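(* Let $B$ be a real separable Banach space with dual $B^*$, let $X,X_1,X_2,\ldots$ be i.i.d. $B$-valued random vectors with law $\mu$, and set $S_n=\sum_{j=1}^nX_j$. Assume $\mathcal{L}(S_n/n^{1/2})$ converges weakly to a nondegenerate probability measure $\gamma$ on $B$ (necessarily centered Gaussian), and let $\{b_n\}$ be positive constants with $b_n/n^{1/2}\to\infty$ and $b_n/n^{2/3}\to0$. Assume that for every $f\in B^*$ there is $t_f>0$ with $E(\|X\|^3e^{t|f(X)|})<\infty$ for $0<|t|<t_f$. Let $D\subset B$ be open and convex with $D\cap H_\gamma\ne\emptyset$ and $0\notin\overline D$, let $a_0$ be the unique dominating point for $(D,\gamma)$ and $g=t_0f\in B^*$ the functional associated with $a_0$ (see context). For $n$ large enough that $\hat\mu(b_ng/n)<\infty$, let $Z_{n,1},\ldots,Z_{n,n}$ be i.i.d. $B$-valued random vectors whose common law has density $\exp\{g(b_nx/n)\}/\hat\mu(b_ng/n)$ with respect to $\mu$. If $\{\sum_{j=1}^n(Z_{n,j}-E(Z_{n,j}))/n^{1/2}\}_n$ is bounded in probability and, for some $\beta>0$, $D$ contains slices whose diameters near $a_0$ dominate the function $\tau(s)=\beta(s|\log s|)^{1/2}$, then $$\liminf_{n\to\infty}n^{-1/2}b_n\,P(S_n/b_n\in D)\exp\{n^{-1}b_n^2\lambda_\gamma(a_0)\}>0.$$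
   Context: Notation: $\hat\mu(f)=\int_B e^{f(x)}\,d\mu(x)$ and $\hat\gamma(f)=\int_B e^{f(x)}\,d\gamma(x)$ for $f\in B^*$. For the centered Gaussian measure $\gamma$, $H_\gamma\subset B$ is the Hilbert space generating $\gamma$: the completion of $S(B^* )$, where $Sf=\int_B xf(x)\,d\gamma(x)$ (Bochner integral), under the inner product $\langle Sf,Sg\rangle_\gamma=\int_B fg\,d\gamma$. The rate function is $\lambda_\gamma(x)=\sup_{f\in B^*}[f(x)-\log\hat\gamma(f)]$, which equals $\|x\|_\gamma^2/2$ for $x\in H_\gamma$ and $+\infty$ otherwise. Dominating point (known facts): for open convex $D$ with $D\cap H_\gamma\ne\emptyset$ and $0\notin\overline D$, there is a unique point $a_0\in\partial D$ (the dominating point for $(D,\gamma)$) such that (i) $\lambda_\gamma(a_0)=\inf_{x\in D}\lambda_\gamma(x)=\inf_{x\in\overline D}\lambda_\gamma(x)<\infty$, and for some $g\in B^*$: (ii) $D\subset\{x:g(x)\ge g(a_0)\}$; (iii) $\lambda_\gamma(a_0)=g(a_0)-\log\hat\gamma(g)$; (iv) $a_0=\int_B x\exp\{g(x)-\log\hat\gamma(g)\}\,d\gamma(x)$ (Bochner integral). Moreover, if $f\in B^*$ satisfies $$( * )\quad \sup_{\{z:\lambda_\gamma(z)\le\lambda_\gamma(a_0)\}}f(z)=f(a_0)<f(x)\quad\forall x\in D$$ (such $f$ exists by Hahn–Banach), there is a unique $t_0>0$ such that $g=t_0f$ satisfies (ii)–(iv). "The functional $g=t_0f$ associated with $a_0$"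 means such a $g$. Slices: $D$ contains slices whose diameters near $a_0$ dominate the function $\tau(s)$ if for some $f\in B^*$ satisfying $( * )$ there exist $x_0\in B$ and $\delta>0$ such that $f(x_0)>0$ and $$\{y+sx_0: f(y)=0,\ \|y\|\le\tau(s),\ 0<s\le\delta\}\subset D-a_0.$$ *)

theory Defs
  imports "HOL-Probability.Probability"
begin

text \<open>
  A real separable Banach space is a type of class \<open>{banach, second_countable_topology}\<close>, and its
  dual is the type \<open>'a \<Rightarrow>\<^sub>L real\<close>.  The library's \<open>weak_conv_m\<close> only treats measures on the real
  line, so weak convergence is defined here for measures on a general topological space.
\<close>

definition weakly_converges :: "(nat \<Rightarrow> 'a::topological_space measure) \<Rightarrow> 'a measure \<Rightarrow> bool" where
  "weakly_converges N \<gamma> \<longleftrightarrow>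
     (\<forall>h :: 'a \<Rightarrow> real. continuous_on UNIV h \<and> bounded (range h) \<longrightarrow>
        (\<lambda>n. LINT x|N n. h x) \<longlonglongrightarrow> (LINT x|\<gamma>. h x))"

text \<open>
  Each \<open>Y n\<close> may live on its own probability space.  For a sequence of random variables it makes no
  difference whether finitely many indices are ignored, since each single variable is bounded in
  probability.
\<close>

definition bounded_in_probability ::
  "(nat \<Rightarrow> 'w measure) \<Rightarrow> (nat \<Rightarrow> 'w \<Rightarrow> 'a::real_normed_vector) \<Rightarrow> bool" where
  "bounded_in_probability N Y \<longleftrightarrow>
     (\<forall>\<epsilon>>0. \<exists>K. \<forall>\<^sub>F n in sequentially. measure (N n) {\<omega> \<in> space (N n). norm (Y n \<omega>) > K} \<le> \<epsilon>)"

text \<open>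
  The Laplace transform takes values in \<open>ennreal\<close> so that its finiteness can be expressed; its
  logarithm takes the value \<open>\<infinity>\<close> where the transform is infinite.  On a probability space the
  transform is never \<open>0\<close>, so \<open>ln 0\<close> does not occur.
\<close>

definition laplace :: "'a::real_normed_vector measure \<Rightarrow> ('a \<Rightarrow>\<^sub>L real) \<Rightarrow> ennreal" where
  "laplace \<mu> f = (\<integral>\<^sup>+x. ennreal (exp (f x)) \<partial>\<mu>)"

definition log_laplace :: "'a::real_normed_vector measure \<Rightarrow> ('a \<Rightarrow>\<^sub>L real) \<Rightarrow> ereal" where
  "log_laplace \<mu> f = (if laplace \<mu> f = \<infinity> then \<infinity> else ereal (ln (enn2real (laplace \<mu> f))))"

definition rate_function :: "'a::real_normed_vector measure \<Rightarrow> 'a \<Rightarrow> ereal" where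
  "rate_function \<gamma> x = (SUP f. ereal (blinfun_apply f x) - log_laplace \<gamma> f)"

definition cov_operator ::
  "'a::{banach, second_countable_topology} measure \<Rightarrow> ('a \<Rightarrow>\<^sub>L real) \<Rightarrow> 'a" where
  "cov_operator \<gamma> f = (LINT x|\<gamma>. f x *\<^sub>R x)"

text \<open>The inner product \<open>\<langle>Sf, Sg\<rangle>\<^sub>\<gamma>\<close>, as a function of the functionals \<open>f\<close> and \<open>g\<close>.\<close>

definition cov_form ::
  "'a::real_normed_vector measure \<Rightarrow> ('a \<Rightarrow>\<^sub>L real) \<Rightarrow> ('a \<Rightarrow>\<^sub>L real) \<Rightarrow> real" where
  "cov_form \<gamma> f g = (LINT x|\<gamma>. f x * g x)"

text \<open>
  The completion of \<open>S(B\<^sup>*)\<close>, realised inside \<open>B\<close>: its points are the limits in \<open>B\<close> of the sequences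
  \<open>S(F\<^sub>n)\<close> that are Cauchy for the norm of \<open>\<langle>\<cdot>, \<cdot>\<rangle>\<^sub>\<gamma>\<close>.  For centered Gaussian \<open>\<gamma>\<close> this norm dominates
  a multiple of the norm of \<open>B\<close>, and the induced map from the abstract completion to \<open>B\<close> is
  injective.
\<close>

definition gen_hilbert_space :: "'a::{banach, second_countable_topology} measure \<Rightarrow> 'a set" where
  "gen_hilbert_space \<gamma> =
     {x. \<exists>F :: nat \<Rightarrow> 'a \<Rightarrow>\<^sub>L real.
           (\<forall>\<epsilon>>0. \<exists>n0. \<forall>m\<ge>n0. \<forall>n\<ge>n0. sqrt (cov_form \<gamma> (F m - F n) (F m - F n)) < \<epsilon>) \<and>
           (\<lambda>n. cov_operator \<gamma> (F n)) \<longlonglongrightarrow> x}"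

text \<open>
  Since \<open>rate_function \<gamma> a0\<close> is nonnegative for every probability measure \<open>\<gamma>\<close>, the second condition
  below forces \<open>log_laplace \<gamma> g\<close> to be finite, so \<open>real_of_ereal\<close> is harmless in the third.
\<close>

definition dominating_functional ::
  "'a::{banach, second_countable_topology} measure \<Rightarrow> 'a set \<Rightarrow> 'a \<Rightarrow> ('a \<Rightarrow>\<^sub>L real) \<Rightarrow> bool" where
  "dominating_functional \<gamma> D a0 g \<longleftrightarrow>
     D \<subseteq> {x. blinfun_apply g x \<ge> g a0} \<and>
     rate_function \<gamma> a0 = ereal (g a0) - log_laplace \<gamma> g \<and>
     has_bochner_integral \<gamma> (\<lambda>x. exp (g x - real_of_ereal (log_laplace \<gamma> g)) *\<^sub>R x) a0"

definition dominating_point ::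
  "'a::{banach, second_countable_topology} measure \<Rightarrow> 'a set \<Rightarrow> 'a \<Rightarrow> bool" where
  "dominating_point \<gamma> D a0 \<longleftrightarrow>
     a0 \<in> frontier D \<and>
     rate_function \<gamma> a0 = (INF x\<in>D. rate_function \<gamma> x) \<and>
     rate_function \<gamma> a0 = (INF x\<in>closure D. rate_function \<gamma> x) \<and>
     rate_function \<gamma> a0 < \<infinity> \<and>
     (\<exists>g. dominating_functional \<gamma> D a0 g)"

definition separating_functional ::
  "'a::real_normed_vector measure \<Rightarrow> 'a set \<Rightarrow> 'a \<Rightarrow> ('a \<Rightarrow>\<^sub>L real) \<Rightarrow> bool" where
  "separating_functional \<gamma> D a0 f \<longleftrightarrow>
     (SUP z\<in>{z. rate_function \<gamma> z \<le> rate_function \<gamma> a0}. ereal (f z)) = ereal (f a0) \<and>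
     (\<forall>x\<in>D. blinfun_apply f a0 < f x)"

definition associated_functional ::
  "'a::{banach, second_countable_topology} measure \<Rightarrow> 'a set \<Rightarrow> 'a \<Rightarrow> ('a \<Rightarrow>\<^sub>L real) \<Rightarrow> bool" where
  "associated_functional \<gamma> D a0 g \<longleftrightarrow>
     (\<exists>f t0. separating_functional \<gamma> D a0 f \<and> t0 > 0 \<and> g = t0 *\<^sub>R f \<and>
             dominating_functional \<gamma> D a0 g)"

definition contains_slices ::
  "'a::real_normed_vector measure \<Rightarrow> 'a set \<Rightarrow> 'a \<Rightarrow> (real \<Rightarrow> real) \<Rightarrow> bool" where
  "contains_slices \<gamma> D a0 \<tau> \<longleftrightarrow>
     (\<exists>f x0 \<delta>. separating_functional \<gamma> D a0 f \<and> \<delta> > 0 \<and> blinfun_apply f x0 > 0 \<and>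
        {y + s *\<^sub>R x0 |y s. f y = 0 \<and> norm y \<le> \<tau> s \<and> 0 < s \<and> s \<le> \<delta>} \<subseteq> (\<lambda>x. x - a0) ` D)"

end

theory Submission
  imports Defs
begin

text \<open>
  Let \<open>L\<close> be the Laplace transform of \<open>\<mu>\<close> at \<open>b\<^sub>n g / n\<close> and \<open>T\<close> the sum of the tilted variables.  Tilting turns
  the probability into \<open>L\<^sup>n E (exp (- (b\<^sub>n / n) g T); T / b\<^sub>n \<in> D)\<close>, and \<open>E T\<close> is \<open>b\<^sub>n a0\<close> up to \<open>O(b\<^sub>n\<^sup>2 / n)\<close>.
  The exponential factor is under control when \<open>g (T - E T)\<close> lies in a window of width of order \<open>n / b\<^sub>n\<close>
  just above \<open>0\<close>, and a local limit estimate gives this window a probability of order \<open>sqrt n / b\<^sub>n\<close>, which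
  is the prefactor to be recovered.

  It remains to have \<open>norm (T - E T) = O(sqrt n)\<close> on a fixed fraction of the window event.  Boundedness in
  probability alone says nothing about an event of vanishing probability.  But if \<open>T - E T\<close> is split
  into two independent halves and one of them is large, the other one still hits the window with
  probability at most a constant times \<open>sqrt n / b\<^sub>n\<close>, so the large values cost only an arbitrarily small
  fraction.  On the remaining event the point \<open>T / b\<^sub>n\<close> is at height of order \<open>s = n / b\<^sub>n\<^sup>2\<close> above \<open>a0\<close> with
  lateral displacement \<open>O(sqrt s)\<close>, which is inside the slices because of their logarithmic factor.

  The functional defining the slices agrees with a positive multiple of \<open>g\<close> almost surely, since both
  attain their maximum over the same ball of the Hilbert space of \<open>\<gamma>\<close> at \<open>a0\<close> (equality in Cauchy-Schwarz).
\<close>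

section \<open>Linear functionals dominated by sublinear ones\<close>

text \<open>No lattice condition is involved, because the window width n / b_n tends to infinity:
  after smoothing by a Gaussian of that width only frequencies below a fixed c count, and there
  variance and third moment control the characteristic function. The other frequencies contribute
  O((b_n / n)^2), which is o(sqrt n / b_n) since b_n^3 / n^(5/2) tends to 0.

  The bound b_n = o(n^(2/3)) says n e^3 -> 0 for the tilt e = b_n / n. This is the order of the
  cubic error in the logarithm of the n-th power of the Laplace transform, and also of e times the
  g-value of the error n (E Z - e a0) in the mean; so both errors cost bounded factors only.

  With v = g a0 the main exponents are n e^2 v / 2 from the Laplace transform and - n e^2 v from the
  tilting factor. They add up to minus b_n^2 / n times v / 2, the rate at a0.

  The window starts at n / b_n and not at 0, so that the error in the mean cannot push T / b_n below
  the height of a0.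

  Of \<gamma> only the one-dimensional marginals are needed, since the rate function sees \<gamma>
  through Laplace transforms alone.\<close>

definition sublinear :: "('a::real_vector \<Rightarrow> real) \<Rightarrow> bool" where
  "sublinear q \<longleftrightarrow> (\<forall>x y. q (x + y) \<le> q x + q y) \<and> (\<forall>c x. 0 \<le> c \<longrightarrow> q (c *\<^sub>R x) \<le> c * q x)"

lemma sublinearI:
  assumes "\<And>x y. q (x + y) \<le> q x + q y" "\<And>c x. 0 \<le> c \<Longrightarrow> q (c *\<^sub>R x) \<le> c * q x"
  shows "sublinear q"
  using assms by (auto simp: sublinear_def)

lemma sublinear_add: "sublinear q \<Longrightarrow> q (x + y) \<le> q x + q y"
  by (simp add: sublinear_def)

lemma sublinear_scale_le: "sublinear q \<Longrightarrow> 0 \<le> c \<Longrightarrow> q (c *\<^sub>R x) \<le> c * q x"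
  by (simp add: sublinear_def)

lemma sublinear_zero: "sublinear q \<Longrightarrow> q 0 = 0"
  using sublinear_scale_le[of q 0 0] sublinear_scale_le[of q 2 0] by simp

lemma sublinear_minus: "sublinear q \<Longrightarrow> - q (- x) \<le> q x"
  using sublinear_add[of q x "- x"] sublinear_zero[of q] by simp

lemma sublinear_scale:
  assumes q: "sublinear q" and c: "0 \<le> c"
  shows "q (c *\<^sub>R x) = c * q x"
proof (cases "c = 0")
  case True
  then show ?thesis using sublinear_zero[OF q] by simp
next
  case False
  with c have "0 < c" by simp
  moreover have "q x \<le> (1 / c) * q (c *\<^sub>R x)"
    using sublinear_scale_le[OF q, of "1 / c" "c *\<^sub>R x"] \<open>0 < c\<close> by simp
  ultimately have "c * q x \<le> q (c *\<^sub>R x)" by (simp add: field_simps)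
  with sublinear_scale_le[OF q c, of x] show ?thesis by simp
qed

text \<open>The perturbation used in proving Hahn-Banach. The choice t = 0 shows that it lies below
  \<open>q\<close>, and t = 1 at \<open>- y\<close> gives at most \<open>- q y\<close>; so every
  linear functional below it is below \<open>q\<close> and takes the value \<open>q y\<close> at
  \<open>y\<close>.\<close>

definition tilt_sublinear :: "('a::real_vector \<Rightarrow> real) \<Rightarrow> 'a \<Rightarrow> 'a \<Rightarrow> real" where
  "tilt_sublinear q y x = (INF t\<in>{0..}. q (x + t *\<^sub>R y) - t * q y)"

context
  fixes q :: "'a::real_vector \<Rightarrow> real" and y :: 'a
  assumes q: "sublinear q"
begin

lemma tilt_sublinear_bdd: "bdd_below ((\<lambda>t. q (x + t *\<^sub>R y) - t * q y) ` {0..})"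
proof (rule bdd_belowI2)
  fix t :: real assume "t \<in> {0..}"
  then have "t * q y \<le> q (x + t *\<^sub>R y) + q (- x)"
    using sublinear_add[OF q, of "x + t *\<^sub>R y" "- x"] sublinear_scale[OF q, of t y] by simp
  then show "- q (- x) \<le> q (x + t *\<^sub>R y) - t * q y" by simp
qed

lemma tilt_sublinear_le: "0 \<le> t \<Longrightarrow> tilt_sublinear q y x \<le> q (x + t *\<^sub>R y) - t * q y"
  unfolding tilt_sublinear_def by (rule cINF_lower[OF tilt_sublinear_bdd]) simp

lemma tilt_sublinear_ge:
  "(\<And>t. 0 \<le> t \<Longrightarrow> a \<le> q (x + t *\<^sub>R y) - t * q y) \<Longrightarrow> a \<le> tilt_sublinear q y x"
  unfolding tilt_sublinear_def by (rule cINF_greatest) auto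

lemma sublinear_tilt: "sublinear (tilt_sublinear q y)"
proof (rule sublinearI)
  fix x x'
  have "tilt_sublinear q y (x + x') - (q (x' + t' *\<^sub>R y) - t' * q y) \<le> tilt_sublinear q y x"
    if t': "0 \<le> t'" for t'
  proof (rule tilt_sublinear_ge)
    fix t :: real assume t: "0 \<le> t"
    have "tilt_sublinear q y (x + x') \<le> q ((x + x') + (t + t') *\<^sub>R y) - (t + t') * q y"
      using t t' by (intro tilt_sublinear_le) simp
    also have "\<dots> \<le> q (x + t *\<^sub>R y) + q (x' + t' *\<^sub>R y) - (t + t') * q y"
      using sublinear_add[OF q, of "x + t *\<^sub>R y" "x' + t' *\<^sub>R y"] by (simp add: algebra_simps)
    finally show "tilt_sublinear q y (x + x') - (q (x' + t' *\<^sub>R y) - t' * q y)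
        \<le> q (x + t *\<^sub>R y) - t * q y"
      by (simp add: algebra_simps)
  qed
  then have "tilt_sublinear q y (x + x') - tilt_sublinear q y x \<le> tilt_sublinear q y x'"
    by (intro tilt_sublinear_ge) (simp add: algebra_simps)
  then show "tilt_sublinear q y (x + x') \<le> tilt_sublinear q y x + tilt_sublinear q y x'" by simp
next
  fix c :: real and x assume c: "0 \<le> c"
  show "tilt_sublinear q y (c *\<^sub>R x) \<le> c * tilt_sublinear q y x"
  proof (cases "c = 0")
    case True
    then show ?thesis using tilt_sublinear_le[of 0 0] sublinear_zero[OF q] by simp
  next
    case False
    with c have c: "0 < c" by simp
    have "tilt_sublinear q y (c *\<^sub>R x) / c \<le> tilt_sublinear q y x"
    proof (rule tilt_sublinear_ge)
      fix t :: real assume t: "0 \<le> t"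
      have "tilt_sublinear q y (c *\<^sub>R x) \<le> q (c *\<^sub>R x + (c * t) *\<^sub>R y) - (c * t) * q y"
        using t c by (intro tilt_sublinear_le) simp
      also have "q (c *\<^sub>R x + (c * t) *\<^sub>R y) = c * q (x + t *\<^sub>R y)"
        using sublinear_scale[OF q, of c "x + t *\<^sub>R y"] c by (simp add: algebra_simps)
      finally show "tilt_sublinear q y (c *\<^sub>R x) / c \<le> q (x + t *\<^sub>R y) - t * q y"
        using c by (simp add: field_simps)
    qed
    then show ?thesis using c by (simp add: field_simps)
  qed
qed

end

text \<open>A minimal sublinear functional below \<open>p\<close> coincides with all its tilts, and is therefore additive.\<close>

lemma sublinear_dominates_linear:
  fixes p :: "'a::real_vector \<Rightarrow> real"
  assumes p: "sublinear p"
  shows "\<exists>h. linear h \<and> (\<forall>x. h x \<le> p x)"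
proof -
  define A where "A = {q. sublinear q \<and> (\<forall>x. q x \<le> p x)}"
  \<comment> \<open>The order is reversed: \<open>?P q r\<close> puts \<open>r\<close> below
    \<open>q\<close>, so the maximal element given by Zorn is a minimal functional.\<close>
  let ?P = "\<lambda>q r::'a \<Rightarrow> real. \<forall>x. r x \<le> q x"
  have "\<exists>m\<in>A. \<forall>a\<in>A. ?P m a \<longrightarrow> a = m"
  proof (rule predicate_Zorn)
    show "partial_order_on A (relation_of ?P A)"
      by (rule partial_order_on_relation_ofI) (auto intro: order_trans antisym simp: fun_eq_iff)
  next
    fix C assume C: "C \<in> Chains (relation_of ?P A)"
    show "\<exists>u\<in>A. \<forall>a\<in>C. ?P a u"
    proof (cases "C = {}")
      case True
      then show ?thesis using p by (auto simp: A_def)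
    next
      case False
      have CA: "a \<in> A" if "a \<in> C" for a
        using C that by (auto simp: Chains_def relation_of_def)
      have Cc: "?P a a' \<or> ?P a' a" if "a \<in> C" "a' \<in> C" for a a'
        using C that by (auto simp: Chains_def relation_of_def)
      define u where "u x = (INF a\<in>C. a x)" for x
      have bdd: "bdd_below ((\<lambda>a. a x) ` C)" for x
      proof (rule bdd_belowI2)
        fix a assume "a \<in> C"
        with CA have a: "sublinear a" "a (- x) \<le> p (- x)" by (auto simp: A_def)
        from sublinear_minus[OF a(1), of x] a(2) show "- p (- x) \<le> a x" by simp
      qed
      have ul: "u x \<le> a x" if "a \<in> C" for a x
        unfolding u_def by (rule cINF_lower[OF bdd that])
      have ug: "b \<le> u x" if "\<And>a. a \<in> C \<Longrightarrow> b \<le> a x" for b x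
        unfolding u_def by (rule cINF_greatest[OF False that])
      have "sublinear u"
      proof (rule sublinearI)
        fix x y
        \<comment> \<open>Different members of the chain may nearly attain the two infima. Being
          comparable, they can both be replaced by the smaller one, for which subadditivity is
          known.\<close>
        have 1: "u (x + y) \<le> a x + a' y" if aa: "a \<in> C" "a' \<in> C" for a a'
          using Cc[OF aa]
        proof
          assume le: "?P a a'"
          have "u (x + y) \<le> a' (x + y)" using ul aa by simp
          also have "\<dots> \<le> a' x + a' y" using CA[OF aa(2)] by (auto simp: A_def sublinear_add)
          also have "\<dots> \<le> a x + a' y" using le by simp
          finally show ?thesis .
        next
          assume le: "?P a' a"
          have "u (x + y) \<le> a (x + y)" using ul aa by simp
          also have "\<dots> \<le> a x + a y" using CA[OF aa(1)] by (auto simp: A_def sublinear_add)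
          also have "\<dots> \<le> a x + a' y" using le by simp
          finally show ?thesis .
        qed
        have "u (x + y) - a' y \<le> u x" if "a' \<in> C" for a'
          using 1 that by (intro ug) (simp add: algebra_simps)
        then have "u (x + y) - u x \<le> u y" by (intro ug) (simp add: algebra_simps)
        then show "u (x + y) \<le> u x + u y" by simp
      next
        fix c :: real and x assume c: "0 \<le> c"
        have 2: "u (c *\<^sub>R x) \<le> c * a x" if "a \<in> C" for a
          using ul[OF that, of "c *\<^sub>R x"] CA[OF that] sublinear_scale_le[OF _ c, of a x]
          by (auto simp: A_def)
        show "u (c *\<^sub>R x) \<le> c * u x"
        proof (cases "c = 0")
          case True
          then show ?thesis using 2 False by auto
        next
          case False
          with c have c: "0 < c" by simp
          have "u (c *\<^sub>R x) / c \<le> u x" using 2 c by (intro ug) (simp add: field_simps)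
          then show ?thesis using c by (simp add: field_simps)
        qed
      qed
      moreover have "u x \<le> p x" for x
      proof -
        from False obtain a where "a \<in> C" by auto
        then show ?thesis using ul[of a x] CA[of a] by (auto simp: A_def intro: order_trans)
      qed
      ultimately show ?thesis using ul by (auto simp: A_def)
    qed
  qed
  then obtain m where m: "m \<in> A" and min: "\<And>a. a \<in> A \<Longrightarrow> (\<And>x. a x \<le> m x) \<Longrightarrow> a = m" by blast
  from m have sm: "sublinear m" and mp: "m x \<le> p x" for x by (auto simp: A_def)
  have tm: "tilt_sublinear m y = m" for y
  proof (rule min)
    show "tilt_sublinear m y x \<le> m x" for x using tilt_sublinear_le[OF sm, of 0 y x] by simp
    with mp show "tilt_sublinear m y \<in> A"
      using sublinear_tilt[OF sm, of y] by (auto simp: A_def intro: order_trans)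
  qed
  \<comment> \<open>The tilt at t = 1 gives \<open>m x \<le> m (x + y) - m y\<close>, which is the
    missing superadditivity.\<close>
  have add: "m (x + y) = m x + m y" for x y
    using tilt_sublinear_le[OF sm, of 1 y x] tm[of y] sublinear_add[OF sm, of x y] by simp
  have minus: "m (- x) = - m x" for x
    using add[of x "- x"] sublinear_zero[OF sm] by simp
  have "m (c *\<^sub>R x) = c * m x" for c x
  proof (cases "0 \<le> c")
    case False
    then show ?thesis using sublinear_scale[OF sm, of "- c" x] minus[of "c *\<^sub>R x"] by simp
  qed (rule sublinear_scale[OF sm])
  with add have "linear m" by (intro linearI) auto
  with mp show ?thesis by blast
qed

text \<open>A linear functional below the norm tilted at \<open>v\<close> is bounded by the norm on
  both \<open>x\<close> and \<open>- x\<close>, hence continuous, and its value at \<open>v\<close>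
  is at least \<open>norm v\<close>.\<close>

lemma exists_blinfun_nonzero:
  fixes v :: "'a::real_normed_vector"
  assumes "v \<noteq> 0"
  shows "\<exists>h::'a \<Rightarrow>\<^sub>L real. blinfun_apply h v \<noteq> 0"
proof -
  have n: "sublinear (norm :: 'a \<Rightarrow> real)" by (rule sublinearI) (auto intro: norm_triangle_ineq)
  obtain h where h: "linear h" and hp: "\<And>x. h x \<le> tilt_sublinear norm v x"
    using sublinear_dominates_linear[OF sublinear_tilt[OF n, of v]] by blast
  have hn: "h x \<le> norm x" for x
    using hp[of x] tilt_sublinear_le[OF n, of 0 v x] by simp
  have "\<bar>h x\<bar> \<le> norm x * 1" for x
    using hn[of x] hn[of "- x"] linear_neg[OF h, of x] by (simp add: abs_le_iff)
  then have bl: "bounded_linear h"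
    using h by (intro bounded_linear_intro[of h 1]) (auto simp: linear_add linear_scale)
  have "h (- v) \<le> - norm v"
    using hp[of "- v"] tilt_sublinear_le[OF n, of 1 v "- v"] by simp
  then have "h v \<noteq> 0" using linear_neg[OF h, of v] assms by auto
  with bl show ?thesis by (intro exI[of _ "Blinfun h"]) (simp add: bounded_linear_Blinfun_apply)
qed

text \<open>The form in which Hahn-Banach is applied: identities between Bochner integrals, for the
  mean of \<open>\<mu>\<close> and for the dominating point, are checked functional by
  functional.\<close>

lemma eq_if_blinfun_eq:
  fixes u v :: "'a::real_normed_vector"
  assumes "\<And>h::'a \<Rightarrow>\<^sub>L real. blinfun_apply h u = blinfun_apply h v"
  shows "u = v"
  using exists_blinfun_nonzero[of "u - v"] assms by (auto simp: blinfun.diff_right)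

section \<open>Gaussian averages and characteristic functions\<close>

abbreviation std_normal :: "real measure" where "std_normal \<equiv> std_normal_distribution"

lemma integral_std_normal:
  fixes f :: "real \<Rightarrow> real"
  assumes "f \<in> borel_measurable borel"
  shows "(LINT u|std_normal. f u) = (LINT u|lborel. std_normal_density u * f u)"
  using assms by (subst integral_density) (auto simp: normal_density_nonneg)

lemma std_normal_second_moment:
  "integrable std_normal (\<lambda>u. u\<^sup>2)" "(LINT u|std_normal. u\<^sup>2) = 1"
proof -
  have "has_bochner_integral lborel (\<lambda>x. std_normal_density x * x ^ 2) 1"
    using std_normal_moment_even[of 1] by (simp add: fact_numeral)
  then show "integrable std_normal (\<lambda>u. u\<^sup>2)" "(LINT u|std_normal. u\<^sup>2) = 1"
    by (auto simp: integral_std_normal integrable_density normal_density_nonneg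
        has_bochner_integral_iff)
qed

lemma integral_exp_neg_square:
  assumes a: "0 < a"
  shows "integrable lborel (\<lambda>u::real. exp (- a * u\<^sup>2))"
    "(LINT u|lborel. exp (- a * u\<^sup>2)) = sqrt (pi / a)"
proof -
  define s where "s = 1 / sqrt (2 * a)"
  have s: "0 < s" "s\<^sup>2 = 1 / (2 * a)" using a by (auto simp: s_def power_divide)
  have eq: "exp (- a * u\<^sup>2) = sqrt (pi / a) * normal_density 0 s u" for u
    using a by (simp add: normal_density_def s real_sqrt_divide real_sqrt_mult)
  show "integrable lborel (\<lambda>u::real. exp (- a * u\<^sup>2))"
    unfolding eq using integrable_normal_density[OF s(1)] by simp
  show "(LINT u|lborel. exp (- a * u\<^sup>2)) = sqrt (pi / a)"
    unfolding eq using integral_normal_density[OF s(1)] by simp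
qed

lemma std_normal_exp_neg_square_le:
  assumes a: "0 < a"
  shows "(LINT u|std_normal. exp (- a * u\<^sup>2)) \<le> 1 / sqrt (2 * a)"
proof -
  have le: "std_normal_density u * exp (- a * u\<^sup>2) \<le> (1 / sqrt (2 * pi)) * exp (- a * u\<^sup>2)" for u
    by (intro mult_right_mono) (auto simp: std_normal_density_def divide_right_mono)
  have int: "integrable lborel (\<lambda>u. (1 / sqrt (2 * pi)) * exp (- a * u\<^sup>2))"
    by (intro integrable_mult_right integral_exp_neg_square(1)[OF a])
  have "(LINT u|std_normal. exp (- a * u\<^sup>2))
      = (LINT u|lborel. std_normal_density u * exp (- a * u\<^sup>2))"
    by (rule integral_std_normal) simp
  also have "\<dots> \<le> (LINT u|lborel. (1 / sqrt (2 * pi)) * exp (- a * u\<^sup>2))"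
  proof (rule integral_mono[OF _ int le])
    show "integrable lborel (\<lambda>u. std_normal_density u * exp (- a * u\<^sup>2))"
      by (rule Bochner_Integration.integrable_bound[OF int])
         (use le in \<open>auto simp: abs_mult normal_density_nonneg\<close>)
  qed
  also have "\<dots> = (1 / sqrt (2 * pi)) * sqrt (pi / a)"
    using integral_exp_neg_square(2)[OF a] by simp
  also have "\<dots> = 1 / sqrt (2 * a)"
    using a by (simp add: real_sqrt_divide real_sqrt_mult)
  finally show ?thesis .
qed

lemma Re_integral:
  fixes f :: "'a \<Rightarrow> complex"
  assumes "integrable M f"
  shows "Re (LINT x|M. f x) = (LINT x|M. Re (f x))"
  using assms by (rule integral_Re[symmetric])

text \<open>The Gaussian is its own Fourier transform, so Fubini turns a Gaussian average of \<open>\<rho>\<close> into an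
  average of its characteristic function.\<close>

lemma gaussian_average_eq_char:
  assumes \<rho>: "real_distribution \<rho>" and L: "0 < L"
  shows "(LINT y|\<rho>. exp (- ((y - x) / L)\<^sup>2 / 2))
    = (LINT u|std_normal. Re (iexp (- (u * x / L)) * char \<rho> (u / L)))"
proof -
  interpret R: real_distribution \<rho> by fact
  interpret N: real_distribution std_normal by (rule real_dist_normal_dist)
  interpret P: pair_prob_space \<rho> std_normal ..
  have sets[measurable_cong]: "sets \<rho> = sets borel" by simp
  have 1: "exp (- ((y - x) / L)\<^sup>2 / 2) = (LINT u|std_normal. cos (u * (y - x) / L))" for y
  proof -
    have "complex_of_real (exp (- ((y - x) / L)\<^sup>2 / 2)) = char std_normal ((y - x) / L)"
      by (simp add: char_std_normal_distribution)
    then have "exp (- ((y - x) / L)\<^sup>2 / 2) = Re (char std_normal ((y - x) / L))"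
      by (metis Re_complex_of_real)
    also have "\<dots> = (LINT u|std_normal. Re (iexp ((y - x) / L * u)))"
      unfolding char_def by (rule Re_integral, rule N.integrable_iexp) auto
    finally show ?thesis by (simp add: Re_exp mult_ac)
  qed
  have 2: "Re (iexp (- (u * x / L)) * char \<rho> (u / L)) = (LINT y|\<rho>. cos (u * (y - x) / L))" for u
  proof -
    have "iexp (- (u * x / L)) * char \<rho> (u / L) = (CLINT y|\<rho>. iexp (- (u * x / L)) * iexp (u / L * y))"
      unfolding char_def by simp
    also have "\<dots> = (CLINT y|\<rho>. iexp (u * (y - x) / L))"
      by (intro Bochner_Integration.integral_cong refl)
         (simp add: exp_add[symmetric] algebra_simps diff_divide_distrib)
    finally have "Re (iexp (- (u * x / L)) * char \<rho> (u / L)) = Re (CLINT y|\<rho>. iexp (u * (y - x) / L))"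
      by simp
    also have "\<dots> = (LINT y|\<rho>. Re (iexp (u * (y - x) / L)))"
      by (rule Re_integral, rule R.integrable_iexp) auto
    finally show ?thesis by (simp add: Re_exp)
  qed
  have "integrable (\<rho> \<Otimes>\<^sub>M std_normal) (case_prod (\<lambda>y u. cos (u * (y - x) / L)))"
    by (rule P.integrable_const_bound[where B = 1]) auto
  from P.Fubini_integral[OF this] show ?thesis
    unfolding 1 2 by simp
qed

lemma integrable_gaussian_average:
  assumes \<rho>: "real_distribution \<rho>"
  shows "integrable \<rho> (\<lambda>y. exp (- ((y - x) / L)\<^sup>2 / 2))"
proof -
  interpret R: real_distribution \<rho> by fact
  show ?thesis by (rule R.integrable_const_bound[where B = 1]) auto
qed

text \<open>Frequencies up to \<open>c\<close> are covered by the assumed Gaussian decay. For the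
  others the characteristic function is at most 1, and Chebyshev's bound
  \<open>u\<^sup>2 / (c * L)\<^sup>2\<close> integrates to the second term. The bound does not
  depend on the centre \<open>x\<close>, which is what makes it a concentration estimate.\<close>

lemma gaussian_average_upper:
  assumes \<rho>: "real_distribution \<rho>" and L: "0 < L" and a: "0 < a" and c: "0 < c"
    and bound: "\<And>s. \<bar>s\<bar> \<le> c \<Longrightarrow> cmod (char \<rho> s) \<le> exp (- a * s\<^sup>2)"
  shows "(LINT y|\<rho>. exp (- ((y - x) / L)\<^sup>2 / 2)) \<le> L / sqrt (2 * a) + 1 / (c * L)\<^sup>2"
proof -
  interpret R: real_distribution \<rho> by fact
  interpret N: real_distribution std_normal by (rule real_dist_normal_dist)
  define F where "F u = exp (- (a / L\<^sup>2) * u\<^sup>2) + u\<^sup>2 / (c * L)\<^sup>2" for u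
  have le: "Re (iexp (- (u * x / L)) * char \<rho> (u / L)) \<le> F u" for u
  proof -
    have "Re (iexp (- (u * x / L)) * char \<rho> (u / L)) \<le> cmod (char \<rho> (u / L))"
      by (rule order_trans[OF complex_Re_le_cmod]) (simp add: norm_mult)
    also have "\<dots> \<le> F u"
    proof (cases "\<bar>u / L\<bar> \<le> c")
      case True
      from bound[OF this] show ?thesis
        unfolding F_def by (auto simp: power_divide intro: order_trans)
    next
      case False
      then have "c * L \<le> \<bar>u\<bar>" using L by (simp add: field_simps)
      then have "(c * L)\<^sup>2 \<le> u\<^sup>2" using c L by (metis abs_le_square_iff abs_of_pos mult_pos_pos)
      then have "1 \<le> u\<^sup>2 / (c * L)\<^sup>2" using c L by simp
      moreover have "0 \<le> exp (- (a / L\<^sup>2) * u\<^sup>2)" by simp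
      ultimately show ?thesis using R.cmod_char_le_1[of "u / L"] unfolding F_def by linarith
    qed
    finally show ?thesis .
  qed
  have iE: "integrable std_normal (\<lambda>u. exp (- (a / L\<^sup>2) * u\<^sup>2))"
    using a by (intro N.integrable_const_bound[where B = 1]) auto
  have iF: "integrable std_normal F"
    unfolding F_def using iE std_normal_second_moment(1) by simp
  have m: "char \<rho> \<in> borel_measurable borel" by (rule R.char_measurable)
  have iL: "integrable std_normal (\<lambda>u. Re (iexp (- (u * x / L)) * char \<rho> (u / L)))"
  proof (rule N.integrable_const_bound[where B = 1])
    show "AE u in std_normal. norm (Re (iexp (- (u * x / L)) * char \<rho> (u / L))) \<le> 1"
    proof (rule AE_I2)
      fix u
      show "norm (Re (iexp (- (u * x / L)) * char \<rho> (u / L))) \<le> 1"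
        using abs_Re_le_cmod[of "iexp (- (u * x / L)) * char \<rho> (u / L)"] R.cmod_char_le_1[of "u / L"]
        by (simp add: norm_mult)
    qed
  qed (use m in measurable)
  have "(LINT y|\<rho>. exp (- ((y - x) / L)\<^sup>2 / 2)) \<le> (LINT u|std_normal. F u)"
    unfolding gaussian_average_eq_char[OF \<rho> L] by (rule integral_mono[OF iL iF le])
  also have "\<dots> = (LINT u|std_normal. exp (- (a / L\<^sup>2) * u\<^sup>2)) + 1 / (c * L)\<^sup>2"
    unfolding F_def using iE std_normal_second_moment by simp
  also have "(LINT u|std_normal. exp (- (a / L\<^sup>2) * u\<^sup>2)) \<le> 1 / sqrt (2 * (a / L\<^sup>2))"
    using a L by (intro std_normal_exp_neg_square_le) simp
  also have "1 / sqrt (2 * (a / L\<^sup>2)) = L / sqrt (2 * a)"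
    using L by (simp add: real_sqrt_divide)
  finally show ?thesis by simp
qed

text \<open>A smoothed local limit theorem. The substitution u = t L / sqrt n brings the frequency
  to \<open>t / sqrt n\<close>, where the central limit theorem acts, while the Gaussian weight
  flattens to its value at 0 because L / sqrt n -> 0. A centre at a fixed multiple \<open>A\<close>
  of the width is invisible in the limit for the same reason.\<close>

lemma gaussian_average_limit:
  fixes \<rho> :: "nat \<Rightarrow> real measure" and L :: "nat \<Rightarrow> real"
  assumes \<rho>: "\<And>n. n \<ge> n0 \<Longrightarrow> real_distribution (\<rho> n)"
    and bound: "\<And>n s. n \<ge> n0 \<Longrightarrow> \<bar>s\<bar> \<le> c \<Longrightarrow> cmod (char (\<rho> n) s) \<le> exp (- (\<kappa> * real n) * s\<^sup>2)"
    and lim: "\<And>t. (\<lambda>n. char (\<rho> n) (t / sqrt n)) \<longlonglongrightarrow> complex_of_real (exp (- (v * t\<^sup>2) / 2))"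
    and pos: "0 < c" "0 < \<kappa>" "0 < v"
    and L: "\<And>n. n \<ge> n0 \<Longrightarrow> 0 < L n"
    and L0: "(\<lambda>n. L n / sqrt n) \<longlonglongrightarrow> 0" and L3: "(\<lambda>n. sqrt n / (L n)^3) \<longlonglongrightarrow> 0"
    and n0: "n0 \<ge> 1"
  shows "(\<lambda>n. sqrt n / L n * (LINT y|\<rho> n. exp (- ((y - A * L n) / L n)\<^sup>2 / 2))) \<longlonglongrightarrow> 1 / sqrt v"
proof -
  define \<l> where "\<l> n = L n / sqrt (real n)" for n
  \<comment> \<open>The value 0 below \<open>n0\<close> makes measurability and the dominating bound
    hold for all indices, as dominated convergence requires.\<close>
  define H where "H n t = (if n0 \<le> n then std_normal_density (\<l> n * t) *
    Re (iexp (- (\<l> n * t * A)) * char (\<rho> n) (t / sqrt n)) else 0)" for n t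
  define H1 where "H1 n t = (if \<bar>t\<bar> \<le> c * sqrt n then H n t else 0)" for n t
  define H2 where "H2 n t = (if \<bar>t\<bar> \<le> c * sqrt n then 0 else H n t)" for n t
  have cm: "n0 \<le> n \<Longrightarrow> char (\<rho> n) \<in> borel_measurable borel" for n
    by (rule real_distribution.char_measurable[OF \<rho>])
  have \<l>: "0 < \<l> n" if "n0 \<le> n" for n using L[OF that] n0 that by (simp add: \<l>_def)
  have Hm[measurable]: "H n \<in> borel_measurable borel" for n
    unfolding H_def using cm[of n] by (cases "n0 \<le> n") auto
  have Hle: "\<bar>H n t\<bar> \<le> std_normal_density (\<l> n * t) * cmod (char (\<rho> n) (t / sqrt n))"
    if "n0 \<le> n" for n t
  proof -
    have "\<bar>Re (iexp (- (\<l> n * t * A)) * char (\<rho> n) (t / sqrt n))\<bar> \<le> cmod (char (\<rho> n) (t / sqrt n))"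
      by (rule order_trans[OF abs_Re_le_cmod]) (simp add: norm_mult)
    then show ?thesis using that
      by (simp add: H_def abs_mult normal_density_nonneg mult_left_mono)
  qed
  have dens_le: "std_normal_density u \<le> 1" for u
  proof -
    have "std_normal_density u \<le> 1 / sqrt (2 * pi)"
      by (auto simp: std_normal_density_def divide_right_mono)
    also have "\<dots> \<le> 1" using pi_gt3 by simp
    finally show ?thesis .
  qed
  have H1le: "\<bar>H1 n t\<bar> \<le> exp (- \<kappa> * t\<^sup>2)" for n t
  proof (cases "n0 \<le> n \<and> \<bar>t\<bar> \<le> c * sqrt n")
    case True
    then have n: "n0 \<le> n" "0 < n" using n0 by auto
    have "\<bar>t / sqrt n\<bar> \<le> c" using True n by (simp add: field_simps)
    from bound[OF n(1) this] have "cmod (char (\<rho> n) (t / sqrt n)) \<le> exp (- \<kappa> * t\<^sup>2)"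
      using n by (simp add: power_divide)
    then have "std_normal_density (\<l> n * t) * cmod (char (\<rho> n) (t / sqrt n)) \<le> 1 * exp (- \<kappa> * t\<^sup>2)"
      by (intro mult_mono dens_le) auto
    with Hle[OF n(1), of t] True show ?thesis by (simp add: H1_def)
  next
    case False
    then show ?thesis by (auto simp: H1_def H_def)
  qed
  have iexpk: "integrable lborel (\<lambda>t. exp (- \<kappa> * t\<^sup>2))"
    by (rule integral_exp_neg_square) fact
  have H1m[measurable]: "H1 n \<in> borel_measurable borel" for n
    unfolding H1_def by measurable
  have H2m[measurable]: "H2 n \<in> borel_measurable borel" for n
    unfolding H2_def by measurable
  have H1lim: "(\<lambda>n. H1 n t) \<longlonglongrightarrow> (1 / sqrt (2 * pi)) * exp (- (v / 2) * t\<^sup>2)" for t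
  proof -
    have l0: "\<l> \<longlonglongrightarrow> 0" unfolding \<l>_def by (rule L0)
    have "filterlim (\<lambda>n. c * sqrt (real n)) at_top sequentially"
      by (intro filterlim_tendsto_pos_mult_at_top[OF tendsto_const pos(1)]
          filterlim_compose[OF sqrt_at_top filterlim_real_sequentially])
    then have "eventually (\<lambda>n. \<bar>t\<bar> \<le> c * sqrt (real n)) sequentially"
      by (simp add: filterlim_at_top)
    moreover have "eventually (\<lambda>n. n0 \<le> n) sequentially" by (rule eventually_ge_at_top)
    ultimately have ev: "eventually (\<lambda>n. std_normal_density (\<l> n * t) *
      Re (iexp (- (\<l> n * t * A)) * char (\<rho> n) (t / sqrt n)) = H1 n t) sequentially"
      by eventually_elim (simp add: H1_def H_def)
    have "(\<lambda>n. (1 / sqrt (2 * pi)) * exp (- (\<l> n * t)\<^sup>2 / 2) *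
      Re (iexp (- (\<l> n * t * A)) * char (\<rho> n) (t / sqrt n))) \<longlonglongrightarrow>
      (1 / sqrt (2 * pi)) * exp (- (0 * t)\<^sup>2 / 2) *
      Re (iexp (- (0 * t * A)) * complex_of_real (exp (- (v * t\<^sup>2) / 2)))"
      by (intro tendsto_intros l0 lim) auto
    then have "(\<lambda>n. std_normal_density (\<l> n * t) *
      Re (iexp (- (\<l> n * t * A)) * char (\<rho> n) (t / sqrt n))) \<longlonglongrightarrow> (1 / sqrt (2 * pi)) * exp (- (v / 2) * t\<^sup>2)"
      by (simp add: std_normal_density_def)
    then show ?thesis by (rule Lim_transform_eventually[OF _ ev])
  qed
  have iH1: "integrable lborel (H1 n)" for n
    by (rule Bochner_Integration.integrable_bound[OF iexpk]) (use H1le in auto)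
  have lim1: "(\<lambda>n. LINT t|lborel. H1 n t) \<longlonglongrightarrow> (LINT t|lborel. (1 / sqrt (2 * pi)) * exp (- (v / 2) * t\<^sup>2))"
  proof (rule integral_dominated_convergence[where w = "\<lambda>t. exp (- \<kappa> * t\<^sup>2)"])
    show "H1 n \<in> borel_measurable lborel" for n using iH1 by auto
  qed (use iexpk H1lim H1le in auto)
  have "(LINT t|lborel. (1 / sqrt (2 * pi)) * exp (- (v / 2) * t\<^sup>2)) = (1 / sqrt (2 * pi)) * sqrt (pi / (v / 2))"
    using integral_exp_neg_square(2)[of "v / 2"] pos(3) by simp
  also have "\<dots> = 1 / sqrt v" using pos(3) by (simp add: real_sqrt_divide real_sqrt_mult)
  finally have lim1: "(\<lambda>n. LINT t|lborel. H1 n t) \<longlonglongrightarrow> 1 / sqrt v" using lim1 by simp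
  have H2: "integrable lborel (H2 n)" "\<bar>LINT t|lborel. H2 n t\<bar> \<le> (1 / c\<^sup>2) * (sqrt n / (L n)^3)"
    if n: "n0 \<le> n" for n
  proof -
    interpret R: real_distribution "\<rho> n" by (rule \<rho>[OF n])
    have n': "0 < real n" using n n0 by simp
    have hb: "has_bochner_integral lborel (\<lambda>x. std_normal_density x * x ^ 2) 1"
      using std_normal_moment_even[of 1] by (simp add: fact_numeral)
    then have "has_bochner_integral lborel (\<lambda>t. std_normal_density (0 + \<l> n * t) * (0 + \<l> n * t) ^ 2) (1 /\<^sub>R \<bar>\<l> n\<bar>)"
      using \<l>[OF n] by (subst (asm) lborel_has_bochner_integral_real_affine_iff[of "\<l> n" _ _ 0]) auto
    \<comment> \<open>Beyond \<open>c * sqrt n\<close> the factor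
      \<open>t\<^sup>2 / (c\<^sup>2 * n)\<close> is at least 1. Written in terms of
      \<open>\<l> n * t\<close> it becomes this prefactor times the rescaled second moment of the
      normal law, which yields \<open>sqrt n / (L n)^3\<close>.\<close>
    then have hb: "has_bochner_integral lborel (\<lambda>t. (1 / (\<l> n)\<^sup>2 / (c\<^sup>2 * n)) * (std_normal_density (\<l> n * t) * (\<l> n * t) ^ 2))
        ((1 / (\<l> n)\<^sup>2 / (c\<^sup>2 * n)) * (1 / \<l> n))"
      using \<l>[OF n] by (intro has_bochner_integral_mult_right) (auto simp: field_simps)
    have le: "\<bar>H2 n t\<bar> \<le> (1 / (\<l> n)\<^sup>2 / (c\<^sup>2 * n)) * (std_normal_density (\<l> n * t) * (\<l> n * t) ^ 2)" for t
    proof (cases "\<bar>t\<bar> \<le> c * sqrt n")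
      case True
      then show ?thesis by (auto simp: H2_def normal_density_nonneg)
    next
      case False
      then have "(c * sqrt n)\<^sup>2 \<le> t\<^sup>2"
        using pos(1) by (subst abs_le_square_iff[symmetric]) auto
      then have t: "c\<^sup>2 * n \<le> t\<^sup>2" by (simp add: power_mult_distrib)
      have "std_normal_density (\<l> n * t) * cmod (char (\<rho> n) (t / sqrt n)) \<le> std_normal_density (\<l> n * t) * 1"
        by (intro mult_left_mono R.cmod_char_le_1 normal_density_nonneg)
      with Hle[OF n, of t] have "\<bar>H2 n t\<bar> \<le> std_normal_density (\<l> n * t) * 1"
        using False by (simp add: H2_def)
      also have "\<dots> \<le> std_normal_density (\<l> n * t) * (t\<^sup>2 / (c\<^sup>2 * n))"
        using t pos n' by (intro mult_left_mono normal_density_nonneg) simp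
      also have "\<dots> = (1 / (\<l> n)\<^sup>2 / (c\<^sup>2 * n)) * (std_normal_density (\<l> n * t) * (\<l> n * t) ^ 2)"
        using \<l>[OF n] by (simp add: power_mult_distrib)
      finally show ?thesis .
    qed
    show i2: "integrable lborel (H2 n)"
      by (rule Bochner_Integration.integrable_bound[OF has_bochner_integral_iff[THEN iffD1, OF hb, THEN conjunct1]])
         (use le in \<open>auto simp: normal_density_nonneg abs_mult\<close>)
    have "\<bar>LINT t|lborel. H2 n t\<bar> \<le> (LINT t|lborel. \<bar>H2 n t\<bar>)"
      by (rule integral_abs_bound)
    also have "\<dots> \<le> (LINT t|lborel. (1 / (\<l> n)\<^sup>2 / (c\<^sup>2 * n)) * (std_normal_density (\<l> n * t) * (\<l> n * t) ^ 2))"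
      using hb i2 le by (intro integral_mono) (auto simp: has_bochner_integral_iff)
    also have "\<dots> = (1 / (\<l> n)\<^sup>2 / (c\<^sup>2 * n)) * (1 / \<l> n)"
      using hb by (simp add: has_bochner_integral_iff)
    also have "\<dots> = (1 / c\<^sup>2) * (sqrt n / (L n)^3)"
    proof -
      have "(\<l> n)^3 * n = (L n)^3 / sqrt n"
        using n' by (simp add: \<l>_def power_divide power3_eq_cube field_simps)
      moreover have "(1 / (\<l> n)\<^sup>2 / (c\<^sup>2 * n)) * (1 / \<l> n) = 1 / (c\<^sup>2 * ((\<l> n)^3 * n))"
        by (simp add: power3_eq_cube power2_eq_square mult_ac)
      ultimately show ?thesis by simp
    qed
    finally show "\<bar>LINT t|lborel. H2 n t\<bar> \<le> (1 / c\<^sup>2) * (sqrt n / (L n)^3)" .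
  qed
  have eq: "sqrt n / L n * (LINT y|\<rho> n. exp (- ((y - A * L n) / L n)\<^sup>2 / 2))
      = (LINT t|lborel. H1 n t) + (LINT t|lborel. H2 n t)" if n: "n0 \<le> n" for n
  proof -
    have n': "0 < real n" using n n0 by simp
    have Ln: "0 < L n" using L[OF n] .
    have cm'[measurable]: "char (\<rho> n) \<in> borel_measurable borel" using cm[OF n] .
    have "(LINT y|\<rho> n. exp (- ((y - A * L n) / L n)\<^sup>2 / 2))
      = (LINT u|std_normal. Re (iexp (- (u * (A * L n) / L n)) * char (\<rho> n) (u / L n)))"
      by (rule gaussian_average_eq_char[OF \<rho>[OF n] Ln])
    also have "\<dots> = (LINT u|std_normal. Re (iexp (- (u * A)) * char (\<rho> n) (u / L n)))"
      using Ln by simp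
    also have "\<dots> = (LINT u|lborel. std_normal_density u * Re (iexp (- (u * A)) * char (\<rho> n) (u / L n)))"
      by (intro integral_std_normal) measurable
    also have "\<dots> = \<bar>\<l> n\<bar> *\<^sub>R (LINT t|lborel. std_normal_density (0 + \<l> n * t) *
        Re (iexp (- ((0 + \<l> n * t) * A)) * char (\<rho> n) ((0 + \<l> n * t) / L n)))"
      using \<l>[OF n] by (intro lborel_integral_real_affine) simp
    also have "\<dots> = \<l> n * (LINT t|lborel. H n t)"
    proof -
      have "(\<l> n * t) / L n = t / sqrt n" for t using Ln by (simp add: \<l>_def)
      then show ?thesis using \<l>[OF n] n by (simp add: H_def)
    qed
    also have "(LINT t|lborel. H n t) = (LINT t|lborel. H1 n t + H2 n t)"
      by (intro Bochner_Integration.integral_cong) (auto simp: H1_def H2_def)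
    also have "\<dots> = (LINT t|lborel. H1 n t) + (LINT t|lborel. H2 n t)"
      by (rule Bochner_Integration.integral_add[OF iH1 H2(1)[OF n]])
    finally show ?thesis using Ln n' by (simp add: \<l>_def)
  qed
  have lim2: "(\<lambda>n. LINT t|lborel. H2 n t) \<longlonglongrightarrow> 0"
  proof (rule Lim_null_comparison)
    show "(\<lambda>n. (1 / c\<^sup>2) * (sqrt n / (L n)^3)) \<longlonglongrightarrow> 0"
      using tendsto_mult_right_zero[OF L3, of "1 / c\<^sup>2"] by simp
    show "\<forall>\<^sub>F n in sequentially. norm (LINT t|lborel. H2 n t) \<le> (1 / c\<^sup>2) * (sqrt n / (L n)^3)"
      using eventually_ge_at_top[of n0] by eventually_elim (use H2(2) in auto)
  qed
  have "(\<lambda>n. (LINT t|lborel. H1 n t) + (LINT t|lborel. H2 n t)) \<longlonglongrightarrow> 1 / sqrt v + 0"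
    by (intro tendsto_add lim1 lim2)
  then have T: "(\<lambda>n. (LINT t|lborel. H1 n t) + (LINT t|lborel. H2 n t)) \<longlonglongrightarrow> 1 / sqrt v" by simp
  show ?thesis
    by (rule Lim_transform_eventually[OF T], rule eventually_mono[OF eventually_ge_at_top[of n0]])
       (rule eq[symmetric])
qed

section \<open>Characteristic functions of centered laws with bounded third moment\<close>

definition centered_law :: "real measure \<Rightarrow> real \<Rightarrow> real \<Rightarrow> bool" where
  "centered_law \<nu> v C \<longleftrightarrow> real_distribution \<nu> \<and> integrable \<nu> (\<lambda>x. \<bar>x\<bar>^3) \<and>
     (LINT x|\<nu>. x) = 0 \<and> (LINT x|\<nu>. x\<^sup>2) = v \<and> (LINT x|\<nu>. \<bar>x\<bar>^3) \<le> C"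

lemma abs_cube_eq: "\<bar>t\<bar>^3 = t\<^sup>2 * \<bar>t::real\<bar>"
proof -
  have "\<bar>t\<bar>^3 = \<bar>t\<bar>\<^sup>2 * \<bar>t\<bar>" by (simp add: power3_eq_cube power2_eq_square)
  then show ?thesis by simp
qed

lemma abs_diff_cube_le: "\<bar>a - b\<bar> ^ 3 \<le> 8 * (\<bar>a\<bar> ^ 3 + \<bar>b :: real\<bar> ^ 3)"
proof -
  have "\<bar>a - b\<bar> \<le> 2 * max \<bar>a\<bar> \<bar>b\<bar>" by simp
  then have "\<bar>a - b\<bar> ^ 3 \<le> (2 * max \<bar>a\<bar> \<bar>b\<bar>) ^ 3" by (intro power_mono) auto
  also have "\<dots> = 8 * (max \<bar>a\<bar> \<bar>b\<bar>) ^ 3" by (simp add: power_mult_distrib)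
  also have "\<dots> \<le> 8 * (\<bar>a\<bar> ^ 3 + \<bar>b\<bar> ^ 3)" by (intro mult_left_mono) (auto simp: max_def)
  finally show ?thesis .
qed

lemma abs_power_le_cube: "k \<le> 3 \<Longrightarrow> \<bar>x\<bar>^k \<le> 1 + \<bar>x::real\<bar>^3"
proof (cases "\<bar>x\<bar> \<le> 1")
  case True
  then have "\<bar>x\<bar>^k \<le> 1" by (simp add: power_le_one)
  then show ?thesis using zero_le_power_abs[of x 3] by linarith
next
  case False
  assume "k \<le> 3"
  then have "\<bar>x\<bar>^k \<le> \<bar>x\<bar>^3" using False by (intro power_increasing) auto
  then show ?thesis by simp
qed

text \<open>The error depends on the law only through \<open>C\<close>, an upper bound for the third
  absolute moment; one constant therefore serves the whole family of tilted laws.\<close>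

lemma char_taylor_bound:
  assumes "centered_law \<nu> v C"
  shows "cmod (char \<nu> t - complex_of_real (1 - t\<^sup>2 * v / 2)) \<le> \<bar>t\<bar>^3 * C / 6"
proof -
  interpret R: real_distribution \<nu> using assms by (simp add: centered_law_def)
  have i3: "integrable \<nu> (\<lambda>x. \<bar>x\<bar>^3)" and m: "(LINT x|\<nu>. x) = 0"
    and v: "(LINT x|\<nu>. x\<^sup>2) = v" and C: "(LINT x|\<nu>. \<bar>x\<bar>^3) \<le> C"
    using assms by (auto simp: centered_law_def)
  have i: "integrable \<nu> (\<lambda>x. x^k)" if "k \<le> 3" for k
  proof (rule Bochner_Integration.integrable_bound)
    show "integrable \<nu> (\<lambda>x. 1 + \<bar>x\<bar>^3)" using i3 by simp
    show "AE x in \<nu>. norm (x ^ k) \<le> norm (1 + \<bar>x\<bar> ^ 3)"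
    proof (rule AE_I2)
      fix x :: real
      show "norm (x ^ k) \<le> norm (1 + \<bar>x\<bar> ^ 3)"
        using abs_power_le_cube[OF that, of x] by (simp add: power_abs)
    qed
  qed auto
  have imin: "integrable \<nu> (\<lambda>x. min (6 * x\<^sup>2) (\<bar>t\<bar> * \<bar>x\<bar> ^ 3))"
    by (rule Bochner_Integration.integrable_bound[of _ "\<lambda>x. 6 * x\<^sup>2"]) (use i[of 2] in auto)
  have "cmod (char \<nu> t - (1 - t\<^sup>2 * v / 2)) \<le> (t\<^sup>2 / 6) * R.expectation (\<lambda>x. min (6 * x\<^sup>2) (\<bar>t\<bar> * \<bar>x\<bar> ^ 3))"
    using i[of 1] i[of 2] m v by (intro R.char_approx3) auto
  also have "\<dots> \<le> (t\<^sup>2 / 6) * (\<bar>t\<bar> * C)"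
  proof (intro mult_left_mono)
    have "R.expectation (\<lambda>x. min (6 * x\<^sup>2) (\<bar>t\<bar> * \<bar>x\<bar> ^ 3)) \<le> R.expectation (\<lambda>x. \<bar>t\<bar> * \<bar>x\<bar> ^ 3)"
      using i3 by (intro integral_mono imin) auto
    also have "\<dots> \<le> \<bar>t\<bar> * C" using C by (simp add: mult_left_mono)
    finally show "R.expectation (\<lambda>x. min (6 * x\<^sup>2) (\<bar>t\<bar> * \<bar>x\<bar> ^ 3)) \<le> \<bar>t\<bar> * C" .
  qed simp
  also have "\<dots> = \<bar>t\<bar>^3 * C / 6"
    by (simp add: abs_cube_eq)
  finally show ?thesis by simp
qed

lemma centered_law_third_nonneg: "centered_law \<nu> v C \<Longrightarrow> 0 \<le> C"
  unfolding centered_law_def by (elim conjE, rule order_trans[OF integral_nonneg_AE]) auto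

lemma centered_law_var_nonneg: "centered_law \<nu> v C \<Longrightarrow> 0 \<le> v"
  unfolding centered_law_def by (auto intro: integral_nonneg_AE)

text \<open>The first bound on \<open>t\<close> makes the quadratic Taylor polynomial nonnegative,
  the second makes the cubic error at most \<open>t\<^sup>2 * v0 / 6\<close>. The quadratic term
  gives at least \<open>t\<^sup>2 * v0 / 4\<close>, and 1/4 - 1/6 = 1/12. The \<open>C + 1\<close>
  avoids division by zero.\<close>

lemma char_gaussian_bound:
  assumes \<nu>: "centered_law \<nu> v C" and v: "v0 / 2 \<le> v" "v \<le> 2 * v0" and v0: "0 < v0"
    and t: "\<bar>t\<bar> \<le> min (1 / sqrt v0) (v0 / (C + 1))"
  shows "cmod (char \<nu> t) \<le> exp (- (v0 / 12) * t\<^sup>2)"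
proof -
  have C: "0 \<le> C" by (rule centered_law_third_nonneg[OF \<nu>])
  have "\<bar>t\<bar> * sqrt v0 \<le> 1" using t v0 by (simp add: field_simps)
  then have "(\<bar>t\<bar> * sqrt v0)\<^sup>2 \<le> 1" using v0 by (simp add: abs_square_le_1 abs_mult)
  then have "t\<^sup>2 * v0 \<le> 1" using v0 by (simp add: power_mult_distrib)
  moreover have "t\<^sup>2 * v \<le> t\<^sup>2 * (2 * v0)" using v by (intro mult_left_mono) auto
  ultimately have 1: "t\<^sup>2 * v / 2 \<le> 1" by simp
  have "\<bar>t\<bar> * (C + 1) \<le> v0" using t C by (simp add: field_simps)
  then have tC: "\<bar>t\<bar> * C \<le> v0" using C by (simp add: algebra_simps)
  have "\<bar>t\<bar>^3 * C / 6 = t\<^sup>2 / 6 * (\<bar>t\<bar> * C)"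
    by (simp add: abs_cube_eq)
  also have "\<dots> \<le> t\<^sup>2 / 6 * v0" using tC by (intro mult_left_mono) auto
  finally have 2: "\<bar>t\<bar>^3 * C / 6 \<le> t\<^sup>2 * v0 / 6" by simp
  have 3: "t\<^sup>2 * (v0 / 2) \<le> t\<^sup>2 * v" using v by (intro mult_left_mono) auto
  have "cmod (char \<nu> t) \<le> cmod (complex_of_real (1 - t\<^sup>2 * v / 2)) + \<bar>t\<bar>^3 * C / 6"
    using norm_triangle_sub[of "char \<nu> t" "complex_of_real (1 - t\<^sup>2 * v / 2)"]
      char_taylor_bound[OF \<nu>, of t] by linarith
  also have "cmod (complex_of_real (1 - t\<^sup>2 * v / 2)) = 1 - t\<^sup>2 * v / 2"
    using 1 by (simp only: norm_of_real)
  also have "1 - t\<^sup>2 * v / 2 + \<bar>t\<bar>^3 * C / 6 \<le> 1 + (- (v0 / 12) * t\<^sup>2)"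
    using 2 3 by (simp add: algebra_simps)
  also have "\<dots> \<le> exp (- (v0 / 12) * t\<^sup>2)" by (rule exp_ge_add_one_self)
  finally show ?thesis .
qed

lemma char_power_tendsto:
  assumes \<nu>: "\<And>n. n \<ge> n0 \<Longrightarrow> centered_law (\<nu> n) (v n) C" and v: "v \<longlonglongrightarrow> v0"
  shows "(\<lambda>n. char (\<nu> n) (t / sqrt n) ^ n) \<longlonglongrightarrow> complex_of_real (exp (- (v0 * t\<^sup>2) / 2))"
proof -
  define w where "w n = 1 + (- (v0 * t\<^sup>2) / 2) / real n" for n
  have v0: "0 \<le> v0"
  proof (rule tendsto_lowerbound[OF v])
    show "\<forall>\<^sub>F n in sequentially. 0 \<le> v n"
      using eventually_ge_at_top[of n0] by eventually_elim (rule centered_law_var_nonneg[OF \<nu>])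
  qed simp
  \<comment> \<open>Powers of numbers in the unit disc satisfy |z^n - w^n| <= n |z - w|. The
    comparison number \<open>w n\<close> lies in the disc as soon as n is at least
    \<open>v0 * t\<^sup>2 / 4\<close>, which explains the threshold.\<close>
  have ev: "\<forall>\<^sub>F n in sequentially. cmod (char (\<nu> n) (t / sqrt n) ^ n - complex_of_real (w n) ^ n)
      \<le> t\<^sup>2 / 2 * \<bar>v n - v0\<bar> + \<bar>t\<bar>^3 * C / 6 * (1 / sqrt n)"
    using eventually_ge_at_top[of "max (max 1 n0) (nat \<lceil>v0 * t\<^sup>2 / 4\<rceil>)"]
  proof eventually_elim
    fix n assume "max (max 1 n0) (nat \<lceil>v0 * t\<^sup>2 / 4\<rceil>) \<le> n"
    then have n: "1 \<le> n" "n0 \<le> n" and n4: "v0 * t\<^sup>2 / 4 \<le> n" by auto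
    interpret R: real_distribution "\<nu> n" using \<nu>[OF n(2)] by (simp add: centered_law_def)
    have w1: "cmod (complex_of_real (w n)) \<le> 1"
      using v0 n n4 unfolding norm_of_real w_def by (auto simp: abs_le_iff field_simps)
    have "cmod (char (\<nu> n) (t / sqrt n) ^ n - complex_of_real (w n) ^ n)
      \<le> n * cmod (char (\<nu> n) (t / sqrt n) - complex_of_real (w n))"
      by (intro norm_power_diff w1 R.cmod_char_le_1)
    also have "\<dots> \<le> n * ((t / sqrt n)\<^sup>2 / 2 * \<bar>v n - v0\<bar> + \<bar>t / sqrt n\<bar>^3 * C / 6)"
    proof (intro mult_left_mono)
      have "cmod (complex_of_real (1 - (t / sqrt n)\<^sup>2 * v n / 2) - complex_of_real (w n)) = (t / sqrt n)\<^sup>2 / 2 * \<bar>v n - v0\<bar>"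
      proof -
        have "1 - (t / sqrt n)\<^sup>2 * v n / 2 - w n = - ((t / sqrt n)\<^sup>2 / 2 * (v n - v0))"
          using n by (simp add: w_def power_divide field_simps)
        then show ?thesis unfolding of_real_diff[symmetric] norm_of_real
          by (simp only: abs_minus_cancel abs_mult) simp
      qed
      then show "cmod (char (\<nu> n) (t / sqrt n) - complex_of_real (w n))
          \<le> (t / sqrt n)\<^sup>2 / 2 * \<bar>v n - v0\<bar> + \<bar>t / sqrt n\<bar>^3 * C / 6"
        using char_taylor_bound[OF \<nu>[OF n(2)], of "t / sqrt n"]
          norm_triangle_ineq[of "char (\<nu> n) (t / sqrt n) - complex_of_real (1 - (t / sqrt n)\<^sup>2 * v n / 2)"
            "complex_of_real (1 - (t / sqrt n)\<^sup>2 * v n / 2) - complex_of_real (w n)"]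
        by simp
    qed simp
    also have "\<dots> = t\<^sup>2 / 2 * \<bar>v n - v0\<bar> + \<bar>t\<bar>^3 * C / 6 * (1 / sqrt n)"
    proof -
      have a1: "real n * (t / sqrt n)\<^sup>2 = t\<^sup>2" using n by (simp add: power_divide)
      have a2: "real n * \<bar>t / sqrt n\<bar>^3 = \<bar>t\<bar>^3 * (1 / sqrt n)"
        using n by (simp add: power_divide power3_eq_cube field_simps)
      have alg: "N * (p / 2 * d + q * C / 6) = (N * p) / 2 * d + (N * q) * C / 6" for N p q d :: real
        by (simp add: field_simps)
      show ?thesis unfolding alg a1 a2 by simp
    qed
    finally show "cmod (char (\<nu> n) (t / sqrt n) ^ n - complex_of_real (w n) ^ n)
      \<le> t\<^sup>2 / 2 * \<bar>v n - v0\<bar> + \<bar>t\<bar>^3 * C / 6 * (1 / sqrt n)" .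
  qed
  have "(\<lambda>n. t\<^sup>2 / 2 * \<bar>v n - v0\<bar> + \<bar>t\<bar>^3 * C / 6 * (1 / sqrt n)) \<longlonglongrightarrow> t\<^sup>2 / 2 * \<bar>v0 - v0\<bar> + \<bar>t\<bar>^3 * C / 6 * 0"
    by (intro tendsto_intros v tendsto_divide_0[OF tendsto_const] filterlim_at_top_imp_at_infinity
        filterlim_compose[OF sqrt_at_top filterlim_real_sequentially])
  then have z: "(\<lambda>n. t\<^sup>2 / 2 * \<bar>v n - v0\<bar> + \<bar>t\<bar>^3 * C / 6 * (1 / sqrt n)) \<longlonglongrightarrow> 0" by simp
  have d: "(\<lambda>n. char (\<nu> n) (t / sqrt n) ^ n - complex_of_real (w n) ^ n) \<longlonglongrightarrow> 0"
    by (rule Lim_null_comparison[OF ev z])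
  have "(\<lambda>n. complex_of_real ((w n)^n)) \<longlonglongrightarrow> complex_of_real (exp (- (v0 * t\<^sup>2) / 2))"
    unfolding w_def by (rule isCont_tendsto_compose [OF _ tendsto_exp_limit_sequentially]) auto
  then have "(\<lambda>n. complex_of_real (w n) ^ n) \<longlonglongrightarrow> complex_of_real (exp (- (v0 * t\<^sup>2) / 2))"
    by simp
  then show ?thesis by (rule Lim_transform[OF _ d])
qed

section \<open>Sums of independent blocks and exponential tilting\<close>

lemma borel_measurable_blinfun [measurable]:
  "blinfun_apply (f :: 'a::real_normed_vector \<Rightarrow>\<^sub>L real) \<in> borel_measurable borel"
  by (intro borel_measurable_continuous_onI blinfun.continuous_on continuous_on_id continuous_on_const)

context prob_space
begin

lemma indep_var_block_sums:
  fixes X :: "'i \<Rightarrow> 'a \<Rightarrow> 'b::{banach, second_countable_topology}"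
  assumes indep: "indep_vars (\<lambda>_. borel) X I" and AB: "A \<inter> B = {}" "A \<subseteq> I" "B \<subseteq> I"
  shows "indep_var borel (\<lambda>w. \<Sum>i\<in>A. X i w) borel (\<lambda>w. \<Sum>i\<in>B. X i w)"
proof -
  have "indep_var
    borel ((\<lambda>f. \<Sum>i\<in>A. f i) \<circ> (\<lambda>w. restrict (\<lambda>i. X i w) A))
    borel ((\<lambda>f. \<Sum>i\<in>B. f i) \<circ> (\<lambda>w. restrict (\<lambda>i. X i w) B))"
    by (rule indep_var_compose[OF indep_var_restrict[OF indep AB]]) measurable
  moreover have "(\<lambda>f. \<Sum>i\<in>A. f i) \<circ> (\<lambda>w. restrict (\<lambda>i. X i w) A) = (\<lambda>w. \<Sum>i\<in>A. X i w)" for A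
    by (auto cong: rev_conj_cong)
  ultimately show ?thesis by simp
qed

text \<open>Conditioning on \<open>U\<close> by Fubini for the product law. The inner integral stays
  over \<open>M\<close> instead of the law of \<open>V\<close>, so that estimates for events in
  \<open>V w\<close>, and induction hypotheses for a partial sum, apply to it as they stand.\<close>

lemma indep_var_nn_integral_iterated:
  assumes UV: "indep_var S U T V"
    and H: "(\<lambda>p. H (fst p) (snd p)) \<in> borel_measurable (S \<Otimes>\<^sub>M T)"
  shows "(\<integral>\<^sup>+w. H (U w) (V w) \<partial>M) = (\<integral>\<^sup>+u. (\<integral>\<^sup>+w. H u (V w) \<partial>M) \<partial>distr M S U)"
proof -
  have U[measurable]: "random_variable S U" and V[measurable]: "random_variable T V"
    and eq: "distr M S U \<Otimes>\<^sub>M distr M T V = distr M (S \<Otimes>\<^sub>M T) (\<lambda>x. (U x, V x))"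
    using UV by (auto simp: indep_var_distribution_eq)
  interpret PV: prob_space "distr M T V" by (rule prob_space_distr) fact
  have "(\<integral>\<^sup>+w. H (U w) (V w) \<partial>M) = (\<integral>\<^sup>+p. H (fst p) (snd p) \<partial>distr M (S \<Otimes>\<^sub>M T) (\<lambda>x. (U x, V x)))"
    using H by (subst nn_integral_distr) auto
  also have "\<dots> = (\<integral>\<^sup>+u. \<integral>\<^sup>+v. H (fst (u, v)) (snd (u, v)) \<partial>distr M T V \<partial>distr M S U)"
    unfolding eq[symmetric] by (rule PV.nn_integral_fst[symmetric]) (use H in simp)
  also have "\<dots> = (\<integral>\<^sup>+u. (\<integral>\<^sup>+w. H u (V w) \<partial>M) \<partial>distr M S U)"
  proof (rule nn_integral_cong)
    fix u assume "u \<in> space (distr M S U)"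
    then have "u \<in> space S" by simp
    with H have "(\<lambda>v. H u v) \<in> borel_measurable T"
      using measurable_Pair2[OF H, of u] by simp
    then show "(\<integral>\<^sup>+v. H (fst (u, v)) (snd (u, v)) \<partial>distr M T V) = (\<integral>\<^sup>+w. H u (V w) \<partial>M)"
      by (simp add: nn_integral_distr)
  qed
  finally show ?thesis .
qed

lemma indep_var_emeasure_iterated:
  assumes UV: "indep_var S U T V" and R: "Measurable.pred (S \<Otimes>\<^sub>M T) (\<lambda>p. R (fst p) (snd p))"
  shows "emeasure M {w\<in>space M. R (U w) (V w)}
    = (\<integral>\<^sup>+u. emeasure M {w\<in>space M. R u (V w)} \<partial>distr M S U)"
proof -
  note [measurable] = R
  have U[measurable]: "random_variable S U" and V[measurable]: "random_variable T V"
    using UV by (auto simp: indep_var_distribution_eq)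
  have sub: "Measurable.pred T (\<lambda>v. R u v)" if "u \<in> space S" for u
    using measurable_Pair2[OF R that] by simp
  have "(\<integral>\<^sup>+w. indicator {p \<in> space (S \<Otimes>\<^sub>M T). R (fst p) (snd p)} (U w, V w) \<partial>M)
    = (\<integral>\<^sup>+u. (\<integral>\<^sup>+w. indicator {p \<in> space (S \<Otimes>\<^sub>M T). R (fst p) (snd p)} (u, V w) \<partial>M) \<partial>distr M S U)"
    by (rule indep_var_nn_integral_iterated[OF UV]) simp
  also have "(\<integral>\<^sup>+w. indicator {p \<in> space (S \<Otimes>\<^sub>M T). R (fst p) (snd p)} (U w, V w) \<partial>M)
    = (\<integral>\<^sup>+w. indicator {w\<in>space M. R (U w) (V w)} w \<partial>M)"
    using measurable_space[OF U] measurable_space[OF V]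
    by (intro nn_integral_cong) (auto simp: indicator_def space_pair_measure)
  also have "\<dots> = emeasure M {w\<in>space M. R (U w) (V w)}"
  proof (rule nn_integral_indicator)
    have "(\<lambda>w. (U w, V w)) \<in> measurable M (S \<Otimes>\<^sub>M T)" by simp
    from measurable_compose[OF this R] show "{w\<in>space M. R (U w) (V w)} \<in> sets M"
      by (simp add: pred_def)
  qed
  also have "(\<integral>\<^sup>+u. (\<integral>\<^sup>+w. indicator {p \<in> space (S \<Otimes>\<^sub>M T). R (fst p) (snd p)} (u, V w) \<partial>M) \<partial>distr M S U)
    = (\<integral>\<^sup>+u. emeasure M {w\<in>space M. R u (V w)} \<partial>distr M S U)"
  proof (rule nn_integral_cong)
    fix u assume "u \<in> space (distr M S U)"
    then have u: "u \<in> space S" by simp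
    have "(\<integral>\<^sup>+w. indicator {p \<in> space (S \<Otimes>\<^sub>M T). R (fst p) (snd p)} (u, V w) \<partial>M)
      = (\<integral>\<^sup>+w. indicator {w\<in>space M. R u (V w)} w \<partial>M)"
      using u measurable_space[OF V]
      by (intro nn_integral_cong) (auto simp: indicator_def space_pair_measure)
    also have "\<dots> = emeasure M {w\<in>space M. R u (V w)}"
      using measurable_compose[OF V sub[OF u]] by (intro nn_integral_indicator) (simp add: pred_def)
    finally show "(\<integral>\<^sup>+w. indicator {p \<in> space (S \<Otimes>\<^sub>M T). R (fst p) (snd p)} (u, V w) \<partial>M)
      = emeasure M {w\<in>space M. R u (V w)}" .
  qed
  finally show ?thesis .
qed

text \<open>If every shift had a tail of at least 2 \<eta>, averaging over the law of
  \<open>U\<close> would give the sum a tail of at least 2 \<eta>. This makes a single block tight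
  up to an unknown shift; tightness is assumed for the whole sum only.\<close>

lemma indep_var_good_shift:
  fixes U V :: "'a \<Rightarrow> 'b::{banach, second_countable_topology}"
  assumes UV: "indep_var borel U borel V" and \<eta>: "0 < \<eta>"
    and tail: "prob {w\<in>space M. K < norm (U w + V w)} \<le> \<eta>"
  shows "\<exists>u. prob {w\<in>space M. K < norm (u + V w)} < 2 * \<eta>"
proof (rule ccontr)
  assume "\<not> ?thesis"
  then have ge: "2 * \<eta> \<le> prob {w\<in>space M. K < norm (u + V w)}" for u by (auto simp: not_less)
  have U[measurable]: "random_variable borel U" using UV by (auto simp: indep_var_distribution_eq)
  interpret D: prob_space "distr M borel U" by (rule prob_space_distr) fact
  have "ennreal (2 * \<eta>) = (\<integral>\<^sup>+u. ennreal (2 * \<eta>) \<partial>distr M borel U)"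
    using D.emeasure_space_1 by simp
  also have "\<dots> \<le> (\<integral>\<^sup>+u. emeasure M {w\<in>space M. K < norm (u + V w)} \<partial>distr M borel U)"
    unfolding emeasure_eq_measure using ge by (intro nn_integral_mono) (auto intro: ennreal_leI)
  also have "\<dots> = emeasure M {w\<in>space M. K < norm (U w + V w)}"
    by (rule indep_var_emeasure_iterated[OF UV, symmetric]) simp
  also have "\<dots> \<le> ennreal \<eta>" unfolding emeasure_eq_measure using tail by (rule ennreal_leI)
  finally have "2 * \<eta> \<le> \<eta>" using \<eta> by (simp add: ennreal_le_iff)
  with \<eta> show False by simp
qed

text \<open>Whatever the value of \<open>U\<close>, the block \<open>V\<close> hits the window with
  probability at most \<open>Q\<close>; integrating this over the event that the shifted
  \<open>U\<close> is large gives a product bound although both conditions involve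
  \<open>U\<close>.\<close>

lemma indep_var_joint_window_tail:
  fixes U V :: "'a \<Rightarrow> 'b::{banach, second_countable_topology}" and g :: "'b \<Rightarrow>\<^sub>L real"
  assumes UV: "indep_var borel U borel V" and J: "J \<in> sets borel" and Q: "0 \<le> Q"
    and conc: "\<And>x. prob {w\<in>space M. x + g (V w) \<in> J} \<le> Q"
  shows "prob {w\<in>space M. g (U w + V w) \<in> J \<and> K < norm (U w + c)}
    \<le> Q * prob {w\<in>space M. K < norm (U w + c)}"
proof -
  have U[measurable]: "random_variable borel U" and V[measurable]: "random_variable borel V"
    using UV by (auto simp: indep_var_distribution_eq)
  note J[measurable]
  have "emeasure M {w\<in>space M. g (U w + V w) \<in> J \<and> K < norm (U w + c)}
    = (\<integral>\<^sup>+u. emeasure M {w\<in>space M. g (u + V w) \<in> J \<and> K < norm (u + c)} \<partial>distr M borel U)"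
    by (rule indep_var_emeasure_iterated[OF UV]) simp
  also have "\<dots> \<le> (\<integral>\<^sup>+u. ennreal Q * indicator {u. K < norm (u + c)} u \<partial>distr M borel U)"
  proof (rule nn_integral_mono)
    fix u
    show "emeasure M {w\<in>space M. g (u + V w) \<in> J \<and> K < norm (u + c)} \<le> ennreal Q * indicator {u. K < norm (u + c)} u"
      using conc[of "g u"] by (auto simp: indicator_def blinfun.add_right emeasure_eq_measure ennreal_leI)
  qed
  also have "\<dots> = ennreal Q * emeasure (distr M borel U) {u. K < norm (u + c)}"
    by (rule nn_integral_cmult_indicator) simp
  also have "emeasure (distr M borel U) {u. K < norm (u + c)} = emeasure M {w\<in>space M. K < norm (U w + c)}"
    by (subst emeasure_distr) (auto intro!: arg_cong[where f = "emeasure M"])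
  finally show ?thesis
    unfolding emeasure_eq_measure using Q by (simp add: ennreal_mult[symmetric] ennreal_le_iff)
qed

text \<open>Given that a one-dimensional marginal of a sum of two independent blocks lies in a small window,
  one of the blocks may be conditioned on and the other still spreads over the window; so the tail
  of the sum costs a factor \<open>\<eta>\<close> on top of the window probability \<open>Q\<close>.\<close>

lemma indep_blocks_window_tail:
  fixes U V :: "'a \<Rightarrow> 'b::{banach, second_countable_topology}" and g :: "'b \<Rightarrow>\<^sub>L real"
  assumes UV: "indep_var borel U borel V" and VU: "indep_var borel V borel U"
    and J: "J \<in> sets borel" and Q: "0 \<le> Q" and \<eta>: "0 < \<eta>" "5 * \<eta> < 1"
    and concU: "\<And>x. prob {w\<in>space M. x + g (U w) \<in> J} \<le> Q"
    and concV: "\<And>x. prob {w\<in>space M. x + g (V w) \<in> J} \<le> Q"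
    and tail: "prob {w\<in>space M. K < norm (U w + V w)} \<le> \<eta>"
  shows "prob {w\<in>space M. g (U w + V w) \<in> J \<and> 5 * K < norm (U w + V w)} \<le> 4 * \<eta> * Q"
proof -
  have U[measurable]: "random_variable borel U" and V[measurable]: "random_variable borel V"
    using UV by (auto simp: indep_var_distribution_eq)
  note J[measurable]
  have tail': "prob {w\<in>space M. K < norm (V w + U w)} \<le> \<eta>"
    using tail by (simp add: add.commute)
  obtain u where u: "prob {w\<in>space M. K < norm (u + V w)} < 2 * \<eta>"
    using indep_var_good_shift[OF UV \<eta>(1) tail] by auto
  obtain v where v: "prob {w\<in>space M. K < norm (v + U w)} < 2 * \<eta>"
    using indep_var_good_shift[OF VU \<eta>(1) tail'] by auto
  let ?A = "{w\<in>space M. K < norm (u + V w)}" and ?B = "{w\<in>space M. K < norm (v + U w)}"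
    and ?C = "{w\<in>space M. K < norm (U w + V w)}"
  \<comment> \<open>The three tails add up to less than 5 \<eta> < 1, so one sample point avoids
    them all. It bounds the sum of the two unknown shifts by 3 K.\<close>
  have "prob (?A \<union> ?B \<union> ?C) \<le> prob ?A + prob ?B + prob ?C"
    by (rule order_trans[OF measure_Un_le add_right_mono[OF measure_Un_le]]) auto
  also have "\<dots> < 1" using u v tail \<eta> by linarith
  finally have "?A \<union> ?B \<union> ?C \<noteq> space M" using prob_space by auto
  then obtain w where "w \<in> space M" "w \<notin> ?A \<union> ?B \<union> ?C" by blast
  then have w: "norm (u + V w) \<le> K" "norm (v + U w) \<le> K" "norm (U w + V w) \<le> K"
    by (auto simp: not_less)
  have tri: "norm (a + b - c) \<le> norm a + norm b + norm c" for a b c :: 'b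
    using norm_triangle_ineq4[of "a + b" c] norm_triangle_ineq[of a b] by simp
  have "norm (u + v) = norm ((u + V w) + (v + U w) - (U w + V w))" by simp
  also have "\<dots> \<le> norm (u + V w) + norm (v + U w) + norm (U w + V w)" by (rule tri)
  finally have uv: "norm (u + v) \<le> 3 * K" using w by simp
  \<comment> \<open>The factor 5 is K + K for the shifted blocks plus 3 K for the sum of the
    shifts.\<close>
  have split: "K < norm (V w + u) \<or> K < norm (U w + v)" if "5 * K < norm (U w + V w)" for w
  proof (rule ccontr)
    assume "\<not> ?thesis"
    moreover have "norm (U w + V w) = norm ((V w + u) + (U w + v) - (u + v))"
      by (simp add: add.commute)
    then have "norm (U w + V w) \<le> norm (V w + u) + norm (U w + v) + norm (u + v)"
      using tri[of "V w + u" "U w + v" "u + v"] by simp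
    ultimately show False using uv that by simp
  qed
  let ?P = "{w\<in>space M. g (U w + V w) \<in> J \<and> K < norm (U w + v)}"
    and ?R = "{w\<in>space M. g (V w + U w) \<in> J \<and> K < norm (V w + u)}"
  have "prob {w\<in>space M. g (U w + V w) \<in> J \<and> 5 * K < norm (U w + V w)} \<le> prob (?P \<union> ?R)"
    using split by (intro finite_measure_mono) (auto simp: add.commute)
  also have "\<dots> \<le> prob ?P + prob ?R" by (rule measure_Un_le) auto
  also have "\<dots> \<le> Q * (2 * \<eta>) + Q * (2 * \<eta>)"
  proof (intro add_mono)
    have "prob ?P \<le> Q * prob {w\<in>space M. K < norm (U w + v)}"
      by (rule indep_var_joint_window_tail[OF UV J Q concV])
    also have "\<dots> \<le> Q * (2 * \<eta>)" using v Q by (intro mult_left_mono) (auto simp: add.commute)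
    finally show "prob ?P \<le> Q * (2 * \<eta>)" .
    have "prob ?R \<le> Q * prob {w\<in>space M. K < norm (V w + u)}"
      by (rule indep_var_joint_window_tail[OF VU J Q concU])
    also have "\<dots> \<le> Q * (2 * \<eta>)" using u Q by (intro mult_left_mono) (auto simp: add.commute)
    finally show "prob ?R \<le> Q * (2 * \<eta>)" .
  qed
  finally show ?thesis by (simp add: mult_ac)
qed

end

text \<open>The change of measure, peeled off one summand at a time: the density of a summand
  cancels its share of the exponential factor and leaves one power of \<open>L\<close>. The test
  function \<open>F\<close> is arbitrary because the induction hypothesis is applied to its
  translates.\<close>

lemma tilted_sum_nn_integral:
  fixes X :: "'i \<Rightarrow> 'w \<Rightarrow> 'a::{banach, second_countable_topology}" and Z :: "'i \<Rightarrow> 'z \<Rightarrow> 'a"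
    and h :: "'a \<Rightarrow>\<^sub>L real"
  assumes M: "prob_space M" and N: "prob_space N" and I: "finite I"
    and X: "prob_space.indep_vars M (\<lambda>_. borel) X I" and Xd: "\<And>i. i \<in> I \<Longrightarrow> distr M borel (X i) = \<mu>"
    and Z: "prob_space.indep_vars N (\<lambda>_. borel) Z I"
    and Zd: "\<And>i. i \<in> I \<Longrightarrow> distr N borel (Z i) = density \<mu> (\<lambda>x. ennreal (exp (h x)) / L)"
    and L: "0 < L" "L < \<infinity>" and \<mu>: "sets \<mu> = sets borel" "prob_space \<mu>"
    and F: "F \<in> borel_measurable borel"
  shows "(\<integral>\<^sup>+w. F (\<Sum>i\<in>I. X i w) \<partial>M)
    = L ^ card I * (\<integral>\<^sup>+w. F (\<Sum>i\<in>I. Z i w) * ennreal (exp (- h (\<Sum>i\<in>I. Z i w))) \<partial>N)"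
  using I X Xd Z Zd F
proof (induction I arbitrary: F rule: finite_induct)
  case empty
  then show ?case using prob_space.emeasure_space_1[OF M] prob_space.emeasure_space_1[OF N] by simp
next
  case (insert i I)
  interpret M: prob_space M by fact
  interpret N: prob_space N by fact
  interpret \<mu>: prob_space \<mu> by fact
  note [measurable_cong] = \<mu>(1)
  note F[measurable] = insert.prems(5)
  have iX: "M.indep_var borel (\<lambda>w. X i w) borel (\<lambda>w. \<Sum>i\<in>I. X i w)"
    using M.indep_var_block_sums[OF insert.prems(1), of "{i}" I] insert.hyps by auto
  have iZ: "N.indep_var borel (\<lambda>w. Z i w) borel (\<lambda>w. \<Sum>i\<in>I. Z i w)"
    using N.indep_var_block_sums[OF insert.prems(3), of "{i}" I] insert.hyps by auto
  have SZ[measurable]: "(\<lambda>w. \<Sum>i\<in>I. Z i w) \<in> borel_measurable N"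
    using iZ by (auto simp: N.indep_var_distribution_eq)
  have XI: "M.indep_vars (\<lambda>_. borel) X I" and ZI: "N.indep_vars (\<lambda>_. borel) Z I"
    using insert.prems by (auto intro: M.indep_vars_subset N.indep_vars_subset)
  \<comment> \<open>The contribution of the remaining sum under the tilted law once the new summand
    is fixed at \<open>x\<close>. Both sides of the claim reduce to its integral over
    \<open>\<mu>\<close>.\<close>
  define A where "A x = (\<integral>\<^sup>+w. F (x + (\<Sum>i\<in>I. Z i w)) * ennreal (exp (- h (\<Sum>i\<in>I. Z i w))) \<partial>N)" for x
  have A[measurable]: "A \<in> borel_measurable borel" unfolding A_def by measurable
  have "(\<integral>\<^sup>+w. F (\<Sum>i\<in>insert i I. X i w) \<partial>M) = (\<integral>\<^sup>+w. F (X i w + (\<Sum>i\<in>I. X i w)) \<partial>M)"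
    using insert.hyps by simp
  also have "\<dots> = (\<integral>\<^sup>+x. (\<integral>\<^sup>+w. F (x + (\<Sum>i\<in>I. X i w)) \<partial>M) \<partial>distr M borel (\<lambda>w. X i w))"
    by (rule M.indep_var_nn_integral_iterated[OF iX]) measurable
  also have "distr M borel (\<lambda>w. X i w) = \<mu>" using insert.prems(2)[of i] by simp
  also have "(\<integral>\<^sup>+x. (\<integral>\<^sup>+w. F (x + (\<Sum>i\<in>I. X i w)) \<partial>M) \<partial>\<mu>) = (\<integral>\<^sup>+x. L ^ card I * A x \<partial>\<mu>)"
    unfolding A_def using insert.prems by (intro nn_integral_cong insert.IH XI ZI) auto
  also have "\<dots> = L ^ card I * (\<integral>\<^sup>+x. A x \<partial>\<mu>)"
    by (rule nn_integral_cmult) simp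
  finally have 1: "(\<integral>\<^sup>+w. F (\<Sum>i\<in>insert i I. X i w) \<partial>M) = L ^ card I * (\<integral>\<^sup>+x. A x \<partial>\<mu>)" .
  have "(\<integral>\<^sup>+w. F (\<Sum>i\<in>insert i I. Z i w) * ennreal (exp (- h (\<Sum>i\<in>insert i I. Z i w))) \<partial>N)
    = (\<integral>\<^sup>+w. F (Z i w + (\<Sum>i\<in>I. Z i w)) * (ennreal (exp (- h (\<Sum>i\<in>I. Z i w))) * ennreal (exp (- h (Z i w)))) \<partial>N)"
    using insert.hyps
    by (simp add: blinfun.add_right ennreal_mult[symmetric] exp_add[symmetric] add.commute)
  also have "\<dots> = (\<integral>\<^sup>+z. (\<integral>\<^sup>+w. F (z + (\<Sum>i\<in>I. Z i w)) * (ennreal (exp (- h (\<Sum>i\<in>I. Z i w))) * ennreal (exp (- h z))) \<partial>N)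
      \<partial>distr N borel (\<lambda>w. Z i w))"
    by (rule N.indep_var_nn_integral_iterated[OF iZ]) measurable
  also have "\<dots> = (\<integral>\<^sup>+z. A z * ennreal (exp (- h z)) \<partial>distr N borel (\<lambda>w. Z i w))"
    unfolding A_def by (intro nn_integral_cong) (simp add: nn_integral_multc mult.assoc[symmetric])
  also have "distr N borel (\<lambda>w. Z i w) = density \<mu> (\<lambda>x. ennreal (exp (h x)) / L)"
    using insert.prems(4)[of i] by simp
  also have "(\<integral>\<^sup>+z. A z * ennreal (exp (- h z)) \<partial>density \<mu> (\<lambda>x. ennreal (exp (h x)) / L))
    = (\<integral>\<^sup>+z. (ennreal (exp (h z)) / L) * (A z * ennreal (exp (- h z))) \<partial>\<mu>)"
    by (rule nn_integral_density) measurable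
  also have "\<dots> = (\<integral>\<^sup>+z. A z / L \<partial>\<mu>)"
  proof (rule nn_integral_cong)
    fix z
    have "(ennreal (exp (h z)) / L) * (A z * ennreal (exp (- h z)))
      = (ennreal (exp (h z)) * ennreal (exp (- h z))) * (A z / L)"
      by (simp add: divide_ennreal_def mult_ac)
    also have "ennreal (exp (h z)) * ennreal (exp (- h z)) = 1"
      by (simp add: ennreal_mult[symmetric] exp_add[symmetric])
    finally show "(ennreal (exp (h z)) / L) * (A z * ennreal (exp (- h z))) = A z / L" by simp
  qed
  also have "\<dots> = (\<integral>\<^sup>+z. A z \<partial>\<mu>) / L"
    by (rule nn_integral_divide) simp
  finally have 2: "(\<integral>\<^sup>+w. F (\<Sum>i\<in>insert i I. Z i w) * ennreal (exp (- h (\<Sum>i\<in>insert i I. Z i w))) \<partial>N)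
    = (\<integral>\<^sup>+z. A z \<partial>\<mu>) / L" .
  have "L * ((\<integral>\<^sup>+z. A z \<partial>\<mu>) / L) = (\<integral>\<^sup>+z. A z \<partial>\<mu>)"
    using L by (metis ennreal_times_divide ennreal_mult_divide_eq mult.commute less_irrefl
        infinity_ennreal_def)
  then have "L ^ card I * (\<integral>\<^sup>+x. A x \<partial>\<mu>) = L ^ card (insert i I) * ((\<integral>\<^sup>+z. A z \<partial>\<mu>) / L)"
    using insert.hyps by (simp add: mult.assoc mult.left_commute[of L])
  then show ?case unfolding 1 2 .
qed

section \<open>The covariance structure of the limit law\<close>

lemma (in prob_space) char_iid_sum:
  fixes Y :: "'i \<Rightarrow> 'a \<Rightarrow> real"
  assumes "indep_vars (\<lambda>_. borel) Y I" and "\<And>i. i \<in> I \<Longrightarrow> distr M borel (Y i) = \<nu>"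
  shows "char (distr M borel (\<lambda>w. \<Sum>i\<in>I. Y i w)) t = char \<nu> t ^ card I"
  unfolding char_distr_sum[OF assms(1)] using assms(2) by (simp add: prod_constant)

lemma (in prob_space) char_scale:
  assumes [measurable]: "random_variable borel Y"
  shows "char (distr M borel (\<lambda>w. c * Y w)) t = char (distr M borel Y) (c * t)"
  unfolding char_def by (simp add: integral_distr mult_ac)

text \<open>Plays the role of tightness: for large \<open>L\<close> the limit is close to 1, so most
  of the mass stays at distance O(L) from 0. The lower bound is \<open>exp z \<ge> 1 + z\<close>
  averaged over the normal law.\<close>

lemma tendsto_gaussian_average:
  fixes \<rho> :: "nat \<Rightarrow> real measure"
  assumes \<rho>: "\<And>n. n \<ge> n0 \<Longrightarrow> real_distribution (\<rho> n)"
    and lim: "\<And>t. (\<lambda>n. char (\<rho> n) t) \<longlonglongrightarrow> complex_of_real (exp (- (v * t\<^sup>2) / 2))"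
    and L: "0 < L" and v: "0 \<le> v"
  shows "\<exists>l \<ge> 1 - v / (2 * L\<^sup>2). (\<lambda>n. LINT y|\<rho> n. exp (- (y / L)\<^sup>2 / 2)) \<longlonglongrightarrow> l"
proof (intro exI conjI)
  interpret N: real_distribution std_normal by (rule real_dist_normal_dist)
  let ?l = "LINT u|std_normal. exp (- (v * (u / L)\<^sup>2) / 2)"
  define G where "G n u = (if n0 \<le> n then Re (char (\<rho> n) (u / L)) else 0)" for n u
  have cm: "n0 \<le> n \<Longrightarrow> char (\<rho> n) \<in> borel_measurable borel" for n
    by (rule real_distribution.char_measurable[OF \<rho>])
  have Gm[measurable]: "G n \<in> borel_measurable borel" for n
    unfolding G_def using cm[of n] by (cases "n0 \<le> n") auto
  have "(\<lambda>n. LINT u|std_normal. G n u) \<longlonglongrightarrow> ?l"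
  proof (rule integral_dominated_convergence[where w = "\<lambda>_. 1"])
    show "AE u in std_normal. (\<lambda>n. G n u) \<longlonglongrightarrow> exp (- (v * (u / L)\<^sup>2) / 2)"
    proof (rule AE_I2)
      fix u
      have "(\<lambda>n. Re (char (\<rho> n) (u / L))) \<longlonglongrightarrow> Re (complex_of_real (exp (- (v * (u / L)\<^sup>2) / 2)))"
        by (intro tendsto_Re lim)
      then have T: "(\<lambda>n. Re (char (\<rho> n) (u / L))) \<longlonglongrightarrow> exp (- (v * (u / L)\<^sup>2) / 2)"
        by (simp only: Re_complex_of_real)
      show "(\<lambda>n. G n u) \<longlonglongrightarrow> exp (- (v * (u / L)\<^sup>2) / 2)"
        by (rule Lim_transform_eventually[OF T], rule eventually_mono[OF eventually_ge_at_top[of n0]])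
           (simp add: G_def)
    qed
    show "AE u in std_normal. norm (G n u) \<le> 1" for n
    proof (rule AE_I2)
      fix u
      show "norm (G n u) \<le> 1"
        using real_distribution.cmod_char_le_1[OF \<rho>, of n "u / L"] abs_Re_le_cmod[of "char (\<rho> n) (u / L)"]
        by (auto simp: G_def)
    qed
  qed auto
  then show "(\<lambda>n. LINT y|\<rho> n. exp (- (y / L)\<^sup>2 / 2)) \<longlonglongrightarrow> ?l"
    by (rule Lim_transform_eventually, intro eventually_mono[OF eventually_ge_at_top[of n0]])
       (use gaussian_average_eq_char[OF \<rho> L, of _ 0] in \<open>simp add: G_def\<close>)
  have "1 - v / (2 * L\<^sup>2) = (LINT u|std_normal. 1 - v / (2 * L\<^sup>2) * u\<^sup>2)"
    using std_normal_second_moment N.prob_space by simp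
  also have "\<dots> \<le> ?l"
  proof (rule integral_mono)
    show "integrable std_normal (\<lambda>u. 1 - v / (2 * L\<^sup>2) * u\<^sup>2)"
      using std_normal_second_moment(1) by simp
    show "integrable std_normal (\<lambda>u. exp (- (v * (u / L)\<^sup>2) / 2))"
      using v by (intro N.integrable_const_bound[where B = 1]) auto
    fix u
    have "1 + - (v * (u / L)\<^sup>2) / 2 \<le> exp (- (v * (u / L)\<^sup>2) / 2)" by (rule exp_ge_add_one_self)
    then show "1 - v / (2 * L\<^sup>2) * u\<^sup>2 \<le> exp (- (v * (u / L)\<^sup>2) / 2)"
      by (simp add: power_divide mult_ac)
  qed
  finally show "1 - v / (2 * L\<^sup>2) \<le> ?l" .
qed

lemma abs_le_2_if_exp_ge_half:
  assumes "1 / 2 \<le> exp (- z\<^sup>2 / 2 :: real)"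
  shows "\<bar>z\<bar> \<le> 2"
proof -
  have "1 + z\<^sup>2 / 2 \<le> exp (z\<^sup>2 / 2)" by (rule exp_ge_add_one_self)
  also have "exp (z\<^sup>2 / 2) = 1 / exp (- z\<^sup>2 / 2)" by (simp add: exp_minus field_simps)
  also have "\<dots> \<le> 1 / (1 / 2)" using assms by (intro divide_left_mono) auto
  finally have "z\<^sup>2 \<le> 2\<^sup>2" by simp
  then show ?thesis by (metis abs_le_square_iff abs_numeral)
qed

lemma char_eq_cos_sin:
  assumes "real_distribution \<rho>"
  shows "char \<rho> t = Complex (LINT y|\<rho>. cos (t * y)) (LINT y|\<rho>. sin (t * y))"
proof -
  interpret R: real_distribution \<rho> by fact
  have i: "integrable \<rho> (\<lambda>x. iexp (t * x))" by (intro R.integrable_iexp) auto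
  have "Re (char \<rho> t) = (LINT y|\<rho>. cos (t * y))"
    unfolding char_def using integral_Re[OF i] by (simp add: Re_exp)
  moreover have "Im (char \<rho> t) = (LINT y|\<rho>. sin (t * y))"
    unfolding char_def using integral_Im[OF i] by (simp add: Im_exp)
  ultimately show ?thesis by (simp add: complex_eq_iff)
qed

text \<open>Representing the law as the image of the standard normal under multiplication by sqrt v
  covers the degenerate case v = 0, where no density exists. The integral itself is found by
  completing the square.\<close>

lemma laplace_normal_law:
  assumes \<rho>: "real_distribution \<rho>" and c: "\<And>t. char \<rho> t = complex_of_real (exp (- (v * t\<^sup>2) / 2))"
    and v: "0 \<le> v"
  shows "(\<integral>\<^sup>+y. ennreal (exp y) \<partial>\<rho>) = ennreal (exp (v / 2))"
proof -
  interpret N: real_distribution std_normal by (rule real_dist_normal_dist)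
  define s where "s = sqrt v"
  have s: "s\<^sup>2 = v" using v by (simp add: s_def)
  have "\<rho> = distr std_normal borel (\<lambda>u. s * u)"
  proof (rule Levy_uniqueness[OF \<rho>])
    show "real_distribution (distr std_normal borel (\<lambda>u. s * u))"
      by (rule N.real_distribution_distr) simp
    show "char \<rho> = char (distr std_normal borel (\<lambda>u. s * u))"
    proof
      fix t
      have "char (distr std_normal borel (\<lambda>u. s * u)) t
          = char (distr std_normal borel (\<lambda>u. u)) (s * t)"
        by (rule N.char_scale) simp
      also have "distr std_normal borel (\<lambda>u. u) = std_normal"
        by (rule distr_id2) simp
      also have "char std_normal (s * t) = char \<rho> t"
        by (simp add: char_std_normal_distribution c power_mult_distrib s)
      finally show "char \<rho> t = char (distr std_normal borel (\<lambda>u. s * u)) t" ..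
    qed
  qed
  then have "(\<integral>\<^sup>+y. ennreal (exp y) \<partial>\<rho>) = (\<integral>\<^sup>+u. ennreal (exp (s * u)) \<partial>std_normal)"
    by (simp add: nn_integral_distr)
  also have "\<dots> = (\<integral>\<^sup>+u. ennreal (std_normal_density u) * ennreal (exp (s * u)) \<partial>lborel)"
    by (rule nn_integral_density) auto
  also have "\<dots> = (\<integral>\<^sup>+u. ennreal (exp (v / 2)) * ennreal (normal_density s 1 u) \<partial>lborel)"
  proof (rule nn_integral_cong)
    fix u :: real
    have "- u\<^sup>2 / 2 + s * u = v / 2 + - (u - s)\<^sup>2 / 2"
      by (simp add: s[symmetric] power2_eq_square field_simps)
    then have "exp (- u\<^sup>2 / 2) * exp (s * u) = exp (v / 2) * exp (- (u - s)\<^sup>2 / 2)"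
      by (simp only: exp_add[symmetric])
    then have "std_normal_density u * exp (s * u) = exp (v / 2) * normal_density s 1 u"
      by (simp add: normal_density_def)
    then show "ennreal (std_normal_density u) * ennreal (exp (s * u)) = ennreal (exp (v / 2)) * ennreal (normal_density s 1 u)"
      by (simp only: ennreal_mult'[symmetric] exp_ge_zero normal_density_nonneg)
  qed
  also have "\<dots> = ennreal (exp (v / 2)) * (\<integral>\<^sup>+u. ennreal (normal_density s 1 u) \<partial>lborel)"
    by (rule nn_integral_cmult) simp
  also have "(\<integral>\<^sup>+u. ennreal (normal_density s 1 u) \<partial>lborel) = 1"
    using prob_space.emeasure_space_1[OF prob_space_normal_density[of 1 s]]
    by (simp add: emeasure_density)
  finally show ?thesis by simp
qed

section \<open>Mean and covariance of a law in the domain of normal attraction\<close>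

locale clt_domain =
  fixes M :: "'w measure" and X :: "nat \<Rightarrow> 'w \<Rightarrow> 'a::{banach, second_countable_topology}"
    and \<mu> \<gamma> :: "'a measure"
  assumes prob_M: "prob_space M"
    and indep: "prob_space.indep_vars M (\<lambda>_. borel) X {1..}"
    and law: "\<And>j. j \<ge> 1 \<Longrightarrow> distr M borel (X j) = \<mu>"
    and prob_\<gamma>: "prob_space \<gamma>" and sets_\<gamma> [measurable_cong]: "sets \<gamma> = sets borel"
    and weak: "weakly_converges (\<lambda>n. distr M borel (\<lambda>w. (1 / sqrt (real n)) *\<^sub>R (\<Sum>j=1..n. X j w))) \<gamma>"
    and moment3: "integrable \<mu> (\<lambda>x. norm x ^ 3)"
begin

sublocale M: prob_space M by (rule prob_M)
sublocale \<gamma>: prob_space \<gamma> by (rule prob_\<gamma>)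

lemma X_measurable [measurable]: "j \<in> {1..} \<Longrightarrow> X j \<in> borel_measurable M"
  using indep by (auto simp: M.indep_vars_def)

lemma sets_\<mu> [measurable_cong, simp]: "sets \<mu> = sets borel"
  using law[of 1] by auto

sublocale \<mu>: prob_space \<mu>
  using M.prob_space_distr[of "X 1" borel] law[of 1] X_measurable[of 1] by auto

lemma integrable_norm_power:
  assumes "k \<le> 3"
  shows "integrable \<mu> (\<lambda>x. norm x ^ k)"
proof (rule Bochner_Integration.integrable_bound)
  show "integrable \<mu> (\<lambda>x. 1 + norm x ^ 3)" using moment3 by simp
  show "AE x in \<mu>. norm (norm x ^ k) \<le> norm (1 + norm x ^ 3)"
  proof (rule AE_I2)
    fix x :: 'a
    show "norm (norm x ^ k) \<le> norm (1 + norm x ^ 3)"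
      using abs_power_le_cube[OF assms, of "norm x"] by simp
  qed
qed measurable

lemma integrable_id: "integrable \<mu> (\<lambda>x. x)"
  using integrable_norm_power[of 1] by (simp add: integrable_norm_iff)

lemma integrable_blinfun: "integrable \<mu> (\<lambda>x. blinfun_apply h x)"
  by (rule integrable_bounded_linear[OF blinfun.bounded_linear_right integrable_id])

lemma integrable_blinfun_mult:
  fixes h k :: "'a \<Rightarrow>\<^sub>L real"
  shows "integrable \<mu> (\<lambda>x. blinfun_apply h x * blinfun_apply k x)"
proof (rule Bochner_Integration.integrable_bound)
  show "integrable \<mu> (\<lambda>x. norm h * norm k * norm x ^ 2)" using integrable_norm_power[of 2] by simp
  show "AE x in \<mu>. norm (h x * k x) \<le> norm (norm h * norm k * norm x ^ 2)"
  proof (rule AE_I2)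
    fix x
    have "norm (h x) * norm (k x) \<le> (norm h * norm x) * (norm k * norm x)"
      by (intro mult_mono norm_blinfun) auto
    then show "norm (h x * k x) \<le> norm (norm h * norm k * norm x ^ 2)"
      by (simp add: abs_mult power2_eq_square mult_ac)
  qed
qed measurable

lemma integrable_blinfun_square:
  fixes h :: "'a \<Rightarrow>\<^sub>L real"
  shows "integrable \<mu> (\<lambda>x. (blinfun_apply h x)\<^sup>2)"
  using integrable_blinfun_mult[of h h] by (simp add: power2_eq_square)

lemma integrable_blinfun_scaleR: "integrable \<mu> (\<lambda>x. blinfun_apply h x *\<^sub>R x)"
proof (rule Bochner_Integration.integrable_bound)
  show "integrable \<mu> (\<lambda>x. norm h * norm x ^ 2)" using integrable_norm_power[of 2] by simp
  show "AE x in \<mu>. norm (h x *\<^sub>R x) \<le> norm (norm h * norm x ^ 2)"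
  proof (rule AE_I2)
    fix x
    have "norm (h x) * norm x \<le> (norm h * norm x) * norm x"
      by (intro mult_right_mono norm_blinfun) auto
    then show "norm (h x *\<^sub>R x) \<le> norm (norm h * norm x ^ 2)"
      by (simp add: power2_eq_square mult_ac)
  qed
qed measurable

text \<open>Taken under \<open>\<mu>\<close>, where moments are available. By
  \<open>char_\<gamma>\<close> the number \<open>cov h h\<close> is also the variance parameter of
  the marginal of \<open>\<gamma>\<close> under \<open>h\<close>, and \<open>cov_vec\<close> is the
  counterpart of the operator S.\<close>

definition cov :: "('a \<Rightarrow>\<^sub>L real) \<Rightarrow> ('a \<Rightarrow>\<^sub>L real) \<Rightarrow> real" where
  "cov h k = (LINT x|\<mu>. blinfun_apply h x * blinfun_apply k x)"

definition cov_vec :: "('a \<Rightarrow>\<^sub>L real) \<Rightarrow> 'a" where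
  "cov_vec h = (LINT x|\<mu>. blinfun_apply h x *\<^sub>R x)"

lemma cov_nonneg: "0 \<le> cov h h"
  unfolding cov_def by (rule integral_nonneg_AE) simp

lemma blinfun_cov_vec: "blinfun_apply k (cov_vec h) = cov h k"
proof -
  have "k (cov_vec h) = (LINT x|\<mu>. k (h x *\<^sub>R x))"
    unfolding cov_vec_def
    by (rule integral_bounded_linear[OF blinfun.bounded_linear_right integrable_blinfun_scaleR, symmetric])
  then show ?thesis by (simp add: cov_def blinfun.scaleR_right)
qed

lemma cov_commute: "cov h k = cov k h"
  by (simp add: cov_def mult.commute)

lemma cov_add_left: "cov (h + h') k = cov h k + cov h' k"
  by (simp add: cov_def blinfun.add_left distrib_right integrable_blinfun_mult)

lemma cov_scaleR_left: "cov (c *\<^sub>R h) k = c * cov h k"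
  by (simp add: cov_def blinfun.scaleR_left mult.assoc)

lemma cov_add_right: "cov k (h + h') = cov k h + cov k h'"
  using cov_add_left[of h h' k] by (simp add: cov_commute)

lemma cov_scaleR_right: "cov k (c *\<^sub>R h) = c * cov k h"
  using cov_scaleR_left[of c h k] by (simp add: cov_commute)

text \<open>The mean is subtracted because it is not yet known to vanish;
  \<open>mean_zero_weak\<close> uses the limit theorem for these centered sums to prove that it
  does.\<close>

definition centered :: "('a \<Rightarrow>\<^sub>L real) \<Rightarrow> 'a \<Rightarrow> real" where
  "centered h x = blinfun_apply h x - (LINT x|\<mu>. blinfun_apply h x)"

lemma centered_measurable [measurable]: "centered h \<in> borel_measurable borel"
  unfolding centered_def by measurable

lemma centered_law_centered:
  "centered_law (distr \<mu> borel (centered h)) (LINT x|\<mu>. (centered h x)\<^sup>2) (LINT x|\<mu>. \<bar>centered h x\<bar>^3)"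
proof -
  define m where "m = (LINT x|\<mu>. h x)"
  have "integrable \<mu> (\<lambda>x. \<bar>centered h x\<bar> ^ 3)"
  proof (rule Bochner_Integration.integrable_bound)
    show "integrable \<mu> (\<lambda>x. 8 * (norm h ^ 3 * norm x ^ 3 + \<bar>m\<bar> ^ 3))" using moment3 by simp
    show "AE x in \<mu>. norm (\<bar>centered h x\<bar> ^ 3) \<le> norm (8 * (norm h ^ 3 * norm x ^ 3 + \<bar>m\<bar> ^ 3))"
    proof (rule AE_I2)
      fix x :: 'a
      have "\<bar>centered h x\<bar> ^ 3 \<le> 8 * (\<bar>h x\<bar> ^ 3 + \<bar>m\<bar> ^ 3)"
        unfolding centered_def m_def by (rule abs_diff_cube_le)
      also have "\<dots> \<le> 8 * ((norm h * norm x) ^ 3 + \<bar>m\<bar> ^ 3)"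
        using norm_blinfun[of h x] by (intro mult_left_mono add_right_mono power_mono) auto
      finally show "norm (\<bar>centered h x\<bar> ^ 3) \<le> norm (8 * (norm h ^ 3 * norm x ^ 3 + \<bar>m\<bar> ^ 3))"
        by (simp add: power_mult_distrib)
    qed
  qed measurable
  moreover have "(LINT x|\<mu>. centered h x) = 0"
    unfolding centered_def using integrable_blinfun[of h] \<mu>.prob_space by simp
  ultimately show ?thesis
    unfolding centered_law_def
    by (auto simp: integrable_distr_eq integral_distr intro!: \<mu>.real_distribution_distr)
qed

definition scaled_sum :: "nat \<Rightarrow> 'w \<Rightarrow> 'a" where
  "scaled_sum n w = (1 / sqrt (real n)) *\<^sub>R (\<Sum>j=1..n. X j w)"

lemma scaled_sum_measurable [measurable]: "scaled_sum n \<in> borel_measurable M"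
  unfolding scaled_sum_def by measurable

lemma scaled_sum_test:
  assumes "continuous_on UNIV \<phi>" "bounded (range \<phi>)"
  shows "(\<lambda>n. LINT w|M. \<phi> (scaled_sum n w)) \<longlonglongrightarrow> (LINT x|\<gamma>. \<phi> x :: real)"
proof -
  have "\<phi> \<in> borel_measurable borel" using assms(1) by (rule borel_measurable_continuous_onI)
  then show ?thesis
    using weak assms unfolding weakly_converges_def scaled_sum_def[symmetric]
    by (auto simp: integral_distr)
qed

definition scaled_centered_sum :: "('a \<Rightarrow>\<^sub>L real) \<Rightarrow> nat \<Rightarrow> 'w \<Rightarrow> real" where
  "scaled_centered_sum h n w = (1 / sqrt (real n)) * (\<Sum>j=1..n. centered h (X j w))"

lemma scaled_centered_sum_measurable [measurable]: "scaled_centered_sum h n \<in> borel_measurable M"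
  unfolding scaled_centered_sum_def by measurable

lemma scaled_centered_sum_eq:
  "blinfun_apply h (scaled_sum n w) = scaled_centered_sum h n w + sqrt n * (LINT x|\<mu>. blinfun_apply h x)"
proof -
  let ?m = "LINT x|\<mu>. h x"
  have "scaled_centered_sum h n w = (1 / sqrt (real n)) * (\<Sum>j=1..n. h (X j w)) - ((1 / sqrt (real n)) * real n) * ?m"
    by (simp add: scaled_centered_sum_def centered_def sum_subtractf right_diff_distrib)
  also have "(1 / sqrt (real n)) * real n = sqrt n" by (simp add: real_div_sqrt)
  finally have "scaled_centered_sum h n w = (1 / sqrt (real n)) * (\<Sum>j=1..n. h (X j w)) - sqrt n * ?m" .
  moreover have "h (scaled_sum n w) = (1 / sqrt (real n)) * (\<Sum>j=1..n. h (X j w))"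
    by (simp add: scaled_sum_def blinfun.scaleR_right blinfun.sum_right)
  ultimately show ?thesis by simp
qed

lemma scaled_centered_sum_char_limit:
  "(\<lambda>n. char (distr M borel (scaled_centered_sum h n)) t) \<longlonglongrightarrow> complex_of_real (exp (- ((LINT x|\<mu>. (centered h x)\<^sup>2) * t\<^sup>2) / 2))"
proof -
  let ?\<nu> = "distr \<mu> borel (centered h)"
  have "char (distr M borel (scaled_centered_sum h n)) t = char ?\<nu> (t / sqrt n) ^ n" for n
  proof -
    have "char (distr M borel (scaled_centered_sum h n)) t
        = char (distr M borel (\<lambda>w. \<Sum>j=1..n. centered h (X j w))) ((1 / sqrt (real n)) * t)"
      unfolding scaled_centered_sum_def by (rule M.char_scale) measurable
    also have "\<dots> = char ?\<nu> ((1 / sqrt (real n)) * t) ^ card {1..n}"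
    proof (rule M.char_iid_sum)
      have "M.indep_vars (\<lambda>_. borel) X {1..n}" by (rule M.indep_vars_subset[OF indep]) auto
      then show "M.indep_vars (\<lambda>_. borel) (\<lambda>j w. centered h (X j w)) {1..n}"
        by (rule M.indep_vars_compose2) simp
      fix j assume "j \<in> {1..n}"
      then have j: "j \<ge> 1" by simp
      have "distr M borel (\<lambda>w. centered h (X j w)) = distr (distr M borel (X j)) borel (centered h)"
        using j by (subst distr_distr) (auto simp: comp_def)
      then show "distr M borel (\<lambda>w. centered h (X j w)) = ?\<nu>"
        by (simp only: law[OF j])
    qed
    finally show ?thesis by simp
  qed
  then show ?thesis
    using char_power_tendsto[of 0 "\<lambda>_. ?\<nu>" "\<lambda>_. LINT x|\<mu>. (centered h x)\<^sup>2", OF centered_law_centered tendsto_const]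
    by simp
qed

text \<open>The centered sums are tight by the scalar central limit theorem and the uncentered ones
  by weak convergence. They differ by sqrt n times the mean, which therefore stays bounded only if
  the mean is 0. Tightness is expressed by smooth Gaussian test functions.\<close>

lemma mean_zero_weak:
  fixes h :: "'a \<Rightarrow>\<^sub>L real"
  shows "(LINT x|\<mu>. blinfun_apply h x) = 0"
proof (rule ccontr)
  let ?m = "LINT x|\<mu>. h x"
  let ?v = "LINT x|\<mu>. (centered h x)\<^sup>2"
  assume m: "?m \<noteq> 0"
  have v: "0 \<le> ?v" by (rule integral_nonneg_AE) simp
  \<comment> \<open>With this choice v / (2 L^2) stays below 1/4 for every v, and the added 1 keeps
    \<open>L\<close> positive when v = 0.\<close>
  define L where "L = sqrt (4 * ?v + 1)"
  have "0 < 4 * ?v + 1" using v by linarith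
  then have L: "0 < L" "L\<^sup>2 = 4 * ?v + 1" by (simp_all add: L_def)
  have rd: "real_distribution (distr M borel (scaled_centered_sum h n))" for n by (rule M.real_distribution_distr) simp
  obtain l where l: "1 - ?v / (2 * L\<^sup>2) \<le> l"
    and lim: "(\<lambda>n. LINT y|distr M borel (scaled_centered_sum h n). exp (- (y / L)\<^sup>2 / 2)) \<longlonglongrightarrow> l"
    using tendsto_gaussian_average[of 0 "\<lambda>n. distr M borel (scaled_centered_sum h n)", OF rd scaled_centered_sum_char_limit L(1) v] by auto
  have "x / (2 * (4 * x + 1)) < 1 / 4" if "0 \<le> x" for x :: real using that by (simp add: field_simps)
  from this[OF v] have "?v / (2 * L\<^sup>2) < 1 / 4" unfolding L(2) .
  with l have "3 / 4 < l" by simp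
  from order_tendstoD(1)[OF lim this]
  have ev1: "\<forall>\<^sub>F n in sequentially. 3 / 4 < (LINT w|M. exp (- (scaled_centered_sum h n w / L)\<^sup>2 / 2))"
    by (simp add: integral_distr)
  have "(\<lambda>K::nat. LINT x|\<gamma>. exp (- (h x / real K)\<^sup>2 / 2)) \<longlonglongrightarrow> (LINT x|\<gamma>. 1)"
  proof (rule integral_dominated_convergence[where w = "\<lambda>_. 1"])
    show "AE x in \<gamma>. (\<lambda>K::nat. exp (- (h x / real K)\<^sup>2 / 2)) \<longlonglongrightarrow> 1"
    proof (rule AE_I2)
      fix x
      have "(\<lambda>K::nat. exp (- (h x / real K)\<^sup>2 / 2)) \<longlonglongrightarrow> exp (- (0::real)\<^sup>2 / 2)"
        by (intro tendsto_intros lim_const_over_n) auto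
      then show "(\<lambda>K::nat. exp (- (h x / real K)\<^sup>2 / 2)) \<longlonglongrightarrow> 1" by simp
    qed
  qed auto
  then have "\<forall>\<^sub>F K in sequentially. 3 / 4 < (LINT x|\<gamma>. exp (- (h x / real K)\<^sup>2 / 2))"
    using \<gamma>.prob_space by (intro order_tendstoD(1)) auto
  then have "\<forall>\<^sub>F K in sequentially. 3 / 4 < (LINT x|\<gamma>. exp (- (h x / real K)\<^sup>2 / 2)) \<and> 1 \<le> K"
    using eventually_ge_at_top[of 1] by eventually_elim auto
  then obtain K :: nat where K: "3 / 4 < (LINT x|\<gamma>. exp (- (h x / real K)\<^sup>2 / 2))" "1 \<le> K"
    by (auto simp: eventually_sequentially)
  have "(\<lambda>n. LINT w|M. exp (- (h (scaled_sum n w) / real K)\<^sup>2 / 2))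
      \<longlonglongrightarrow> (LINT x|\<gamma>. exp (- (h x / real K)\<^sup>2 / 2))"
  proof (rule scaled_sum_test)
    show "continuous_on UNIV (\<lambda>x. exp (- (h x / real K)\<^sup>2 / 2))"
      by (intro continuous_intros) (use K(2) in auto)
    show "bounded (range (\<lambda>x. exp (- (h x / real K)\<^sup>2 / 2)))"
      by (rule boundedI[of _ 1]) auto
  qed
  then have ev2: "\<forall>\<^sub>F n in sequentially. 3 / 4 < (LINT w|M. exp (- (h (scaled_sum n w) / real K)\<^sup>2 / 2))"
    using K(1) by (rule order_tendstoD(1))
  have "\<forall>\<^sub>F n in sequentially. sqrt n * \<bar>?m\<bar> \<le> 2 * real K + 2 * L"
    using ev1 ev2
  proof eventually_elim
    fix n
    let ?f = "\<lambda>w. exp (- (scaled_centered_sum h n w / L)\<^sup>2 / 2)"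
      and ?g = "\<lambda>w. exp (- (h (scaled_sum n w) / real K)\<^sup>2 / 2)"
    assume 1: "3 / 4 < (LINT w|M. ?f w)" and 2: "3 / 4 < (LINT w|M. ?g w)"
    have i: "integrable M ?f" "integrable M ?g"
      by (rule M.integrable_const_bound[where B = 1]; auto)+
    \<comment> \<open>Two functions bounded by 1 with means above 3/4 are both above 1/2 at some
      common point, where the centered and the uncentered sum are bounded simultaneously.\<close>
    have "\<exists>w\<in>space M. 3 / 2 < ?f w + ?g w"
    proof (rule ccontr)
      assume "\<not> ?thesis"
      then have "(LINT w|M. ?f w + ?g w) \<le> (LINT w|M. 3 / 2)"
        using i by (intro integral_mono) (auto simp: not_less)
      then show False using 1 2 i M.prob_space by simp
    qed
    then obtain w where w: "3 / 2 < ?f w + ?g w" by auto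
    have "?f w \<le> 1" "?g w \<le> 1" by auto
    with w have f: "1 / 2 \<le> ?f w" and g: "1 / 2 \<le> ?g w" by linarith+
    from abs_le_2_if_exp_ge_half[OF f] abs_le_2_if_exp_ge_half[OF g]
    have "\<bar>scaled_centered_sum h n w\<bar> \<le> 2 * L" "\<bar>h (scaled_sum n w)\<bar> \<le> 2 * real K"
      using L(1) K(2) by (auto simp: field_simps)
    then have "\<bar>sqrt n * ?m\<bar> \<le> 2 * real K + 2 * L" using scaled_centered_sum_eq[of h n w] by linarith
    then show "sqrt n * \<bar>?m\<bar> \<le> 2 * real K + 2 * L" by (simp add: abs_mult)
  qed
  moreover have "filterlim (\<lambda>n. sqrt (real n) * \<bar>?m\<bar>) at_top sequentially"
    using m by (intro filterlim_at_top_mult_tendsto_pos[OF tendsto_const] filterlim_compose[OF sqrt_at_top filterlim_real_sequentially]) auto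
  then have "\<forall>\<^sub>F n in sequentially. 2 * real K + 2 * L < sqrt (real n) * \<bar>?m\<bar>"
    by (simp add: filterlim_at_top_dense)
  ultimately have "\<forall>\<^sub>F n in sequentially. False" by eventually_elim auto
  then show False by simp
qed

lemma mean_zero: "(LINT x|\<mu>. x) = 0"
proof (rule eq_if_blinfun_eq)
  fix h :: "'a \<Rightarrow>\<^sub>L real"
  show "h (LINT x|\<mu>. x) = blinfun_apply h 0"
    using integral_bounded_linear[OF blinfun.bounded_linear_right integrable_id, of h] mean_zero_weak[of h]
    by (simp add: blinfun.zero_right)
qed

lemma centered_eq: "centered h = blinfun_apply h"
  by (auto simp: centered_def mean_zero_weak)

text \<open>The characteristic functions of the scaled sums have two limits: one from the scalar
  central limit theorem, the other from weak convergence tested with cosine and sine. Their equality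
  shows that every marginal of \<open>\<gamma>\<close> is a centered normal law.\<close>

lemma char_\<gamma>: "char (distr \<gamma> borel (blinfun_apply h)) t = complex_of_real (exp (- (cov h h * t\<^sup>2) / 2))"
proof (rule LIMSEQ_unique)
  have Y: "scaled_centered_sum h n = (\<lambda>w. h (scaled_sum n w))" for n
    using scaled_centered_sum_eq[of h n] by (simp add: mean_zero_weak)
  show "(\<lambda>n. char (distr M borel (scaled_centered_sum h n)) t) \<longlonglongrightarrow> complex_of_real (exp (- (cov h h * t\<^sup>2) / 2))"
    using scaled_centered_sum_char_limit[of h t] by (simp add: centered_eq cov_def power2_eq_square)
  have bd: "bounded (range (\<lambda>x. cos (t * h x)))" "bounded (range (\<lambda>x. sin (t * h x)))"
    by (rule boundedI[of _ 1]; auto)+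
  have "(\<lambda>n. LINT w|M. cos (t * h (scaled_sum n w))) \<longlonglongrightarrow> (LINT x|\<gamma>. cos (t * h x))"
    by (rule scaled_sum_test[OF _ bd(1)]) (intro continuous_intros)
  moreover have "(\<lambda>n. LINT w|M. sin (t * h (scaled_sum n w))) \<longlonglongrightarrow> (LINT x|\<gamma>. sin (t * h x))"
    by (rule scaled_sum_test[OF _ bd(2)]) (intro continuous_intros)
  moreover have "real_distribution (distr M borel (\<lambda>w. h (scaled_sum n w)))" for n
    by (rule M.real_distribution_distr) simp
  moreover have "real_distribution (distr \<gamma> borel (blinfun_apply h))"
    by (rule \<gamma>.real_distribution_distr) simp
  ultimately show "(\<lambda>n. char (distr M borel (scaled_centered_sum h n)) t) \<longlonglongrightarrow> char (distr \<gamma> borel (blinfun_apply h)) t"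
    unfolding Y by (simp add: char_eq_cos_sin integral_distr tendsto_Complex)
qed

section \<open>Laplace transform and rate function of the limit law\<close>

lemma laplace_\<gamma>: "laplace \<gamma> h = ennreal (exp (cov h h / 2))"
proof -
  have "(\<integral>\<^sup>+y. ennreal (exp y) \<partial>distr \<gamma> borel (blinfun_apply h)) = ennreal (exp (cov h h / 2))"
    by (rule laplace_normal_law[OF _ char_\<gamma> cov_nonneg]) (rule \<gamma>.real_distribution_distr, simp)
  then show ?thesis by (simp add: laplace_def nn_integral_distr)
qed

lemma log_laplace_\<gamma>: "log_laplace \<gamma> h = ereal (cov h h / 2)"
  by (simp add: log_laplace_def laplace_\<gamma>)

lemma rate_function_ge: "ereal (blinfun_apply h x - cov h h / 2) \<le> rate_function \<gamma> x"
  unfolding rate_function_def by (rule SUP_upper2[of h]) (auto simp: log_laplace_\<gamma>)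

text \<open>For each competing \<open>k\<close> the bound is the nonnegativity of the variance of
  \<open>k - r f\<close>. It is used to place a multiple of \<open>cov_vec f\<close> in the level
  set of the rate function through the dominating point.\<close>

lemma rate_function_scaled_cov_vec: "rate_function \<gamma> (r *\<^sub>R cov_vec f) \<le> ereal (r\<^sup>2 * cov f f / 2)"
  unfolding rate_function_def
proof (rule SUP_least)
  fix k :: "'a \<Rightarrow>\<^sub>L real"
  have "0 \<le> cov (k + (- r) *\<^sub>R f) (k + (- r) *\<^sub>R f)" by (rule cov_nonneg)
  also have "\<dots> = cov k k - 2 * r * cov f k + r\<^sup>2 * cov f f"
    unfolding cov_add_left cov_add_right cov_scaleR_left cov_scaleR_right
    by (simp add: cov_commute[of k f] power2_eq_square algebra_simps)
  finally show "ereal (k (r *\<^sub>R cov_vec f)) - log_laplace \<gamma> k \<le> ereal (r\<^sup>2 * cov f f / 2)"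
    by (simp add: log_laplace_\<gamma> blinfun.scaleR_right blinfun_cov_vec)
qed

text \<open>Since \<open>g\<close> attains the supremum that defines the rate function at \<open>a0\<close>, stationarity in every
  direction \<open>h\<close> identifies \<open>a0\<close>.\<close>

lemma dominating_functional_cov_vec:
  assumes "dominating_functional \<gamma> D a0 g"
  shows "a0 = cov_vec g"
proof (rule eq_if_blinfun_eq)
  fix h :: "'a \<Rightarrow>\<^sub>L real"
  have rate: "rate_function \<gamma> a0 = ereal (g a0 - cov g g / 2)"
    using assms by (simp add: dominating_functional_def log_laplace_\<gamma>)
  have le: "t * (h a0 - cov g h) \<le> t\<^sup>2 * cov h h / 2" for t
  proof -
    have "blinfun_apply (g + t *\<^sub>R h) a0 - cov (g + t *\<^sub>R h) (g + t *\<^sub>R h) / 2 \<le> g a0 - cov g g / 2"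
      using rate_function_ge[of "g + t *\<^sub>R h" a0] unfolding rate by simp
    moreover have "cov (g + t *\<^sub>R h) (g + t *\<^sub>R h) = cov g g + 2 * t * cov g h + t\<^sup>2 * cov h h"
      unfolding cov_add_left cov_add_right cov_scaleR_left cov_scaleR_right
      by (simp add: cov_commute[of h g] power2_eq_square algebra_simps)
    ultimately show ?thesis by (simp add: blinfun.add_left blinfun.scaleR_left field_simps)
  qed
  define d where "d = h a0 - cov g h"
  have "d = 0"
  proof (rule ccontr)
    assume "d \<noteq> 0"
    \<comment> \<open>This makes the left side of \<open>le\<close> equal to t^2 (cov h h + 1), more
      than the right side t^2 cov h h / 2; the added 1 covers the case of zero variance.\<close>
    define t where "t = d / (cov h h + 1)"
    have pos: "0 < cov h h + 1" using cov_nonneg[of h] by simp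
    have d: "d = t * (cov h h + 1)" using pos by (simp add: t_def)
    have "t \<noteq> 0" using \<open>d \<noteq> 0\<close> pos by (simp add: t_def)
    have "t * (t * (cov h h + 1)) \<le> t\<^sup>2 * cov h h / 2" using le[of t] unfolding d_def[symmetric] d[symmetric] .
    then have "t\<^sup>2 * (cov h h / 2 + 1) \<le> 0" by (simp add: power2_eq_square algebra_simps)
    moreover have "0 < t\<^sup>2 * (cov h h / 2 + 1)" using \<open>t \<noteq> 0\<close> cov_nonneg[of h] by (intro mult_pos_pos) auto
    ultimately show False by simp
  qed
  then show "h a0 = h (cov_vec g)" by (simp add: d_def blinfun_cov_vec)
qed

lemma rate_function_dominating:
  assumes "dominating_functional \<gamma> D a0 g"
  shows "rate_function \<gamma> a0 = ereal (cov g g / 2)" "blinfun_apply g a0 = cov g g"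
proof -
  show g: "g a0 = cov g g"
    using dominating_functional_cov_vec[OF assms] by (simp add: blinfun_cov_vec)
  show "rate_function \<gamma> a0 = ereal (cov g g / 2)"
    using assms by (simp add: dominating_functional_def log_laplace_\<gamma> g)
qed

lemma cov_eq_0_AE: "cov h h = 0 \<Longrightarrow> AE x in \<mu>. blinfun_apply h x = 0"
  using integral_nonneg_eq_0_iff_AE[OF integrable_blinfun_mult[of h h]] by (simp add: cov_def)

lemma cov_dominating_pos:
  assumes "dominating_functional \<gamma> D a0 g" and "a0 \<noteq> 0"
  shows "0 < cov g g"
proof (rule ccontr)
  assume "\<not> 0 < cov g g"
  then have "AE x in \<mu>. g x = 0" using cov_nonneg[of g] by (intro cov_eq_0_AE) auto
  then have "cov_vec g = (LINT x|\<mu>. 0)"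
    unfolding cov_vec_def by (intro integral_cong_AE) auto
  then show False using dominating_functional_cov_vec[OF assms(1)] assms(2) by simp
qed

text \<open>Variances determine functionals only up to \<open>\<mu>\<close>-null sets, so
  proportionality is obtained almost everywhere. The value at the single point \<open>a0\<close>
  does not follow from that and is recorded separately.\<close>

lemma separating_functional_proportional:
  assumes dp: "dominating_point \<gamma> D a0" and g: "dominating_functional \<gamma> D a0 g" and a0: "a0 \<noteq> 0"
    and f: "separating_functional \<gamma> D a0 f"
  shows "\<exists>c>0. (AE x in \<mu>. blinfun_apply f x = c * blinfun_apply g x) \<and> blinfun_apply f a0 = c * blinfun_apply g a0"
proof -
  define vf vg where "vf = cov f f" and "vg = cov g g"
  have vg: "0 < vg" using cov_dominating_pos[OF g a0] by (simp add: vg_def)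
  have fa: "f a0 = cov f g"
    using dominating_functional_cov_vec[OF g] by (simp add: blinfun_cov_vec cov_commute)
  \<comment> \<open>If \<open>f\<close> had zero variance, then \<open>f a0 = 0\<close> and
    \<open>f\<close> would be positive on \<open>D\<close>. Arbitrarily large multiples of
    \<open>f\<close>, at no cost in variance, would make the rate infinite on all of
    \<open>D\<close>, against the finite infimum.\<close>
  have vf: "0 < vf"
  proof (rule ccontr)
    assume "\<not> 0 < vf"
    then have vf0: "cov f f = 0" using cov_nonneg[of f] by (simp add: vf_def)
    from cov_eq_0_AE[OF vf0] have "cov f g = (LINT x|\<mu>. 0)"
      unfolding cov_def by (intro integral_cong_AE) auto
    then have "f a0 = 0" using fa by simp
    with f have fpos: "0 < f x" if "x \<in> D" for x
      using that by (auto simp: separating_functional_def)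
    have "rate_function \<gamma> x = \<infinity>" if "x \<in> D" for x
    proof (rule ereal_top)
      fix B :: real
      have "ereal B \<le> ereal (blinfun_apply ((B / f x) *\<^sub>R f) x
          - cov ((B / f x) *\<^sub>R f) ((B / f x) *\<^sub>R f) / 2)"
        using fpos[OF that] by (simp add: blinfun.scaleR_left cov_scaleR_left cov_scaleR_right vf0)
      also have "\<dots> \<le> rate_function \<gamma> x" by (rule rate_function_ge)
      finally show "ereal B \<le> rate_function \<gamma> x" .
    qed
    then have "(INF x\<in>D. rate_function \<gamma> x) = \<infinity>" by (auto intro!: INF_eqI)
    with dp show False by (auto simp: dominating_point_def)
  qed
  \<comment> \<open>Scales the maximising direction of \<open>f\<close> to the rate of
    \<open>a0\<close>, so that the supremum in the separating condition applies to it and reverses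
    Cauchy-Schwarz.\<close>
  define r where "r = sqrt (vg / vf)"
  have r: "0 < r" "r\<^sup>2 = vg / vf" using vf vg by (auto simp: r_def)
  have "rate_function \<gamma> (r *\<^sub>R cov_vec f) \<le> ereal (r\<^sup>2 * cov f f / 2)" by (rule rate_function_scaled_cov_vec)
  also have "\<dots> = rate_function \<gamma> a0"
    using rate_function_dominating(1)[OF g] vf r(2) by (simp add: vf_def vg_def)
  finally have "r *\<^sub>R cov_vec f \<in> {z. rate_function \<gamma> z \<le> rate_function \<gamma> a0}" by simp
  then have "ereal (f (r *\<^sub>R cov_vec f)) \<le> (SUP z\<in>{z. rate_function \<gamma> z \<le> rate_function \<gamma> a0}. ereal (blinfun_apply f z))"
    by (rule SUP_upper)
  also have "\<dots> = ereal (f a0)" using f by (simp add: separating_functional_def)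
  finally have le: "r * vf \<le> cov f g"
    by (simp add: blinfun.scaleR_right blinfun_cov_vec fa vf_def)
  have "0 < r * vf" using r vf by simp
  with le have pos: "0 < cov f g" by simp
  have "vg * vf = r\<^sup>2 * vf\<^sup>2" unfolding r(2) using vf by (simp add: power2_eq_square)
  also have "\<dots> = (r * vf)\<^sup>2" by (rule power_mult_distrib[symmetric])
  also have "\<dots> \<le> (cov f g)\<^sup>2" using le \<open>0 < r * vf\<close> by (intro power_mono) auto
  finally have cs: "vg * vf \<le> (cov f g)\<^sup>2" .
  \<comment> \<open>The coefficient of the orthogonal projection of \<open>f\<close> on
    \<open>g\<close>; the residual variance is vf - cov(f,g)^2 / vg, which is now at most 0.\<close>
  define c where "c = cov f g / vg"
  have c: "0 < c" using pos vg by (simp add: c_def)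
  have "cov (f + (- c) *\<^sub>R g) (f + (- c) *\<^sub>R g) = vf - 2 * c * cov f g + c\<^sup>2 * vg"
    unfolding cov_add_left cov_add_right cov_scaleR_left cov_scaleR_right
    by (simp add: cov_commute[of g f] power2_eq_square algebra_simps vf_def vg_def)
  also have "\<dots> = vf - (cov f g)\<^sup>2 / vg" using vg by (simp add: c_def power2_eq_square field_simps)
  also have "\<dots> \<le> 0" using cs vg by (simp add: field_simps)
  finally have "cov (f + (- c) *\<^sub>R g) (f + (- c) *\<^sub>R g) = 0" using cov_nonneg by (simp add: order.antisym)
  from cov_eq_0_AE[OF this] have "AE x in \<mu>. f x = c * g x"
    by eventually_elim (simp add: blinfun.diff_left blinfun.scaleR_left)
  moreover have "f a0 = c * g a0"
    using fa rate_function_dominating(2)[OF g] vg by (simp add: c_def vg_def)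
  ultimately show ?thesis using c by blast
qed

end

section \<open>The tilted law\<close>

lemma exp_taylor_bound:
  fixes y :: real
  shows "\<bar>exp y - (\<Sum>m<n. y ^ m / fact m)\<bar> \<le> \<bar>y\<bar> ^ n * exp \<bar>y\<bar>"
proof -
  obtain t where t: "\<bar>t\<bar> \<le> \<bar>y\<bar>" "exp y = (\<Sum>m<n. y ^ m / fact m) + exp t / fact n * y ^ n"
    using Maclaurin_exp_le[of y n] by blast
  have "\<bar>exp t / fact n * y ^ n\<bar> = (exp t / fact n) * \<bar>y\<bar> ^ n"
    by (simp add: abs_mult power_abs)
  also have "\<dots> \<le> (exp \<bar>y\<bar> / 1) * \<bar>y\<bar> ^ n"
    using t(1) by (intro mult_right_mono frac_le) (auto simp: fact_ge_1)
  finally show ?thesis using t(2) by (simp add: mult.commute)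
qed

locale tilted_clt = clt_domain M X \<mu> \<gamma>
  for M :: "'w measure" and X :: "nat \<Rightarrow> 'w \<Rightarrow> 'a::{banach, second_countable_topology}"
    and \<mu> \<gamma> :: "'a measure" +
  fixes g :: "'a \<Rightarrow>\<^sub>L real" and t1 :: real
  assumes t1: "0 < t1"
    and exp_moment: "integrable \<mu> (\<lambda>x. norm x ^ 3 * exp (t1 * \<bar>g x\<bar>))"
begin

text \<open>One quantity that dominates the Taylor remainders for all tilts between 0 and
  \<open>t1\<close> at once, which makes the constants below uniform in the tilt.\<close>

definition weighted_moment3 :: real where "weighted_moment3 = (LINT x|\<mu>. norm x ^ 3 * exp (t1 * \<bar>g x\<bar>))"

lemma weighted_moment3_nonneg: "0 \<le> weighted_moment3"
  unfolding weighted_moment3_def by (rule integral_nonneg_AE) simp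

lemma abs_g_le: "\<bar>g x\<bar> \<le> norm g * norm x"
  using norm_blinfun[of g x] by simp

lemma exp_le_t1: "e \<le> t1 \<Longrightarrow> exp (e * \<bar>g x\<bar>) \<le> exp (t1 * \<bar>g x\<bar>)"
  by (simp add: mult_right_mono)

lemma exp_g_le: "\<lbrakk>0 \<le> e; e \<le> t1\<rbrakk> \<Longrightarrow> exp (e * g x) \<le> exp (t1 * \<bar>g x\<bar>)"
  by (rule order_trans[OF _ exp_le_t1[of e]]) (auto intro: mult_left_mono)

text \<open>Lower powers of the norm are covered too: inside the unit ball the weight is at most
  \<open>exp (t1 * norm g)\<close>, outside it the power can be raised to 3.\<close>

lemma integrable_dominated:
  fixes \<phi> :: "'a \<Rightarrow> 'b::{banach, second_countable_topology}"
  assumes [measurable]: "\<phi> \<in> borel_measurable borel" and k: "k \<le> 3" and c: "0 \<le> c"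
    and le: "\<And>x. norm (\<phi> x) \<le> c * (norm x ^ k * exp (t1 * \<bar>g x\<bar>))"
  shows "integrable \<mu> \<phi>"
proof (rule Bochner_Integration.integrable_bound)
  show "integrable \<mu> (\<lambda>x. c * (exp (t1 * norm g) + norm x ^ 3 * exp (t1 * \<bar>g x\<bar>)))"
    using exp_moment by simp
  show "AE x in \<mu>. norm (\<phi> x) \<le> norm (c * (exp (t1 * norm g) + norm x ^ 3 * exp (t1 * \<bar>g x\<bar>)))"
  proof (rule AE_I2)
    fix x
    have "norm x ^ k * exp (t1 * \<bar>g x\<bar>)
      \<le> exp (t1 * norm g) + norm x ^ 3 * exp (t1 * \<bar>g x\<bar>)"
    proof (cases "norm x \<le> 1")
      case True
      have "\<bar>g x\<bar> \<le> norm g * 1"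
        by (rule order_trans[OF abs_g_le mult_left_mono[OF True]]) simp
      then have "exp (t1 * \<bar>g x\<bar>) \<le> exp (t1 * norm g)" using t1 by simp
      moreover have "norm x ^ k * exp (t1 * \<bar>g x\<bar>) \<le> 1 * exp (t1 * \<bar>g x\<bar>)"
        using True by (intro mult_right_mono power_le_one) auto
      moreover have "0 \<le> norm x ^ 3 * exp (t1 * \<bar>g x\<bar>)" by simp
      ultimately show ?thesis by linarith
    next
      case False
      then have "norm x ^ k * exp (t1 * \<bar>g x\<bar>) \<le> norm x ^ 3 * exp (t1 * \<bar>g x\<bar>)"
        using k by (intro mult_right_mono power_increasing) auto
      moreover have "0 < exp (t1 * norm g)" by simp
      ultimately show ?thesis by linarith
    qed
    from mult_left_mono[OF this c] le[of x]
    have "norm (\<phi> x) \<le> c * (exp (t1 * norm g) + norm x ^ 3 * exp (t1 * \<bar>g x\<bar>))"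
      by linarith
    then show "norm (\<phi> x) \<le> norm (c * (exp (t1 * norm g) + norm x ^ 3 * exp (t1 * \<bar>g x\<bar>)))"
      by (rule order_trans) simp
  qed
qed measurable

lemma integral_norm_dominated:
  fixes \<phi> :: "'a \<Rightarrow> 'b::{banach, second_countable_topology}"
  assumes [measurable]: "\<phi> \<in> borel_measurable borel" and c: "0 \<le> c"
    and le: "\<And>x. norm (\<phi> x) \<le> c * (norm x ^ 3 * exp (t1 * \<bar>g x\<bar>))"
  shows "norm (LINT x|\<mu>. \<phi> x) \<le> c * weighted_moment3"
proof -
  have i: "integrable \<mu> \<phi>" using c le by (intro integrable_dominated[of _ 3 c]) auto
  have "norm (LINT x|\<mu>. \<phi> x) \<le> (LINT x|\<mu>. norm (\<phi> x))" by (rule integral_norm_bound)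
  also have "\<dots> \<le> (LINT x|\<mu>. c * (norm x ^ 3 * exp (t1 * \<bar>g x\<bar>)))"
    using i le exp_moment by (intro integral_mono integrable_norm) auto
  also have "\<dots> = c * weighted_moment3" by (simp add: weighted_moment3_def)
  finally show ?thesis .
qed

context
  fixes e :: real
  assumes e: "0 \<le> e" "e \<le> t1"
begin

lemma integrable_exp: "integrable \<mu> (\<lambda>x. exp (e * g x))"
  by (rule integrable_dominated[of _ 0 1]) (use exp_g_le[OF e] in auto)

lemma integrable_exp_scaleR: "integrable \<mu> (\<lambda>x. exp (e * g x) *\<^sub>R x)"
proof (rule integrable_dominated[of _ 1 1])
  fix x
  show "norm (exp (e * g x) *\<^sub>R x) \<le> 1 * (norm x ^ 1 * exp (t1 * \<bar>g x\<bar>))"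
    using mult_left_mono[OF exp_g_le[OF e, of x], of "norm x"] by (simp add: mult.commute)
qed auto

lemma abs_g_power_exp_le: "\<bar>g x\<bar> ^ k * exp (e * g x)
    \<le> norm g ^ k * (norm x ^ k * exp (t1 * \<bar>g x\<bar>))"
proof -
  have "\<bar>g x\<bar> ^ k * exp (e * g x)
      \<le> (norm g * norm x) ^ k * exp (t1 * \<bar>g x\<bar>)"
    by (intro mult_mono power_mono abs_g_le exp_g_le[OF e]) auto
  then show ?thesis by (simp add: power_mult_distrib mult.assoc)
qed

lemma integrable_abs_g_power_exp:
  "k \<le> 3 \<Longrightarrow> integrable \<mu> (\<lambda>x. \<bar>g x\<bar> ^ k * exp (e * g x))"
  by (rule integrable_dominated[of _ k "norm g ^ k"]) (use abs_g_power_exp_le in auto)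

definition mgf :: real where "mgf = (LINT x|\<mu>. exp (e * g x))"

lemma taylor_remainder_le:
  "\<bar>exp (e * g x) - (\<Sum>m<k. (e * g x) ^ m / fact m)\<bar>
    \<le> e ^ k * norm g ^ k * (norm x ^ k * exp (t1 * \<bar>g x\<bar>))"
proof -
  have "\<bar>exp (e * g x) - (\<Sum>m<k. (e * g x) ^ m / fact m)\<bar>
      \<le> \<bar>e * g x\<bar> ^ k * exp \<bar>e * g x\<bar>"
    by (rule exp_taylor_bound)
  also have "\<dots> = e ^ k * (\<bar>g x\<bar> ^ k * exp (e * \<bar>g x\<bar>))"
    using e by (simp add: abs_mult power_mult_distrib)
  also have "\<dots> \<le> e ^ k * ((norm g * norm x) ^ k * exp (t1 * \<bar>g x\<bar>))"
    using e by (intro mult_left_mono mult_mono power_mono abs_g_le exp_le_t1) auto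
  finally show ?thesis by (simp add: power_mult_distrib mult_ac)
qed

lemma mgf_ge_1: "1 \<le> mgf"
proof -
  have "1 = (LINT x|\<mu>. 1 + e * g x)"
    using integrable_blinfun[of g] by (simp add: mean_zero_weak \<mu>.prob_space)
  also have "\<dots> \<le> mgf"
    unfolding mgf_def using integrable_blinfun[of g]
    by (intro integral_mono integrable_exp) (auto intro: exp_ge_add_one_self)
  finally show ?thesis .
qed

lemma laplace_eq: "laplace \<mu> (e *\<^sub>R g) = ennreal mgf"
  unfolding laplace_def mgf_def
  by (simp add: blinfun.scaleR_left nn_integral_eq_integral[OF integrable_exp])

text \<open>In this expansion and in those of the mean and the second moment below, the order is
  chosen so that the remainder carries exactly the third power of \<open>norm x\<close>. The linear
  term drops out because the mean is 0.\<close>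

lemma mgf_taylor: "\<bar>mgf - (1 + e\<^sup>2 * cov g g / 2)\<bar> \<le> e ^ 3 * (norm g ^ 3 * weighted_moment3)"
proof -
  have "mgf - (1 + e\<^sup>2 * cov g g / 2)
      = (LINT x|\<mu>. exp (e * g x) - (1 + e * g x + e\<^sup>2 / 2 * (g x)\<^sup>2))"
    using integrable_exp integrable_blinfun[of g] integrable_blinfun_square[of g]
    by (simp add: mgf_def cov_def mean_zero_weak \<mu>.prob_space power2_eq_square)
  also have "norm \<dots> \<le> e ^ 3 * norm g ^ 3 * weighted_moment3"
  proof (rule integral_norm_dominated)
    fix x
    show "norm (exp (e * g x) - (1 + e * g x + e\<^sup>2 / 2 * (g x)\<^sup>2))
      \<le> e ^ 3 * norm g ^ 3 * (norm x ^ 3 * exp (t1 * \<bar>g x\<bar>))"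
      using taylor_remainder_le[where k = 3, of x]
      by (simp add: numeral_3_eq_3 power2_eq_square mult_ac)
  qed (use e in auto)
  finally show ?thesis by (simp add: mult.assoc)
qed

lemma exp_mean_taylor:
  "norm ((LINT x|\<mu>. exp (e * g x) *\<^sub>R x) - e *\<^sub>R cov_vec g) \<le> e\<^sup>2 * (norm g ^ 2 * weighted_moment3)"
proof -
  have i: "integrable \<mu> (\<lambda>x. e *\<^sub>R (g x *\<^sub>R x))"
    by (rule integrable_scaleR_right[OF integrable_blinfun_scaleR])
  have "(LINT x|\<mu>. x + e *\<^sub>R (g x *\<^sub>R x)) = (LINT x|\<mu>. x) + (LINT x|\<mu>. e *\<^sub>R (g x *\<^sub>R x))"
    by (rule Bochner_Integration.integral_add[OF integrable_id i])
  also have "\<dots> = e *\<^sub>R cov_vec g"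
    unfolding cov_vec_def mean_zero by (simp del: scaleR_scaleR)
  finally have "(LINT x|\<mu>. exp (e * g x) *\<^sub>R x) - e *\<^sub>R cov_vec g
      = (LINT x|\<mu>. exp (e * g x) *\<^sub>R x - (x + e *\<^sub>R (g x *\<^sub>R x)))"
    using Bochner_Integration.integral_diff[OF integrable_exp_scaleR Bochner_Integration.integrable_add[OF integrable_id i]]
    by simp
  also have "\<dots> = (LINT x|\<mu>. (exp (e * g x) - (1 + e * g x)) *\<^sub>R x)"
    by (intro Bochner_Integration.integral_cong) (auto simp: algebra_simps)
  also have "norm \<dots> \<le> e\<^sup>2 * norm g ^ 2 * weighted_moment3"
  proof (rule integral_norm_dominated)
    fix x
    have "\<bar>exp (e * g x) - (1 + e * g x)\<bar>
      \<le> e\<^sup>2 * norm g ^ 2 * (norm x ^ 2 * exp (t1 * \<bar>g x\<bar>))"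
      using taylor_remainder_le[where k = 2, of x] by (simp add: numeral_2_eq_2)
    from mult_right_mono[OF this, of "norm x"]
    show "norm ((exp (e * g x) - (1 + e * g x)) *\<^sub>R x)
      \<le> e\<^sup>2 * norm g ^ 2 * (norm x ^ 3 * exp (t1 * \<bar>g x\<bar>))"
      by (simp add: power3_eq_cube power2_eq_square mult_ac)
  qed auto
  finally show ?thesis by (simp add: mult.assoc)
qed

lemma exp_second_moment_taylor:
  "\<bar>(LINT x|\<mu>. (g x)\<^sup>2 * exp (e * g x)) - cov g g\<bar> \<le> e * (norm g ^ 3 * weighted_moment3)"
proof -
  have "(LINT x|\<mu>. (g x)\<^sup>2 * exp (e * g x)) - cov g g
      = (LINT x|\<mu>. (g x)\<^sup>2 * exp (e * g x) - (g x)\<^sup>2)"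
    using integrable_abs_g_power_exp[of 2] integrable_blinfun_square[of g]
    by (simp add: cov_def power2_eq_square)
  also have "norm \<dots> \<le> e * norm g ^ 3 * weighted_moment3"
  proof (rule integral_norm_dominated)
    fix x
    have 1: "\<bar>exp (e * g x) - 1\<bar> \<le> e * norm g * (norm x * exp (t1 * \<bar>g x\<bar>))"
      using taylor_remainder_le[where k = 1, of x] by simp
    have 2: "(g x)\<^sup>2 \<le> (norm g * norm x)\<^sup>2"
      using abs_g_le[of x] by (metis abs_ge_zero power2_abs power_mono)
    have "(g x)\<^sup>2 * \<bar>exp (e * g x) - 1\<bar>
      \<le> (norm g * norm x)\<^sup>2 * (e * norm g * (norm x * exp (t1 * \<bar>g x\<bar>)))"
      by (intro mult_mono 1 2) auto
    moreover have "norm ((g x)\<^sup>2 * exp (e * g x) - (g x)\<^sup>2)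
      = (g x)\<^sup>2 * \<bar>exp (e * g x) - 1\<bar>"
    proof -
      have "(g x)\<^sup>2 * exp (e * g x) - (g x)\<^sup>2
        = (g x)\<^sup>2 * (exp (e * g x) - 1)" by (simp add: algebra_simps)
      then show ?thesis by (simp add: abs_mult)
    qed
    ultimately show "norm ((g x)\<^sup>2 * exp (e * g x) - (g x)\<^sup>2)
      \<le> e * norm g ^ 3 * (norm x ^ 3 * exp (t1 * \<bar>g x\<bar>))"
      by (simp add: power3_eq_cube power2_eq_square mult_ac)
  qed (use e in auto)
  finally show ?thesis by (simp add: mult.assoc)
qed

lemma exp_third_moment_le:
  "(LINT x|\<mu>. \<bar>g x\<bar> ^ 3 * exp (e * g x)) \<le> norm g ^ 3 * weighted_moment3"
  using integral_norm_dominated[of "\<lambda>x. \<bar>g x\<bar> ^ 3 * exp (e * g x)" "norm g ^ 3"]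
    abs_g_power_exp_le[where k = 3]
  by simp

text \<open>Written with \<open>laplace\<close> and with \<open>g (e *\<^sub>R x)\<close> so that it
  is literally the density prescribed for the array when e = b_n / n.\<close>

definition tilted :: "'a measure" where
  "tilted = density \<mu> (\<lambda>x. ennreal (exp (g (e *\<^sub>R x))) / laplace \<mu> (e *\<^sub>R g))"

lemma tilted_eq: "tilted = density \<mu> (\<lambda>x. ennreal (exp (e * g x) / mgf))"
  unfolding tilted_def laplace_eq using mgf_ge_1
  by (simp add: blinfun.scaleR_right divide_ennreal)

lemma integral_tilted:
  fixes \<phi> :: "'a \<Rightarrow> 'b::{banach, second_countable_topology}"
  assumes [measurable]: "\<phi> \<in> borel_measurable borel"
  shows "(LINT x|tilted. \<phi> x) = (1 / mgf) *\<^sub>R (LINT x|\<mu>. exp (e * g x) *\<^sub>R \<phi> x)"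
proof -
  have "(LINT x|tilted. \<phi> x) = (LINT x|\<mu>. (exp (e * g x) / mgf) *\<^sub>R \<phi> x)"
    unfolding tilted_eq using mgf_ge_1 by (intro integral_density) auto
  also have "\<dots> = (LINT x|\<mu>. (1 / mgf) *\<^sub>R (exp (e * g x) *\<^sub>R \<phi> x))"
    by simp
  also have "\<dots> = (1 / mgf) *\<^sub>R (LINT x|\<mu>. exp (e * g x) *\<^sub>R \<phi> x)"
    by (rule integral_scaleR_right)
  finally show ?thesis .
qed

lemma integrable_tilted:
  fixes \<phi> :: "'a \<Rightarrow> 'b::{banach, second_countable_topology}"
  assumes [measurable]: "\<phi> \<in> borel_measurable borel"
    and i: "integrable \<mu> (\<lambda>x. exp (e * g x) *\<^sub>R \<phi> x)"
  shows "integrable tilted \<phi>"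
proof -
  have "integrable \<mu> (\<lambda>x. (1 / mgf) *\<^sub>R (exp (e * g x) *\<^sub>R \<phi> x))"
    using i by (rule integrable_scaleR_right)
  then have "integrable \<mu> (\<lambda>x. (exp (e * g x) / mgf) *\<^sub>R \<phi> x)" by simp
  then show ?thesis
    unfolding tilted_eq using mgf_ge_1 by (subst integrable_density) auto
qed

lemma sets_tilted [simp, measurable_cong]: "sets tilted = sets borel"
  by (simp add: tilted_def)

lemma prob_space_tilted: "prob_space tilted"
proof (rule prob_spaceI)
  have "emeasure tilted (space tilted) = (\<integral>\<^sup>+x. ennreal (exp (e * g x) / mgf) \<partial>\<mu>)"
    unfolding tilted_eq by (subst emeasure_density) (auto simp: sets_eq_imp_space_eq[OF sets_\<mu>] intro!: nn_integral_cong)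
  also have "\<dots> = ennreal (LINT x|\<mu>. exp (e * g x) / mgf)"
    using integrable_exp mgf_ge_1 by (intro nn_integral_eq_integral) auto
  also have "\<dots> = 1" using mgf_ge_1 by (simp add: mgf_def[symmetric])
  finally show "emeasure tilted (space tilted) = 1" .
qed

definition tilted_mean :: 'a where "tilted_mean = (LINT x|tilted. x)"

definition tilted_var :: real where "tilted_var = (LINT x|tilted. (g x - g tilted_mean)\<^sup>2)"

lemma integrable_tilted_id: "integrable tilted (\<lambda>x. x)"
  by (rule integrable_tilted[OF _ integrable_exp_scaleR]) simp

lemma tilted_mean_eq: "tilted_mean = (1 / mgf) *\<^sub>R (LINT x|\<mu>. exp (e * g x) *\<^sub>R x)"
  unfolding tilted_mean_def by (rule integral_tilted) simp

lemma mgf_le: "mgf - 1 \<le> e\<^sup>2 * (cov g g / 2 + t1 * (norm g ^ 3 * weighted_moment3))"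
proof -
  have "e ^ 3 * (norm g ^ 3 * weighted_moment3) = e\<^sup>2 * (e * (norm g ^ 3 * weighted_moment3))"
    by (simp add: power3_eq_cube power2_eq_square)
  also have "\<dots> \<le> e\<^sup>2 * (t1 * (norm g ^ 3 * weighted_moment3))"
    using e weighted_moment3_nonneg by (intro mult_left_mono mult_right_mono) auto
  finally show ?thesis using mgf_taylor by (simp add: algebra_simps)
qed

lemma inverse_mgf: "\<bar>1 / mgf - 1\<bar> \<le> mgf - 1" "0 < 1 / mgf" "1 / mgf \<le> 1"
proof -
  have "\<bar>1 / mgf - 1\<bar> = (mgf - 1) / mgf" using mgf_ge_1 by (simp add: field_simps)
  also have "\<dots> \<le> (mgf - 1) / 1" using mgf_ge_1 by (intro divide_left_mono) auto
  finally show "\<bar>1 / mgf - 1\<bar> \<le> mgf - 1" by simp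
qed (use mgf_ge_1 in auto)

end

lemma tilted_estimates:
  "\<exists>e0>0. e0 \<le> t1 \<and> (\<exists>C\<ge>0. \<forall>e. 0 < e \<and> e \<le> e0 \<longrightarrow>
     norm (tilted_mean e - e *\<^sub>R cov_vec g) \<le> C * e\<^sup>2 \<and>
     \<bar>tilted_var e - cov g g\<bar> \<le> C * e \<and>
     centered_law (distr (tilted e) borel (\<lambda>x. g x - g (tilted_mean e))) (tilted_var e) C \<and>
     exp (e\<^sup>2 * cov g g / 2 - C * e ^ 3) \<le> mgf e)"
proof -
  define v where "v = cov g g"
  define C0 where "C0 = norm g ^ 3 * weighted_moment3"
  \<comment> \<open>\<open>B\<close> bounds \<open>(mgf e - 1) / e^2\<close> and \<open>D\<close>
    bounds \<open>\<bar>g (tilted_mean e)\<bar> / e\<close>. \<open>C1\<close>, \<open>C2\<close>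
    and \<open>C3\<close> combine them with the Taylor remainders for the mean, the variance and the
    third moment.\<close>
  define B where "B = v / 2 + t1 * C0"
  define C1 where "C1 = norm g ^ 2 * weighted_moment3 + B * norm (cov_vec g)"
  define D where "D = norm g * (norm (cov_vec g) + C1)"
  define C2 where "C2 = C0 + B * v + D\<^sup>2"
  define C3 where "C3 = 8 * (C0 + D ^ 3)"
  \<comment> \<open>\<open>C0\<close> is the Taylor error of \<open>mgf\<close>; the additional v^2
    / 4 absorbs the square in exp u <= 1 + u + u^2.\<close>
  define C4 where "C4 = C0 + v\<^sup>2 / 4"
  define C where "C = C1 + C2 + C3 + C4"
  \<comment> \<open>The bound by 1 allows e^2 to be replaced by e, and \<open>e0 * v \<le> 1\<close>
    keeps the exponent \<open>u\<close> in the range where the quadratic bound for exp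
    holds.\<close>
  define e0 where "e0 = min t1 (min 1 (1 / (v + 1)))"
  have v: "0 \<le> v" unfolding v_def by (rule cov_nonneg)
  have nn: "0 \<le> C0" "0 \<le> B" "0 \<le> C1" "0 \<le> D" "0 \<le> C2" "0 \<le> C3" "0 \<le> C4"
    using v weighted_moment3_nonneg t1 by (simp_all add: C0_def B_def C1_def D_def C2_def C3_def C4_def)
  have e0: "0 < e0" "e0 \<le> t1" "e0 \<le> 1" "e0 * v \<le> 1"
  proof -
    have "e0 * v \<le> (1 / (v + 1)) * v" using v by (intro mult_right_mono) (auto simp: e0_def)
    also have "\<dots> \<le> 1" using v by simp
    finally show "e0 * v \<le> 1" .
    have "1 / (v + 1) \<le> 1" using v by simp
    then show "e0 \<le> 1" by (simp add: e0_def)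
  qed (use t1 v in \<open>auto simp: e0_def\<close>)
  have "norm (tilted_mean e - e *\<^sub>R cov_vec g) \<le> C * e\<^sup>2 \<and> \<bar>tilted_var e - cov g g\<bar> \<le> C * e \<and>
     centered_law (distr (tilted e) borel (\<lambda>x. g x - g (tilted_mean e))) (tilted_var e) C \<and>
     exp (e\<^sup>2 * cov g g / 2 - C * e ^ 3) \<le> mgf e" if small: "0 < e" "e \<le> e0" for e
  proof -
    have e: "0 \<le> e" "e \<le> t1" and small1: "e \<le> 1" using small e0 by auto
    note L = inverse_mgf[OF e]
    have sq: "e\<^sup>2 \<le> e" using small small1 by (simp add: power2_eq_square mult_left_le)
    have LB: "mgf e - 1 \<le> e\<^sup>2 * B" using mgf_le[OF e] by (simp add: B_def C0_def v_def)
    interpret T: prob_space "tilted e" by (rule prob_space_tilted[OF e])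
    let ?I = "LINT x|\<mu>. exp (e * g x) *\<^sub>R x"
    have mean: "norm (tilted_mean e - e *\<^sub>R cov_vec g) \<le> C1 * e\<^sup>2"
    proof -
      \<comment> \<open>Separates the Taylor error of the unnormalised mean from the effect of the
        normalising factor, which is of order e^2.\<close>
      have "tilted_mean e - e *\<^sub>R cov_vec g
        = (1 / mgf e) *\<^sub>R (?I - e *\<^sub>R cov_vec g) + (1 / mgf e - 1) *\<^sub>R (e *\<^sub>R cov_vec g)"
        by (simp add: tilted_mean_eq[OF e] algebra_simps)
      also have "norm \<dots> \<le> (1 / mgf e) * norm (?I - e *\<^sub>R cov_vec g) + \<bar>1 / mgf e - 1\<bar> * (e * norm (cov_vec g))"
        using L(2) e by (intro order_trans[OF norm_triangle_ineq]) (simp add: abs_mult)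
      also have "\<dots> \<le> 1 * (e\<^sup>2 * (norm g ^ 2 * weighted_moment3)) + (e\<^sup>2 * B) * (1 * norm (cov_vec g))"
        using L LB small small1 exp_mean_taylor[OF e] nn by (intro add_mono mult_mono) auto
      finally show ?thesis by (simp add: C1_def algebra_simps)
    qed
    have gm: "\<bar>g (tilted_mean e)\<bar> \<le> e * D"
    proof -
      have "norm (tilted_mean e) \<le> norm (e *\<^sub>R cov_vec g) + norm (tilted_mean e - e *\<^sub>R cov_vec g)"
        by (rule norm_triangle_sub)
      also have "\<dots> \<le> e * norm (cov_vec g) + C1 * e"
        using mean mult_left_mono[OF sq nn(3)] e by simp
      finally have "norm g * norm (tilted_mean e) \<le> norm g * (e * norm (cov_vec g) + C1 * e)"
        by (rule mult_left_mono) simp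
      with abs_g_le[of "tilted_mean e"] show ?thesis by (simp add: D_def algebra_simps)
    qed
    have ig: "integrable (tilted e) (\<lambda>x. g x)"
      by (rule integrable_bounded_linear[OF blinfun.bounded_linear_right integrable_tilted_id[OF e]])
    have gmean: "(LINT x|tilted e. g x) = g (tilted_mean e)"
      unfolding tilted_mean_def[OF e] by (rule integral_bounded_linear[OF blinfun.bounded_linear_right integrable_tilted_id[OF e]])
    have ig2: "integrable (tilted e) (\<lambda>x. (g x)\<^sup>2)"
      using integrable_abs_g_power_exp[OF e, of 2] by (intro integrable_tilted[OF e]) (auto simp: mult.commute)
    have ig3: "integrable (tilted e) (\<lambda>x. \<bar>g x\<bar> ^ 3)"
      using integrable_abs_g_power_exp[OF e, of 3] by (intro integrable_tilted[OF e]) (auto simp: mult.commute)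
    let ?J = "LINT x|\<mu>. (g x)\<^sup>2 * exp (e * g x)"
    have var: "\<bar>tilted_var e - v\<bar> \<le> C2 * e"
    proof -
      have "tilted_var e = (LINT x|tilted e. (g x)\<^sup>2) - (g (tilted_mean e))\<^sup>2"
        unfolding tilted_var_def[OF e] gmean[symmetric] using T.variance_eq[OF ig ig2] by simp
      also have "(LINT x|tilted e. (g x)\<^sup>2) = (1 / mgf e) * ?J"
        using integral_tilted[OF e, of "\<lambda>x. (g x)\<^sup>2"] by (simp add: mult.commute)
      finally have "tilted_var e - v = (1 / mgf e) * (?J - v) + (1 / mgf e - 1) * v + - (g (tilted_mean e))\<^sup>2"
        by (simp add: algebra_simps)
      also have "\<bar>\<dots>\<bar> \<le> \<bar>(1 / mgf e) * (?J - v)\<bar> + \<bar>(1 / mgf e - 1) * v\<bar> + \<bar>- (g (tilted_mean e))\<^sup>2\<bar>"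
        by (intro order_trans[OF abs_triangle_ineq add_right_mono] abs_triangle_ineq)
      also have "\<dots> = (1 / mgf e) * \<bar>?J - v\<bar> + \<bar>1 / mgf e - 1\<bar> * v + \<bar>g (tilted_mean e)\<bar>\<^sup>2"
        using L(2) v by (simp add: abs_mult)
      also have "\<dots> \<le> 1 * (e * C0) + (e\<^sup>2 * B) * v + (e * D)\<^sup>2"
        using L LB exp_second_moment_taylor[OF e] v gm
        by (intro add_mono mult_mono power_mono) (auto simp: v_def C0_def)
      also have "\<dots> = e * C0 + e\<^sup>2 * (B * v + D\<^sup>2)" by (simp add: algebra_simps power_mult_distrib)
      also have "\<dots> \<le> e * C0 + e * (B * v + D\<^sup>2)"
        using sq nn v by (intro add_left_mono mult_right_mono) auto
      finally show ?thesis by (simp add: C2_def algebra_simps)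
    qed
    let ?z = "\<lambda>x. g x - g (tilted_mean e)"
    have zm: "?z \<in> borel_measurable (tilted e)"
      using sets_tilted[OF e] by (simp cong: measurable_cong_sets)
    have dom: "integrable (tilted e) (\<lambda>x. 8 * (\<bar>g x\<bar> ^ 3 + \<bar>g (tilted_mean e)\<bar> ^ 3))"
      using ig3 by simp
    have iz3: "integrable (tilted e) (\<lambda>x. \<bar>?z x\<bar> ^ 3)"
      by (rule Bochner_Integration.integrable_bound[OF dom]) (use abs_diff_cube_le zm in auto)
    have third: "(LINT x|tilted e. \<bar>?z x\<bar> ^ 3) \<le> C3"
    proof -
      have "(LINT x|tilted e. \<bar>?z x\<bar> ^ 3)
        \<le> (LINT x|tilted e. 8 * (\<bar>g x\<bar> ^ 3 + \<bar>g (tilted_mean e)\<bar> ^ 3))"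
        by (rule integral_mono[OF iz3 dom]) (rule abs_diff_cube_le)
      also have "\<dots> = 8 * ((LINT x|tilted e. \<bar>g x\<bar> ^ 3) + \<bar>g (tilted_mean e)\<bar> ^ 3)"
        using ig3 T.prob_space by simp
      also have "(LINT x|tilted e. \<bar>g x\<bar> ^ 3)
        = (1 / mgf e) * (LINT x|\<mu>. \<bar>g x\<bar> ^ 3 * exp (e * g x))"
        using integral_tilted[OF e, of "\<lambda>x. \<bar>g x\<bar> ^ 3"] by (simp add: mult.commute)
      also have "\<dots> \<le> 1 * C0"
        using L exp_third_moment_le[OF e] nn by (intro mult_mono) (auto simp: C0_def)
      also have "\<bar>g (tilted_mean e)\<bar> ^ 3 \<le> D ^ 3"
      proof (rule power_mono)
        have "e * D \<le> 1 * D" using small1 nn by (intro mult_right_mono) auto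
        with gm show "\<bar>g (tilted_mean e)\<bar> \<le> D" by simp
      qed simp
      finally show ?thesis by (simp add: C3_def)
    qed
    have cl: "centered_law (distr (tilted e) borel ?z) (tilted_var e) C"
      unfolding centered_law_def
    proof (intro conjI)
      show "real_distribution (distr (tilted e) borel ?z)" by (rule T.real_distribution_distr[OF zm])
      show "integrable (distr (tilted e) borel ?z) (\<lambda>x. \<bar>x\<bar> ^ 3)"
        using iz3 zm by (subst integrable_distr_eq) auto
      show "(LINT x|distr (tilted e) borel ?z. x) = 0"
        using zm ig gmean T.prob_space by (subst integral_distr) auto
      show "(LINT x|distr (tilted e) borel ?z. x\<^sup>2) = tilted_var e"
        unfolding tilted_var_def[OF e] using zm by (subst integral_distr) auto
      have "(LINT x|distr (tilted e) borel ?z. \<bar>x\<bar> ^ 3) \<le> C3"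
        using third zm by (subst integral_distr) auto
      then show "(LINT x|distr (tilted e) borel ?z. \<bar>x\<bar> ^ 3) \<le> C" using nn by (simp add: C_def)
    qed
    have "exp (e\<^sup>2 * v / 2 - C * e ^ 3) \<le> mgf e"
    proof -
      define u where "u = e\<^sup>2 * v / 2 - C4 * e ^ 3"
      have "e\<^sup>2 * v / 2 - C * e ^ 3 \<le> u"
        using nn small by (auto simp: u_def C_def intro!: mult_right_mono)
      then have "exp (e\<^sup>2 * v / 2 - C * e ^ 3) \<le> exp u" by simp
      also have "exp u \<le> mgf e"
      proof (cases "u \<le> 0")
        case True
        then have "exp u \<le> 1" by simp
        with mgf_ge_1[OF e] show ?thesis by linarith
      next
        case False
        have "e\<^sup>2 * v \<le> e * v" using sq v by (rule mult_right_mono)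
        also have "\<dots> \<le> e0 * v" using small v by (intro mult_right_mono) auto
        finally have ev: "e\<^sup>2 * v \<le> 1" using e0 by simp
        have u1: "u \<le> e\<^sup>2 * v / 2" using nn small by (simp add: u_def)
        have "exp u \<le> 1 + u + u\<^sup>2" using False ev u1 by (intro exp_bound) auto
        also have "u\<^sup>2 \<le> (e\<^sup>2 * v / 2)\<^sup>2" using False u1 by (intro power_mono) auto
        also have "\<dots> = e ^ 3 * (e * (v\<^sup>2 / 4))"
          by (simp add: power2_eq_square power3_eq_cube)
        also have "\<dots> \<le> e ^ 3 * (1 * (v\<^sup>2 / 4))"
          using small small1 by (intro mult_left_mono mult_right_mono) auto
        finally have "exp u \<le> 1 + e\<^sup>2 * v / 2 - e ^ 3 * C0"
          by (simp add: u_def C4_def algebra_simps)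
        with mgf_taylor[OF e] show ?thesis by (simp add: C0_def v_def abs_le_iff)
      qed
      finally show ?thesis .
    qed
    moreover have "C1 * e\<^sup>2 \<le> C * e\<^sup>2" using nn by (intro mult_right_mono) (auto simp: C_def)
    moreover have "C2 * e \<le> C * e" using nn small by (intro mult_right_mono) (auto simp: C_def)
    ultimately show ?thesis using mean var cl by (simp add: v_def)
  qed
  moreover have "0 \<le> C" using nn by (simp add: C_def)
  ultimately show ?thesis using e0 by blast
qed

end

section \<open>A local limit estimate for tilted sums\<close>

text \<open>On the window the exponent is at least -1/2, so the Gaussian weight is at least 1/2;
  hence the factor 2.\<close>

lemma window_prob_upper:
  assumes \<rho>: "real_distribution \<rho>" and w: "0 < w"
  shows "measure \<rho> {y. \<bar>y - x\<bar> \<le> w} \<le> 2 * (LINT y|\<rho>. exp (- ((y - x) / w)\<^sup>2 / 2))"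
proof -
  interpret R: real_distribution \<rho> by fact
  have "measure \<rho> {y. \<bar>y - x\<bar> \<le> w} = (LINT y|\<rho>. indicator {y. \<bar>y - x\<bar> \<le> w} y)"
    by simp
  also have "\<dots> \<le> (LINT y|\<rho>. 2 * exp (- ((y - x) / w)\<^sup>2 / 2))"
  proof (rule integral_mono)
    show "integrable \<rho> (indicator {y. \<bar>y - x\<bar> \<le> w} :: real \<Rightarrow> real)"
      by (rule R.integrable_const_bound[where B = 1]) auto
    show "integrable \<rho> (\<lambda>y. 2 * exp (- ((y - x) / w)\<^sup>2 / 2))"
      using integrable_gaussian_average[OF \<rho>] by simp
    fix y
    show "indicator {y. \<bar>y - x\<bar> \<le> w} y \<le> 2 * exp (- ((y - x) / w)\<^sup>2 / 2)"
    proof (cases "\<bar>y - x\<bar> \<le> w")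
      case True
      then have "\<bar>(y - x) / w\<bar> \<le> 1" using w by simp
      then have "((y - x) / w)\<^sup>2 \<le> 1" by (simp only: abs_square_le_1)
      moreover have "1 + - ((y - x) / w)\<^sup>2 / 2 \<le> exp (- ((y - x) / w)\<^sup>2 / 2)"
        by (rule exp_ge_add_one_self)
      ultimately have "1 \<le> 2 * exp (- ((y - x) / w)\<^sup>2 / 2)" by linarith
      then show ?thesis by (simp add: indicator_def)
    next
      case False
      then show ?thesis by simp
    qed
  qed
  finally show ?thesis by simp
qed

text \<open>Off the window half of the exponent is at least r^2 / 4, while the other half is a
  Gaussian weight of width sqrt 2 L, whose average is of the same order. A large \<open>r\<close>
  therefore makes the loss a small fraction of the main term.\<close>

lemma window_prob_lower:
  assumes \<rho>: "real_distribution \<rho>" and L: "0 < L" and r: "0 \<le> r"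
  shows "(LINT y|\<rho>. exp (- ((y - x) / L)\<^sup>2 / 2)) - exp (- r\<^sup>2 / 4) * (LINT y|\<rho>. exp (- ((y - x) / (sqrt 2 * L))\<^sup>2 / 2))
    \<le> measure \<rho> {y. \<bar>y - x\<bar> \<le> r * L}"
proof -
  interpret R: real_distribution \<rho> by fact
  have i1: "integrable \<rho> (indicator {y. \<bar>y - x\<bar> \<le> r * L} :: real \<Rightarrow> real)"
    by (rule R.integrable_const_bound[where B = 1]) auto
  have i2: "integrable \<rho> (\<lambda>y. exp (- r\<^sup>2 / 4) * exp (- ((y - x) / (sqrt 2 * L))\<^sup>2 / 2))"
    using integrable_gaussian_average[OF \<rho>] by simp
  have "(LINT y|\<rho>. exp (- ((y - x) / L)\<^sup>2 / 2))
    \<le> (LINT y|\<rho>. indicator {y. \<bar>y - x\<bar> \<le> r * L} y + exp (- r\<^sup>2 / 4) * exp (- ((y - x) / (sqrt 2 * L))\<^sup>2 / 2))"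
  proof (rule integral_mono)
    show "integrable \<rho> (\<lambda>y. exp (- ((y - x) / L)\<^sup>2 / 2))" by (rule integrable_gaussian_average[OF \<rho>])
    show "integrable \<rho> (\<lambda>y. indicator {y. \<bar>y - x\<bar> \<le> r * L} y + exp (- r\<^sup>2 / 4) * exp (- ((y - x) / (sqrt 2 * L))\<^sup>2 / 2))"
      using i1 i2 by (rule Bochner_Integration.integrable_add)
    fix y
    define z where "z = (y - x) / L"
    have z2: "((y - x) / (sqrt 2 * L))\<^sup>2 = z\<^sup>2 / 2" by (simp add: z_def power_divide power_mult_distrib)
    show "exp (- ((y - x) / L)\<^sup>2 / 2)
      \<le> indicator {y. \<bar>y - x\<bar> \<le> r * L} y + exp (- r\<^sup>2 / 4) * exp (- ((y - x) / (sqrt 2 * L))\<^sup>2 / 2)"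
    proof (cases "\<bar>y - x\<bar> \<le> r * L")
      case True
      have "exp (- ((y - x) / L)\<^sup>2 / 2) \<le> 1" by simp
      moreover have "0 \<le> exp (- r\<^sup>2 / 4) * exp (- ((y - x) / (sqrt 2 * L))\<^sup>2 / 2)" by simp
      moreover have "indicator {y. \<bar>y - x\<bar> \<le> r * L} y = (1::real)" using True by simp
      ultimately show ?thesis by linarith
    next
      case False
      then have "r \<le> \<bar>z\<bar>" using L by (simp add: z_def field_simps)
      then have "\<bar>r\<bar> \<le> \<bar>z\<bar>" using r by simp
      then have "r\<^sup>2 \<le> z\<^sup>2" by (simp only: abs_le_square_iff)
      then have "exp (- z\<^sup>2 / 2) \<le> exp (- r\<^sup>2 / 4 + - (z\<^sup>2 / 2) / 2)" by simp
      also have "\<dots> = exp (- r\<^sup>2 / 4) * exp (- (z\<^sup>2 / 2) / 2)" by (rule exp_add)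
      finally show ?thesis unfolding z2 using False by (simp add: z_def)
    qed
  qed
  also have "\<dots> = measure \<rho> {y. \<bar>y - x\<bar> \<le> r * L} + exp (- r\<^sup>2 / 4) * (LINT y|\<rho>. exp (- ((y - x) / (sqrt 2 * L))\<^sup>2 / 2))"
    using Bochner_Integration.integral_add[OF i1 i2] by simp
  finally show ?thesis by simp
qed

lemma (in prob_space) prob_real_distr:
  assumes [measurable]: "random_variable borel Y" and "Measurable.pred borel Q"
  shows "measure (distr M borel Y) {y. Q y} = prob {w \<in> space M. Q (Y w)}"
  using assms(2) by (subst measure_distr) (auto intro!: arg_cong[where f = prob] simp: pred_def)

context tilted_clt
begin

text \<open>In units of l = sqrt n / b_n: the smoothed local limit gives 1 / (2 sqrt v), the mass
  off the window costs at most 1 / (4 sqrt v) and large norms at most 1 / (8 sqrt v), which leaves 1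
  / (8 sqrt v).\<close>

lemma tilted_window_prob:
  fixes b :: "nat \<Rightarrow> real" and N :: "nat \<Rightarrow> 'z measure" and Z :: "nat \<Rightarrow> nat \<Rightarrow> 'z \<Rightarrow> 'a"
  defines "W n w \<equiv> \<Sum>j=1..n. Z n j w - tilted_mean (b n / real n)"
  assumes pos: "0 < cov g g"
    and array: "\<forall>\<^sub>F n in sequentially. prob_space (N n) \<and> prob_space.indep_vars (N n) (\<lambda>_. borel) (Z n) {1..n} \<and>
      (\<forall>j\<in>{1..n}. distr (N n) borel (Z n j) = tilted (b n / real n))"
    and b: "\<forall>n\<ge>1. 0 < b n"
    and eps0: "(\<lambda>n. b n / real n) \<longlonglongrightarrow> 0"
    and l0: "(\<lambda>n. (real n / b n) / sqrt n) \<longlonglongrightarrow> 0" and L3: "(\<lambda>n. sqrt n / (real n / b n) ^ 3) \<longlonglongrightarrow> 0"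
    and tight: "bounded_in_probability N (\<lambda>n w. (1 / sqrt (real n)) *\<^sub>R
      (\<Sum>j=1..n. Z n j w - (LINT w'|N n. Z n j w')))"
  shows "\<exists>R\<ge>0. \<exists>K\<ge>0. \<exists>p>0. \<forall>\<^sub>F n in sequentially. p * (sqrt n / b n) \<le>
    measure (N n) {w \<in> space (N n). blinfun_apply g (W n w) \<in> {real n / b n .. (2 * R + 1) * (real n / b n)} \<and>
      norm (W n w) \<le> K * sqrt n}"
proof -
  define v where "v = cov g g"
  have v: "0 < v" using pos by (simp add: v_def)
  obtain e0 C where e0: "0 < e0" "e0 \<le> t1" and C: "0 \<le> C"
    and est: "\<And>e. 0 < e \<Longrightarrow> e \<le> e0 \<Longrightarrow> \<bar>tilted_var e - v\<bar> \<le> C * e \<and>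
     centered_law (distr (tilted e) borel (\<lambda>x. g x - g (tilted_mean e))) (tilted_var e) C"
    using tilted_estimates unfolding v_def by blast
  define e where "e n = b n / real n" for n
  define m where "m n = tilted_mean (e n)" for n
  define \<nu> where "\<nu> n = distr (tilted (e n)) borel (\<lambda>x. g x - g (m n))" for n
  define L where "L n = real n / b n" for n
  have "\<forall>\<^sub>F n in sequentially. C * e n < v / 2"
    using tendsto_mult_right_zero[OF eps0, of C] v by (intro order_tendstoD(2)[of _ 0]) (auto simp: e_def)
  moreover have "\<forall>\<^sub>F n in sequentially. e n < e0"
    using order_tendstoD(2)[OF eps0 e0(1)] by (simp add: e_def)
  moreover have "\<forall>\<^sub>F n in sequentially. sqrt n / (L n) ^ 3 < 1"
    using order_tendstoD(2)[OF L3, of 1] by (simp add: L_def)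
  ultimately have "\<forall>\<^sub>F n in sequentially. C * e n < v / 2 \<and> e n < e0 \<and> sqrt n / (L n) ^ 3 < 1 \<and> 2 \<le> n \<and>
      prob_space (N n) \<and> prob_space.indep_vars (N n) (\<lambda>_. borel) (Z n) {1..n} \<and>
      (\<forall>j\<in>{1..n}. distr (N n) borel (Z n j) = tilted (b n / real n))"
    using array eventually_ge_at_top[of 2] by eventually_elim simp
  then obtain n0 where n0: "\<And>n. n \<ge> n0 \<Longrightarrow> C * e n < v / 2 \<and> e n < e0 \<and> sqrt n / (L n) ^ 3 < 1 \<and> 2 \<le> n \<and>
      prob_space (N n) \<and> prob_space.indep_vars (N n) (\<lambda>_. borel) (Z n) {1..n} \<and>
      (\<forall>j\<in>{1..n}. distr (N n) borel (Z n j) = tilted (b n / real n))"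
    by (auto simp: eventually_sequentially)
  have Cn: "C * e n < v / 2" and en: "e n < e0" and Ln3: "sqrt n / (L n) ^ 3 < 1" and n2: "2 \<le> n"
    and PN: "prob_space (N n)" and iN: "prob_space.indep_vars (N n) (\<lambda>_. borel) (Z n) {1..n}"
    and dN: "\<And>j. j \<in> {1..n} \<Longrightarrow> distr (N n) borel (Z n j) = tilted (e n)" if "n \<ge> n0" for n
    using n0[OF that] by (auto simp: e_def)
  have n01: "n0 \<ge> 1" using n2[of n0] by simp
  have bp: "0 < b n" and ep: "0 < e n" and Lp: "0 < L n" if "n \<ge> n0" for n
    using b[rule_format, of n] n2[OF that] by (auto simp: e_def L_def)
  have \<nu>: "centered_law (\<nu> n) (tilted_var (e n)) C" and tv: "\<bar>tilted_var (e n) - v\<bar> \<le> C * e n" if "n \<ge> n0" for n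
    using est[OF ep[OF that]] en[OF that] by (auto simp: \<nu>_def m_def)
  have tvlim: "(\<lambda>n. tilted_var (e n)) \<longlonglongrightarrow> v"
  proof (rule LIM_zero_cancel, rule Lim_null_comparison)
    show "\<forall>\<^sub>F n in sequentially. norm (tilted_var (e n) - v) \<le> C * e n"
      using eventually_ge_at_top[of n0] by eventually_elim (use tv in simp)
    show "(\<lambda>n. C * e n) \<longlonglongrightarrow> 0"
      using tendsto_mult_right_zero[OF eps0, of C] by (simp add: e_def)
  qed
  define \<kappa> where "\<kappa> = v / 12"
  define c where "c = min (1 / sqrt v) (v / (C + 1))"
  have \<kappa>: "0 < \<kappa>" and c: "0 < c" using v C by (auto simp: \<kappa>_def c_def)
  have char1: "cmod (char (\<nu> n) s) \<le> exp (- \<kappa> * s\<^sup>2)" if "n \<ge> n0" "\<bar>s\<bar> \<le> c" for n s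
    unfolding \<kappa>_def using tv[OF that(1)] Cn[OF that(1)] v that(2)
    by (intro char_gaussian_bound[OF \<nu>[OF that(1)]]) (auto simp: c_def)
  define S where "S n A w = (\<Sum>j\<in>A. Z n j w - m n)" for n A w
  have iS: "prob_space.indep_vars (N n) (\<lambda>_. borel) (\<lambda>j w. Z n j w - m n) {1..n}" if "n \<ge> n0" for n
    by (rule prob_space.indep_vars_compose2[OF PN[OF that] iN[OF that]]) measurable
  have Zm: "Z n j \<in> borel_measurable (N n)" if "n \<ge> n0" "j \<in> {1..n}" for n j
    using iN[OF that(1)] that(2) unfolding prob_space.indep_vars_def[OF PN[OF that(1)]] by auto
  have Sm: "S n A \<in> borel_measurable (N n)" if "n \<ge> n0" "A \<subseteq> {1..n}" for n A
    unfolding S_def using Zm[OF that(1)] that(2) by (intro borel_measurable_sum) auto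
  define \<rho> where "\<rho> n A = distr (N n) borel (\<lambda>w. g (S n A w))" for n A
  have gSm: "(\<lambda>w. g (S n A w)) \<in> borel_measurable (N n)" if "n \<ge> n0" "A \<subseteq> {1..n}" for n A
    using Sm[OF that] by measurable
  have \<rho>rd: "real_distribution (\<rho> n A)" if "n \<ge> n0" "A \<subseteq> {1..n}" for n A
    unfolding \<rho>_def by (rule prob_space.real_distribution_distr[OF PN[OF that(1)] gSm[OF that]])
  have char_\<rho>: "char (\<rho> n A) t = char (\<nu> n) t ^ card A" if n: "n \<ge> n0" and A: "A \<subseteq> {1..n}" for n A t
  proof -
    have eq: "g (S n A w) = (\<Sum>j\<in>A. g (Z n j w) - g (m n))" for w
      by (simp add: S_def blinfun.sum_right blinfun.diff_right)
    show ?thesis unfolding \<rho>_def eq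
    proof (rule prob_space.char_iid_sum[OF PN[OF n]])
      show "prob_space.indep_vars (N n) (\<lambda>_. borel) (\<lambda>j w. g (Z n j w) - g (m n)) A"
        by (rule prob_space.indep_vars_compose2[OF PN[OF n] prob_space.indep_vars_subset[OF PN[OF n] iN[OF n] A]]) measurable
      fix j assume "j \<in> A"
      then have j: "j \<in> {1..n}" using A by auto
      have "distr (N n) borel (\<lambda>w. g (Z n j w) - g (m n))
        = distr (distr (N n) borel (Z n j)) borel (\<lambda>x. g x - g (m n))"
        using Zm[OF n j] by (subst distr_distr) (auto simp: comp_def)
      then show "distr (N n) borel (\<lambda>w. g (Z n j w) - g (m n)) = \<nu> n"
        unfolding dN[OF n j] \<nu>_def .
    qed
  qed
  have char_\<rho>_le: "cmod (char (\<rho> n A) s) \<le> exp (- (\<kappa> * real (card A)) * s\<^sup>2)"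
    if n: "n \<ge> n0" and A: "A \<subseteq> {1..n}" and s: "\<bar>s\<bar> \<le> c" for n A s
  proof -
    have "cmod (char (\<rho> n A) s) = cmod (char (\<nu> n) s) ^ card A" by (simp add: char_\<rho>[OF n A] norm_power)
    also have "\<dots> \<le> exp (- \<kappa> * s\<^sup>2) ^ card A" by (intro power_mono char1[OF n s]) auto
    also have "\<dots> = exp (- (\<kappa> * real (card A)) * s\<^sup>2)"
      by (simp add: exp_of_nat_mult[symmetric] mult_ac)
    finally show ?thesis .
  qed
  define C5 where "C5 = 1 / sqrt (2 * \<kappa> / 3) + 1 / c\<^sup>2"
  have C5: "0 < C5" using \<kappa> c unfolding C5_def by (intro add_pos_pos) auto
  \<comment> \<open>Stated for index blocks of at least n / 3 elements, so that it serves the full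
    sum and both of its halves, and for widths \<open>s * L n\<close>, so that it serves the windows
    of width \<open>R * L n\<close> and \<open>sqrt 2 * L n\<close>.\<close>
  have upper: "(LINT y|\<rho> n A. exp (- ((y - x) / (s * L n))\<^sup>2 / 2)) \<le> s * (L n / sqrt n) * C5"
    if n: "n \<ge> n0" and A: "A \<subseteq> {1..n}" and cA: "real n / 3 \<le> real (card A)" and s: "1 \<le> s" for n A x s
  proof -
    have n': "0 < real n" using n2[OF n] by simp
    have sL: "0 < s * L n" using s Lp[OF n] by simp
    have cA': "0 < real (card A)" using cA n' by linarith
    have "(LINT y|\<rho> n A. exp (- ((y - x) / (s * L n))\<^sup>2 / 2))
      \<le> (s * L n) / sqrt (2 * (\<kappa> * real (card A))) + 1 / (c * (s * L n))\<^sup>2"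
      using \<kappa> c cA' by (intro gaussian_average_upper[OF \<rho>rd[OF n A] sL] char_\<rho>_le[OF n A]) auto
    also have "(s * L n) / sqrt (2 * (\<kappa> * real (card A))) \<le> (s * L n) / sqrt (2 * (\<kappa> * (real n / 3)))"
      using \<kappa> n' cA sL by (intro divide_left_mono mult_pos_pos real_sqrt_le_mono real_sqrt_gt_zero mult_left_mono) auto
    also have "(s * L n) / sqrt (2 * (\<kappa> * (real n / 3))) = s * (L n / sqrt n) * (1 / sqrt (2 * \<kappa> / 3))"
    proof -
      have "sqrt (2 * (\<kappa> * (real n / 3))) = sqrt n * sqrt (2 * \<kappa> / 3)"
        by (simp add: real_sqrt_mult[symmetric] mult_ac)
      then show ?thesis by simp
    qed
    \<comment> \<open>The high-frequency term is absorbed into the main one, since sqrt n <= L^3 for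
      these n and s >= 1.\<close>
    also have "1 / (c * (s * L n))\<^sup>2 \<le> s * (L n / sqrt n) * (1 / c\<^sup>2)"
    proof -
      have "sqrt n \<le> (L n) ^ 3" using Ln3[OF n] Lp[OF n] by (simp add: field_simps)
      then have "1 / (L n)\<^sup>2 \<le> L n / sqrt n"
        using Lp[OF n] n' by (simp add: field_simps power2_eq_square power3_eq_cube)
      have "(L n)\<^sup>2 \<le> (s * L n)\<^sup>2" using s Lp[OF n] by (intro power_mono) auto
      then have "1 / (s * L n)\<^sup>2 \<le> 1 / (L n)\<^sup>2" using Lp[OF n] sL
        by (intro divide_left_mono mult_pos_pos zero_less_power) auto
      also have "\<dots> \<le> L n / sqrt n" by fact
      also have "\<dots> \<le> s * (L n / sqrt n)"
        using mult_right_mono[OF s, of "L n / sqrt n"] Lp[OF n] by simp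
      finally have "1 / (s * L n)\<^sup>2 * (1 / c\<^sup>2) \<le> s * (L n / sqrt n) * (1 / c\<^sup>2)"
        by (rule mult_right_mono) simp
      moreover have "1 / (c * (s * L n))\<^sup>2 = 1 / (s * L n)\<^sup>2 * (1 / c\<^sup>2)"
        by (simp add: power_mult_distrib)
      ultimately show ?thesis by simp
    qed
    finally show ?thesis by (simp add: C5_def distrib_left)
  qed
  \<comment> \<open>Chosen so that exp (- R^2 / 4) is at most 1 / (8 C5 sqrt v), that is, the loss
    off the window is at most half of the main term; it also gives R >= 1, needed to use
    \<open>upper\<close> at width \<open>R * L n\<close>.\<close>
  define R where "R = sqrt (32 * C5 * sqrt v + 4)"
  have R2: "R\<^sup>2 = 32 * C5 * sqrt v + 4" using C5 v by (simp add: R_def)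
  have R1: "1 \<le> R"
  proof -
    have "1\<^sup>2 \<le> R\<^sup>2" unfolding R2 using C5 v by simp
    moreover have "0 \<le> R" using C5 v by (simp add: R_def)
    ultimately show ?thesis by (rule power2_le_imp_le)
  qed
  have expR: "exp (- R\<^sup>2 / 4) * (2 * C5) \<le> 1 / (4 * sqrt v)"
  proof -
    have "R\<^sup>2 / 4 = 8 * (C5 * sqrt v) + 1" unfolding R2 by (simp add: field_simps)
    then have le: "8 * (C5 * sqrt v) \<le> 1 + R\<^sup>2 / 4" by linarith
    have "8 * C5 * sqrt v = 8 * (C5 * sqrt v)" by simp
    also note le
    also have "1 + R\<^sup>2 / 4 \<le> exp (R\<^sup>2 / 4)" by (rule exp_ge_add_one_self)
    finally have "1 / exp (R\<^sup>2 / 4) \<le> 1 / (8 * C5 * sqrt v)"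
      using C5 v by (intro divide_left_mono) auto
    then have "exp (- R\<^sup>2 / 4) * (2 * C5) \<le> 1 / (8 * C5 * sqrt v) * (2 * C5)"
      using C5 by (intro mult_right_mono) (auto simp: exp_minus inverse_eq_divide)
    also have "\<dots> = 1 / (4 * sqrt v)" using C5 v by (simp add: field_simps)
    finally show ?thesis .
  qed
  define J where "J n = {L n .. (2 * R + 1) * L n}" for n
  have J_iff: "y \<in> J n \<longleftrightarrow> \<bar>y - (R + 1) * L n\<bar> \<le> R * L n" for y n
    unfolding J_def by (simp add: abs_le_iff algebra_simps) (auto simp: algebra_simps)
  have "(\<lambda>n. sqrt n / L n * (LINT y|\<rho> n {1..n}. exp (- ((y - (R + 1) * L n) / L n)\<^sup>2 / 2))) \<longlonglongrightarrow> 1 / sqrt v"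
  proof (rule gaussian_average_limit[where c = c and \<kappa> = \<kappa>])
    show "real_distribution (\<rho> n {1..n})" if "n \<ge> n0" for n by (rule \<rho>rd[OF that]) simp
    show "cmod (char (\<rho> n {1..n}) s) \<le> exp (- (\<kappa> * real n) * s\<^sup>2)" if "n \<ge> n0" "\<bar>s\<bar> \<le> c" for n s
      using char_\<rho>_le[OF that(1) order_refl that(2)] by simp
    show "(\<lambda>n. char (\<rho> n {1..n}) (t / sqrt n)) \<longlonglongrightarrow> complex_of_real (exp (- (v * t\<^sup>2) / 2))" for t
    proof (rule Lim_transform_eventually)
      show "(\<lambda>n. char (\<nu> n) (t / sqrt n) ^ n) \<longlonglongrightarrow> complex_of_real (exp (- (v * t\<^sup>2) / 2))"
        by (rule char_power_tendsto[OF _ tvlim]) (rule \<nu>)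
      show "\<forall>\<^sub>F n in sequentially. char (\<nu> n) (t / sqrt n) ^ n = char (\<rho> n {1..n}) (t / sqrt n)"
        using eventually_ge_at_top[of n0] by eventually_elim (simp add: char_\<rho>)
    qed
    show "(\<lambda>n. L n / sqrt n) \<longlonglongrightarrow> 0" using l0 by (simp add: L_def)
    show "(\<lambda>n. sqrt n / (L n) ^ 3) \<longlonglongrightarrow> 0" using L3 by (simp add: L_def)
  qed (use c \<kappa> v Lp n01 in auto)
  then have avg: "\<forall>\<^sub>F n in sequentially. 1 / (2 * sqrt v)
      < sqrt n / L n * (LINT y|\<rho> n {1..n}. exp (- ((y - (R + 1) * L n) / L n)\<^sup>2 / 2))"
    using v by (intro order_tendstoD(1)[of _ "1 / sqrt v"]) (auto simp: field_simps)
  \<comment> \<open>The first entry gives 5 \<eta> < 1; the second makes the cost 4 \<eta> Q of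
    large norms, with Q = 2 R l C5, at most l / (8 sqrt v).\<close>
  define \<eta> where "\<eta> = min (1 / 10) (1 / (64 * sqrt v * R * C5))"
  have \<eta>: "0 < \<eta>" "5 * \<eta> < 1" using C5 R1 v by (auto simp: \<eta>_def)
  have "\<eta> * (64 * sqrt v * R * C5) \<le> (1 / (64 * sqrt v * R * C5)) * (64 * sqrt v * R * C5)"
    using C5 R1 v by (intro mult_right_mono) (auto simp: \<eta>_def)
  also have "\<dots> = 1" using C5 R1 v by simp
  finally have \<eta>Q: "8 * \<eta> * R * C5 \<le> 1 / (8 * sqrt v)" using v by (simp add: field_simps)
  obtain K0 where K0: "\<forall>\<^sub>F n in sequentially. measure (N n) {w \<in> space (N n). norm ((1 / sqrt (real n)) *\<^sub>R
      (\<Sum>j=1..n. Z n j w - (LINT w'|N n. Z n j w'))) > K0} \<le> \<eta>"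
    using tight \<eta>(1) unfolding bounded_in_probability_def by blast
  define K where "K = max K0 0"
  have W: "W n w = S n {1..n} w" for n w by (simp add: W_def S_def m_def e_def)
  have tail: "\<forall>\<^sub>F n in sequentially. measure (N n) {w \<in> space (N n). K * sqrt n < norm (W n w)} \<le> \<eta>"
    using K0 eventually_ge_at_top[of n0]
  proof eventually_elim
    case (elim n)
    interpret P: prob_space "N n" by (rule PN[OF elim(2)])
    have n': "0 < real n" using n2[OF elim(2)] by simp
    \<comment> \<open>Identifies the centering in the tightness hypothesis with the mean of the
      tilted law.\<close>
    have mean: "(LINT w'|N n. Z n j w') = m n" if j: "j \<in> {1..n}" for j
    proof -
      have "m n = (LINT x|distr (N n) borel (Z n j). x)"
        unfolding dN[OF elim(2) j] m_def
        using tilted_mean_def[of "e n"] ep[OF elim(2)] en[OF elim(2)] e0 by simp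
      also have "\<dots> = (LINT w'|N n. Z n j w')"
        using Zm[OF elim(2) j] by (intro integral_distr) auto
      finally show ?thesis ..
    qed
    have eq: "norm ((1 / sqrt (real n)) *\<^sub>R (\<Sum>j=1..n. Z n j w - (LINT w'|N n. Z n j w'))) = norm (W n w) / sqrt n" for w
      using mean by (simp add: W S_def)
    have Wm: "W n \<in> borel_measurable (N n)" unfolding W using Sm[OF elim(2) order_refl] by simp
    have "K0 < norm (W n w) / sqrt n" if "K * sqrt n < norm (W n w)" for w
    proof -
      have "K < norm (W n w) / sqrt n" using that n' by (simp add: field_simps)
      then show ?thesis by (simp add: K_def)
    qed
    then have "P.prob {w \<in> space (N n). K * sqrt n < norm (W n w)}
      \<le> P.prob {w \<in> space (N n). K0 < norm (W n w) / sqrt n}"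
      using Wm by (intro P.finite_measure_mono) auto
    then show ?case using elim(1) unfolding eq by linarith
  qed
  have main: "\<forall>\<^sub>F n in sequentially. 1 / (8 * sqrt v) * (sqrt n / b n) \<le>
    measure (N n) {w \<in> space (N n). blinfun_apply g (W n w) \<in> J n \<and> norm (W n w) \<le> (5 * K) * sqrt n}"
    using avg tail eventually_ge_at_top[of n0]
  proof eventually_elim
    case (elim n)
    note n = elim(3)
    interpret P: prob_space "N n" by (rule PN[OF n])
    have n': "2 \<le> n" "0 < real n" using n2[OF n] by simp_all
    define l where "l = L n / sqrt n"
    have l: "0 < l" using Lp[OF n] n' by (simp add: l_def)
    define A1 A2 where "A1 = {1..n div 2}" and "A2 = {n div 2 + 1..n}"
    have A: "A1 \<subseteq> {1..n}" "A2 \<subseteq> {1..n}" "A1 \<inter> A2 = {}" "A1 \<union> A2 = {1..n}"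
      by (auto simp: A1_def A2_def)
    have cA: "real n / 3 \<le> real (card A1)" "real n / 3 \<le> real (card A2)"
    proof -
      have "n \<le> 3 * (n div 2)" "n \<le> 3 * (n - n div 2)" using n' by presburger+
      then show "real n / 3 \<le> real (card A1)" "real n / 3 \<le> real (card A2)"
        by (simp_all add: A1_def A2_def)
    qed
    have WUV: "W n w = S n A1 w + S n A2 w" for w
      unfolding W S_def A(4)[symmetric] using A(3) by (intro sum.union_disjoint) (auto simp: A1_def A2_def)
    have Wm[measurable]: "W n \<in> borel_measurable (N n)" unfolding W using Sm[OF n order_refl] by simp
    have UV: "P.indep_var borel (S n A1) borel (S n A2)"
      using P.indep_var_block_sums[OF iS[OF n] A(3) A(1) A(2)] by (simp add: S_def[abs_def])
    have VU: "P.indep_var borel (S n A2) borel (S n A1)"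
      using P.indep_var_block_sums[OF iS[OF n] _ A(2) A(1)] A(3) by (simp add: S_def[abs_def] Int_commute)
    \<comment> \<open>The uniform concentration bound for one half: 2 from
      \<open>window_prob_upper\<close>, the rest from \<open>upper\<close> at width
      \<open>R * L n\<close>.\<close>
    define Q where "Q = 2 * (R * l * C5)"
    have Q: "0 \<le> Q" using R1 l C5 by (simp add: Q_def)
    have conc: "P.prob {w \<in> space (N n). x + g (S n B w) \<in> J n} \<le> Q"
      if B: "B \<subseteq> {1..n}" "real n / 3 \<le> real (card B)" for B x
    proof -
      have "P.prob {w \<in> space (N n). x + g (S n B w) \<in> J n}
        = P.prob {w \<in> space (N n). \<bar>g (S n B w) - ((R + 1) * L n - x)\<bar> \<le> R * L n}"
        by (simp add: J_iff algebra_simps)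
      also have "\<dots> = measure (\<rho> n B) {y. \<bar>y - ((R + 1) * L n - x)\<bar> \<le> R * L n}"
        unfolding \<rho>_def by (rule P.prob_real_distr[symmetric, OF gSm[OF n B(1)]]) simp
      also have "\<dots> \<le> 2 * (LINT y|\<rho> n B. exp (- ((y - ((R + 1) * L n - x)) / (R * L n))\<^sup>2 / 2))"
        using R1 Lp[OF n] by (intro window_prob_upper \<rho>rd[OF n B(1)]) simp
      also have "\<dots> \<le> Q"
        unfolding Q_def l_def by (intro mult_left_mono upper[OF n B R1]) simp
      finally show ?thesis .
    qed
    have bad: "P.prob {w \<in> space (N n). blinfun_apply g (W n w) \<in> J n \<and> 5 * (K * sqrt n) < norm (W n w)} \<le> 4 * \<eta> * Q"
      unfolding WUV
      by (rule P.indep_blocks_window_tail[OF UV VU _ Q \<eta> conc[OF A(1) cA(1)] conc[OF A(2) cA(2)]])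
         (use elim(2) in \<open>auto simp: J_def WUV\<close>)
    have "1 / (2 * sqrt v) * l - exp (- R\<^sup>2 / 4) * (sqrt 2 * l * C5) \<le> measure (\<rho> n {1..n}) {y. \<bar>y - (R + 1) * L n\<bar> \<le> R * L n}"
    proof -
      have "1 / (2 * sqrt v) * l \<le> (LINT y|\<rho> n {1..n}. exp (- ((y - (R + 1) * L n) / L n)\<^sup>2 / 2))"
        using mult_right_mono[OF less_imp_le[OF elim(1)], of l] l Lp[OF n] n' by (simp add: l_def)
      moreover have "(LINT y|\<rho> n {1..n}. exp (- ((y - (R + 1) * L n) / (sqrt 2 * L n))\<^sup>2 / 2)) \<le> sqrt 2 * l * C5"
        unfolding l_def by (rule upper[OF n order_refl]) auto
      then have "exp (- R\<^sup>2 / 4) * (LINT y|\<rho> n {1..n}. exp (- ((y - (R + 1) * L n) / (sqrt 2 * L n))\<^sup>2 / 2))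
          \<le> exp (- R\<^sup>2 / 4) * (sqrt 2 * l * C5)"
        by (rule mult_left_mono) simp
      ultimately show ?thesis
        using window_prob_lower[OF \<rho>rd[OF n order_refl] Lp[OF n], of R "(R + 1) * L n"] R1 by linarith
    qed
    also have "measure (\<rho> n {1..n}) {y. \<bar>y - (R + 1) * L n\<bar> \<le> R * L n}
      = P.prob {w \<in> space (N n). blinfun_apply g (W n w) \<in> J n}"
      unfolding \<rho>_def J_iff W by (rule P.prob_real_distr[OF gSm[OF n order_refl]]) simp
    finally have good: "1 / (2 * sqrt v) * l - exp (- R\<^sup>2 / 4) * (sqrt 2 * l * C5)
      \<le> P.prob {w \<in> space (N n). blinfun_apply g (W n w) \<in> J n}" .
    have "exp (- R\<^sup>2 / 4) * (sqrt 2 * l * C5) \<le> (exp (- R\<^sup>2 / 4) * (2 * C5)) * l"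
    proof -
      have "sqrt 2 \<le> 2" using sqrt2_less_2 by simp
      then have "sqrt 2 * (l * C5 * exp (- R\<^sup>2 / 4)) \<le> 2 * (l * C5 * exp (- R\<^sup>2 / 4))"
        using l C5 by (intro mult_right_mono) auto
      then show ?thesis by (simp add: mult_ac)
    qed
    also have "\<dots> \<le> 1 / (4 * sqrt v) * l" using expR l by (intro mult_right_mono) auto
    finally have good': "1 / (2 * sqrt v) * l - 1 / (4 * sqrt v) * l \<le> P.prob {w \<in> space (N n). blinfun_apply g (W n w) \<in> J n}"
      using good by linarith
    have "4 * \<eta> * Q = (8 * \<eta> * R * C5) * l" by (simp add: Q_def)
    also have "\<dots> \<le> 1 / (8 * sqrt v) * l" using \<eta>Q l by (intro mult_right_mono) auto
    finally have bad': "P.prob {w \<in> space (N n). blinfun_apply g (W n w) \<in> J n \<and> 5 * (K * sqrt n) < norm (W n w)} \<le> 1 / (8 * sqrt v) * l"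
      using bad by linarith
    have Jm[measurable]: "J n \<in> sets borel" by (simp add: J_def)
    have "P.prob {w \<in> space (N n). blinfun_apply g (W n w) \<in> J n}
      \<le> P.prob ({w \<in> space (N n). blinfun_apply g (W n w) \<in> J n \<and> norm (W n w) \<le> (5 * K) * sqrt n}
        \<union> {w \<in> space (N n). blinfun_apply g (W n w) \<in> J n \<and> 5 * (K * sqrt n) < norm (W n w)})"
      by (intro P.finite_measure_mono) (auto simp: not_le)
    also have "\<dots> \<le> P.prob {w \<in> space (N n). blinfun_apply g (W n w) \<in> J n \<and> norm (W n w) \<le> (5 * K) * sqrt n}
      + P.prob {w \<in> space (N n). blinfun_apply g (W n w) \<in> J n \<and> 5 * (K * sqrt n) < norm (W n w)}"
      by (rule measure_Un_le) auto
    finally have "1 / (2 * sqrt v) * l - 1 / (4 * sqrt v) * l - 1 / (8 * sqrt v) * l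
      \<le> P.prob {w \<in> space (N n). blinfun_apply g (W n w) \<in> J n \<and> norm (W n w) \<le> (5 * K) * sqrt n}"
      using good' bad' by linarith
    moreover have "1 / (2 * sqrt v) * l - 1 / (4 * sqrt v) * l - 1 / (8 * sqrt v) * l = 1 / (8 * sqrt v) * l"
      using v by (simp add: field_simps)
    moreover have "l = sqrt n / b n"
      using n' bp[OF n] by (simp add: l_def L_def real_div_sqrt field_simps)
    ultimately show ?case by simp
  qed
  show ?thesis
  proof (intro exI conjI)
    show "0 \<le> R" using R1 by simp
    show "0 \<le> 5 * K" by (simp add: K_def)
    show "0 < 1 / (8 * sqrt v)" using v by simp
    show "\<forall>\<^sub>F n in sequentially. 1 / (8 * sqrt v) * (sqrt n / b n) \<le>
      measure (N n) {w \<in> space (N n). blinfun_apply g (W n w) \<in> {real n / b n .. (2 * R + 1) * (real n / b n)} \<and>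
        norm (W n w) \<le> 5 * K * sqrt n}"
      using main by (simp add: J_def L_def)
  qed
qed

end

section \<open>The slice condition\<close>

context tilted_clt
begin

text \<open>The integral under the tilted law is restricted to \<open>E\<close>, where the
  exponential factor is at least exp (- B). The implication is required almost surely only, because
  the slice functional and \<open>g\<close> are proportional only almost everywhere.\<close>

lemma tilted_lower_bound:
  fixes Z :: "nat \<Rightarrow> 'z \<Rightarrow> 'a"
  assumes e: "0 \<le> e" "e \<le> t1" and P: "prob_space P"
    and Z: "prob_space.indep_vars P (\<lambda>_. borel) Z {1..n}"
    and Zd: "\<And>j. j \<in> {1..n} \<Longrightarrow> distr P borel (Z j) = tilted e"
    and A: "A \<in> sets borel" and E: "E \<in> sets P"
    and imp: "AE w in P. w \<in> E \<longrightarrow> (\<Sum>j=1..n. Z j w) \<in> A \<and> e * g (\<Sum>j=1..n. Z j w) \<le> B"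
  shows "mgf e ^ n * (exp (- B) * measure P E) \<le> measure M {w \<in> space M. (\<Sum>j=1..n. X j w) \<in> A}"
proof -
  interpret P: prob_space P by fact
  note [measurable] = A E
  define L where "L = laplace \<mu> (e *\<^sub>R g)"
  have L: "L = ennreal (mgf e)" unfolding L_def by (rule laplace_eq[OF e])
  have L1: "1 \<le> mgf e" by (rule mgf_ge_1[OF e])
  have MX: "{w \<in> space M. (\<Sum>j=1..n. X j w) \<in> A} \<in> sets M" by measurable
  have "ennreal (mgf e ^ n * (exp (- B) * measure P E)) = L ^ n * (\<integral>\<^sup>+w. ennreal (exp (- B)) * indicator E w \<partial>P)"
    using L1 by (simp add: L nn_integral_cmult_indicator P.emeasure_eq_measure ennreal_mult ennreal_power)
  also have "\<dots> \<le> L ^ card {1..n} * (\<integral>\<^sup>+w. indicator A (\<Sum>j=1..n. Z j w) * ennreal (exp (- (e *\<^sub>R g) (\<Sum>j=1..n. Z j w))) \<partial>P)"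
    unfolding card_atLeastAtMost diff_Suc_1
  proof (intro mult_left_mono nn_integral_mono_AE)
    show "AE w in P. ennreal (exp (- B)) * indicator E w
      \<le> indicator A (\<Sum>j=1..n. Z j w) * ennreal (exp (- (e *\<^sub>R g) (\<Sum>j=1..n. Z j w)))"
      using imp by eventually_elim (auto simp: indicator_def blinfun.scaleR_left intro!: ennreal_leI)
  qed simp
  also have "\<dots> = (\<integral>\<^sup>+w. indicator A (\<Sum>j=1..n. X j w) \<partial>M)"
  proof (rule tilted_sum_nn_integral[symmetric, OF M.prob_space_axioms P])
    show "M.indep_vars (\<lambda>_. borel) X {1..n}" by (rule M.indep_vars_subset[OF indep]) auto
    show "distr M borel (X j) = \<mu>" if "j \<in> {1..n}" for j using law that by simp
    show "distr P borel (Z j) = density \<mu> (\<lambda>x. ennreal (exp ((e *\<^sub>R g) x)) / L)" if "j \<in> {1..n}" for j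
      unfolding Zd[OF that] tilted_def[OF e] L_def by (simp add: blinfun.scaleR_left blinfun.scaleR_right)
  qed (use Z L L1 \<mu>.prob_space_axioms in auto)
  also have "\<dots> = (\<integral>\<^sup>+w. indicator {w \<in> space M. (\<Sum>j=1..n. X j w) \<in> A} w \<partial>M)"
    by (intro nn_integral_cong) (auto simp: indicator_def)
  also have "\<dots> = ennreal (measure M {w \<in> space M. (\<Sum>j=1..n. X j w) \<in> A})"
    using MX by (simp add: M.emeasure_eq_measure)
  finally show ?thesis by (simp add: ennreal_le_iff)
qed

text \<open>On the window event \<open>g (T - n m)\<close> is of order \<open>n / b\<^sub>n\<close>, so the height of \<open>T / b\<^sub>n\<close> above \<open>a0\<close> is of
  order \<open>q = n / b\<^sub>n\<^sup>2\<close>, while its lateral displacement is \<open>O(sqrt q)\<close>; the logarithm in the slice radius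
  beats the constant.\<close>

lemma window_event_in_slices:
  fixes b :: "nat \<Rightarrow> real"
  assumes a0: "a0 = cov_vec g" and pos: "0 < cov g g"
    and b: "\<forall>n\<ge>1. 0 < b n"
    and eps0: "(\<lambda>n. b n / real n) \<longlonglongrightarrow> 0" and eps3: "(\<lambda>n. real n * (b n / real n) ^ 3) \<longlonglongrightarrow> 0"
    and q0: "(\<lambda>n. real n / (b n)\<^sup>2) \<longlonglongrightarrow> 0" and eps_q: "\<forall>\<^sub>F n in sequentially. b n / real n \<le> sqrt (real n / (b n)\<^sup>2)"
    and cc: "0 < cc" and fa: "blinfun_apply f a0 = cc * g a0"
    and fx0: "0 < blinfun_apply f x0" and \<delta>: "0 < \<delta>" and \<beta>: "0 < \<beta>"
    and slices: "\<And>y s. \<lbrakk>blinfun_apply f y = 0; norm y \<le> \<beta> * sqrt (s * \<bar>ln s\<bar>); 0 < s; s \<le> \<delta>\<rbrakk> \<Longrightarrow> a0 + (y + s *\<^sub>R x0) \<in> D"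
    and R: "0 \<le> R" and K: "0 \<le> K"
  shows "\<forall>\<^sub>F n in sequentially. \<forall>T. blinfun_apply f T = cc * g T \<longrightarrow>
    g (T - real n *\<^sub>R tilted_mean (b n / real n)) \<in> {real n / b n .. (2 * R + 1) * (real n / b n)} \<longrightarrow>
    norm (T - real n *\<^sub>R tilted_mean (b n / real n)) \<le> K * sqrt n \<longrightarrow>
    (1 / b n) *\<^sub>R T \<in> D \<and> b n / real n * g T \<le> (b n)\<^sup>2 / real n * cov g g + (2 * R + 2)"
proof -
  obtain e0 C where e0: "0 < e0" and C: "0 \<le> C"
    and mean: "\<And>e. 0 < e \<Longrightarrow> e \<le> e0 \<Longrightarrow> norm (tilted_mean e - e *\<^sub>R a0) \<le> C * e\<^sup>2"
    using tilted_estimates unfolding a0 by blast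
  \<comment> \<open>The height along \<open>x0\<close> will lie between \<open>s1 * q n\<close> and
    \<open>s2 * q n\<close>; the factors 1/2 and 2 R + 2 are the bounds for \<open>H\<close>, the
    tilt times the g-displacement from \<open>b n *\<^sub>R a0\<close>.\<close>
  define s1 where "s1 = cc / (2 * blinfun_apply f x0)"
  define s2 where "s2 = cc * (2 * R + 2) / blinfun_apply f x0"
  have s12: "0 < s1" "0 < s2" using cc fx0 R by (auto simp: s1_def s2_def)
  \<comment> \<open>The size of |ln s| at which a slice of height at least \<open>s1 * q n\<close>
    has radius (K + C + 1) sqrt (q n). Here K comes from the window event, C from the error in the
    mean, and 1 from removing the component along \<open>x0\<close>.\<close>
  define B where "B = (K + C + 1)\<^sup>2 / (\<beta>\<^sup>2 * s1)"
  define q where "q n = real n / (b n)\<^sup>2" for n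
  have q0: "q \<longlonglongrightarrow> 0" unfolding q_def by (rule q0)
  have sq0: "(\<lambda>n. s2 * q n) \<longlonglongrightarrow> 0" using tendsto_mult_right_zero[OF q0] by simp
  have ssq0: "(\<lambda>n. s2 * sqrt (q n) * norm x0) \<longlonglongrightarrow> 0"
    using tendsto_mult_left_zero[OF tendsto_mult_right_zero[OF tendsto_real_sqrt[OF q0, simplified]]] by simp
  have g_eps3: "(\<lambda>n. norm g * C * (real n * (b n / real n) ^ 3)) \<longlonglongrightarrow> 0"
    by (rule tendsto_mult_right_zero[OF eps3])
  have "\<forall>\<^sub>F n in sequentially. b n / real n < e0" by (rule order_tendstoD(2)[OF eps0 e0])
  moreover have "\<forall>\<^sub>F n in sequentially. norm g * C * (real n * (b n / real n) ^ 3) < 1 / 2"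
    by (rule order_tendstoD(2)[OF g_eps3]) simp
  moreover have "\<forall>\<^sub>F n in sequentially. s2 * q n < min \<delta> (min 1 (exp (- B)))"
    by (rule order_tendstoD(2)[OF sq0]) (use \<delta> in simp)
  moreover have "\<forall>\<^sub>F n in sequentially. s2 * sqrt (q n) * norm x0 < 1"
    by (rule order_tendstoD(2)[OF ssq0]) simp
  ultimately show ?thesis using eps_q eventually_ge_at_top[of 1]
  proof eventually_elim
    case (elim n)
    define e where "e = b n / real n"
    have n: "0 < real n" and bn: "0 < b n" using elim(6) b by auto
    have ep: "0 < e" using n bn by (simp add: e_def)
    have qn: "0 < q n" using n bn by (simp add: q_def)
    have b_e: "b n = real n * e" using n by (simp add: e_def)
    have e_b: "e * b n * q n = 1" using n bn by (simp add: e_def q_def power2_eq_square)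
    have sqb: "sqrt n / b n = sqrt (q n)" using bn by (simp add: q_def real_sqrt_divide)
    have eq': "e \<le> sqrt (q n)" using elim(5) by (simp add: e_def q_def)
    have q3: "s2 * q n < \<delta>" "s2 * q n < 1" "s2 * q n < exp (- B)" using elim(3) by auto
    show ?case
    proof (intro allI impI)
      fix T
      define W where "W = T - real n *\<^sub>R tilted_mean (b n / real n)"
      assume fT: "blinfun_apply f T = cc * g T"
        and "g (T - real n *\<^sub>R tilted_mean (b n / real n)) \<in> {real n / b n .. (2 * R + 1) * (real n / b n)}"
        and "norm (T - real n *\<^sub>R tilted_mean (b n / real n)) \<le> K * sqrt n"
      then have gW: "real n / b n \<le> blinfun_apply g W" "blinfun_apply g W \<le> (2 * R + 1) * (real n / b n)"
        and nW: "norm W \<le> K * sqrt n" by (auto simp: W_def)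
      define r where "r = real n *\<^sub>R (tilted_mean e - e *\<^sub>R a0)"
      have TW: "T - b n *\<^sub>R a0 = W + r" by (simp add: W_def r_def b_e e_def[symmetric] algebra_simps)
      have nr: "norm r \<le> real n * (C * e\<^sup>2)"
        unfolding r_def using mean[of e] ep elim(1) n by (simp add: e_def)
      \<comment> \<open>This is where n e^3 -> 0 is used: the error in the mean shifts the scaled
        height by at most 1/2, less than the height 1 at which the window begins.\<close>
      have gr: "\<bar>e * g r\<bar> \<le> 1 / 2"
      proof -
        have "\<bar>e * g r\<bar> = e * \<bar>g r\<bar>" using ep by (simp add: abs_mult)
        also have "\<dots> \<le> e * (norm g * (real n * (C * e\<^sup>2)))"
          using ep nr by (intro mult_left_mono order_trans[OF abs_g_le]) auto
        also have "\<dots> = norm g * C * (real n * e ^ 3)" by (simp add: power2_eq_square power3_eq_cube)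
        also have "\<dots> \<le> 1 / 2" using elim(2) by (simp add: e_def)
        finally show ?thesis .
      qed
      have e_L: "e * (real n / b n) = 1" using n bn by (simp add: e_def)
      have e_W: "1 \<le> e * blinfun_apply g W" "e * blinfun_apply g W \<le> 2 * R + 1"
      proof -
        have "e * (real n / b n) \<le> e * blinfun_apply g W" using gW(1) ep by (intro mult_left_mono) auto
        then show "1 \<le> e * blinfun_apply g W" unfolding e_L .
        have "e * blinfun_apply g W \<le> e * ((2 * R + 1) * (real n / b n))"
          using gW(2) ep by (intro mult_left_mono) auto
        also have "\<dots> = (2 * R + 1) * (e * (real n / b n))" by simp
        finally show "e * blinfun_apply g W \<le> 2 * R + 1" unfolding e_L by simp
      qed
      define H where "H = e * g (T - b n *\<^sub>R a0)"
      have "H = e * blinfun_apply g W + e * g r"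
        by (simp add: H_def TW blinfun.add_right distrib_left)
      with gr e_W have H: "1 / 2 \<le> H" "H \<le> 2 * R + 2" by (auto simp: abs_le_iff)
      have ga: "g a0 = cov g g" unfolding a0 by (rule blinfun_cov_vec)
      have "e * g T = H + e * b n * cov g g"
        by (simp add: H_def blinfun.diff_right blinfun.scaleR_right ga algebra_simps)
      moreover have "e * b n = (b n)\<^sup>2 / real n" by (simp add: e_def power2_eq_square)
      ultimately have concl2: "e * g T \<le> (b n)\<^sup>2 / real n * cov g g + (2 * R + 2)"
        using H by simp
      define u where "u = (1 / b n) *\<^sub>R (T - b n *\<^sub>R a0)"
      have Tu: "(1 / b n) *\<^sub>R T = a0 + u" using bn by (simp add: u_def algebra_simps)
      define s where "s = blinfun_apply f u / blinfun_apply f x0"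
      \<comment> \<open>The factor \<open>e * b n * q n = 1\<close> is inserted to exchange the
        division by \<open>b n\<close> for \<open>e\<close> and \<open>q n\<close>.\<close>
      have fu: "blinfun_apply f u = cc * H * q n"
      proof -
        have "blinfun_apply f u = (1 / b n) * (cc * g (T - b n *\<^sub>R a0))"
          by (simp add: u_def blinfun.scaleR_right blinfun.diff_right fT fa algebra_simps)
        also have "\<dots> = (1 / b n) * (cc * g (T - b n *\<^sub>R a0)) * (e * b n * q n)"
          unfolding e_b by simp
        also have "\<dots> = cc * H * q n" using bn by (simp add: H_def)
        finally show ?thesis .
      qed
      have s_lo: "s1 * q n \<le> s"
      proof -
        have "cc * (1 / 2) * q n \<le> cc * H * q n" using H cc qn by (intro mult_right_mono mult_left_mono) auto
        from divide_right_mono[OF this, of "blinfun_apply f x0"] fx0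
        show ?thesis by (simp add: s_def fu s1_def)
      qed
      have s_hi: "s \<le> s2 * q n"
      proof -
        have "cc * H * q n \<le> cc * (2 * R + 2) * q n" using H cc qn by (intro mult_right_mono mult_left_mono) auto
        from divide_right_mono[OF this, of "blinfun_apply f x0"] fx0
        show ?thesis by (simp add: s_def fu s2_def)
      qed
      have "0 < s1 * q n" using s12 qn by simp
      with s_lo have s: "0 < s" by linarith
      \<comment> \<open>The height \<open>s\<close> was defined so that removing
        \<open>s *\<^sub>R x0\<close> leaves a vector in the kernel of \<open>f\<close>, as the
        slices demand.\<close>
      define y where "y = u - s *\<^sub>R x0"
      have fy: "blinfun_apply f y = 0" using fx0 by (simp add: y_def s_def blinfun.diff_right blinfun.scaleR_right)
      have ny: "norm y \<le> (K + C + 1) * sqrt (q n)"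
      proof -
        have "norm u = (1 / b n) * norm (W + r)" using bn by (simp add: u_def TW)
        also have "\<dots> \<le> (1 / b n) * (K * sqrt n + real n * (C * e\<^sup>2))"
          using bn nW nr by (intro mult_left_mono order_trans[OF norm_triangle_ineq] add_mono) auto
        also have "\<dots> = K * (sqrt n / b n) + C * (e * (real n * e / b n))"
          by (simp add: distrib_left power2_eq_square)
        also have "\<dots> = K * sqrt (q n) + C * e"
        proof -
          have one: "real n * e / b n = 1" unfolding b_e[symmetric] using bn by simp
          show ?thesis unfolding sqb one by simp
        qed
        also have "\<dots> \<le> K * sqrt (q n) + C * sqrt (q n)"
          using eq' C by (intro add_left_mono mult_left_mono) auto
        finally have nu: "norm u \<le> (K + C) * sqrt (q n)" by (simp add: distrib_right)
        have "norm (s *\<^sub>R x0) = s * norm x0" using s by simp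
        also have "\<dots> \<le> (s2 * q n) * norm x0" using s_hi by (intro mult_right_mono) auto
        also have "\<dots> = (s2 * sqrt (q n) * norm x0) * sqrt (q n)"
          using qn by (simp add: mult_ac)
        also have "\<dots> \<le> 1 * sqrt (q n)" using elim(4) qn by (intro mult_right_mono) auto
        finally have "norm (s *\<^sub>R x0) \<le> sqrt (q n)" by simp
        with nu norm_triangle_ineq4[of u "s *\<^sub>R x0"] show ?thesis by (simp add: y_def distrib_right)
      qed
      \<comment> \<open>Since s is at most \<open>s2 * q n\<close> < exp (- B), its logarithm is
        below - B, so the logarithmic factor of the slice radius exceeds \<open>B\<close>.\<close>
      have "ln s \<le> ln (s2 * q n)" using s s_hi by simp
      also have "\<dots> \<le> - B"
      proof -
        have "ln (s2 * q n) \<le> ln (exp (- B))" using q3(3) s12 qn by (intro ln_mono) auto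
        then show ?thesis by simp
      qed
      finally have lns: "B \<le> \<bar>ln s\<bar>" by linarith
      have "(K + C + 1) * sqrt (q n) \<le> \<beta> * sqrt (s * \<bar>ln s\<bar>)"
      proof -
        have "((K + C + 1) / \<beta>)\<^sup>2 * q n = (s1 * q n) * B"
          using s12 by (simp add: B_def power_divide)
        also have "\<dots> \<le> s * \<bar>ln s\<bar>"
          using s_lo lns s s12 by (intro mult_mono) (auto simp: B_def)
        finally have "sqrt (((K + C + 1) / \<beta>)\<^sup>2 * q n) \<le> sqrt (s * \<bar>ln s\<bar>)" by (rule real_sqrt_le_mono)
        then have "(K + C + 1) / \<beta> * sqrt (q n) \<le> sqrt (s * \<bar>ln s\<bar>)"
          using K C \<beta> by (simp add: real_sqrt_mult)
        then show ?thesis using \<beta> by (simp add: field_simps)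
      qed
      then have "a0 + (y + s *\<^sub>R x0) \<in> D" using ny s s_hi q3 by (intro slices fy) auto
      then show "(1 / b n) *\<^sub>R T \<in> D \<and> b n / real n * g T \<le> (b n)\<^sup>2 / real n * cov g g + (2 * R + 2)"
        using concl2 by (simp add: Tu y_def e_def)
    qed
  qed
qed

end

text \<open>With d = b_n / n^(2/3), the cubic error n (b_n / n)^3 equals d^3 and sqrt n / (n /
  b_n)^3 equals d^3 / sqrt n. The quantities n / b_n^2 and sqrt n / b_n instead express that b_n /
  sqrt n tends to infinity.\<close>

lemma moderate_deviation_scales:
  fixes b :: "nat \<Rightarrow> real"
  assumes b: "\<forall>n\<ge>1. 0 < b n"
    and b1: "filterlim (\<lambda>n. b n / sqrt (real n)) at_top sequentially"
    and b2: "(\<lambda>n. b n / real n powr (2 / 3)) \<longlonglongrightarrow> 0"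
  shows "(\<lambda>n. b n / real n) \<longlonglongrightarrow> 0" "(\<lambda>n. real n * (b n / real n) ^ 3) \<longlonglongrightarrow> 0"
    "(\<lambda>n. real n / (b n)\<^sup>2) \<longlonglongrightarrow> 0" "\<forall>\<^sub>F n in sequentially. b n / real n \<le> sqrt (real n / (b n)\<^sup>2)"
    "(\<lambda>n. (real n / b n) / sqrt n) \<longlonglongrightarrow> 0" "(\<lambda>n. sqrt n / (real n / b n) ^ 3) \<longlonglongrightarrow> 0"
proof -
  define d where "d n = b n / real n powr (2 / 3)" for n
  have d: "d \<longlonglongrightarrow> 0" using b2 by (simp add: d_def[abs_def])
  have bd: "b n = d n * real n powr (2 / 3)" if "n \<ge> 1" for n using that by (simp add: d_def)
  have pw: "(\<lambda>n. real n powr (- a)) \<longlonglongrightarrow> 0" if "0 < a" for a :: real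
    using tendsto_neg_powr[of "- a" "\<lambda>n. real n" sequentially] that filterlim_real_sequentially by simp
  have p3: "(real n powr (2 / 3)) ^ 3 = real n ^ 2" if "n \<ge> 1" for n
  proof -
    have "(real n powr (2 / 3)) ^ 3 = real n powr 2" using that by (simp add: powr_power)
    also have "\<dots> = real n ^ 2" using that by simp
    finally show ?thesis .
  qed
  have sq: "sqrt (real n) = real n powr (1 / 2)" for n by (simp add: powr_half_sqrt)
  have ev: "\<forall>\<^sub>F n in sequentially. n \<ge> (1::nat)" by (rule eventually_ge_at_top)
  have e1: "d n * real n powr - (1 / 3) = b n / real n" if "n \<ge> 1" for n
  proof -
    have "real n powr (2 / 3) = real n powr - (1 / 3) * real n powr 1"
      unfolding powr_add[symmetric] by simp
    then show ?thesis using that by (simp add: bd)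
  qed
  have "(\<lambda>n. d n * real n powr - (1 / 3)) \<longlonglongrightarrow> 0 * 0" by (intro tendsto_mult d pw) simp
  then have "(\<lambda>n. d n * real n powr - (1 / 3)) \<longlonglongrightarrow> 0" by simp
  then show "(\<lambda>n. b n / real n) \<longlonglongrightarrow> 0"
    by (rule Lim_transform_eventually) (rule eventually_mono[OF ev], rule e1)
  have e2: "d n ^ 3 = real n * (b n / real n) ^ 3" if "n \<ge> 1" for n
  proof -
    have "d n ^ 3 = b n ^ 3 / real n ^ 2" by (simp only: d_def power_divide p3[OF that])
    also have "\<dots> = real n * (b n / real n) ^ 3"
      using that by (simp add: power_divide power2_eq_square power3_eq_cube)
    finally show ?thesis .
  qed
  have d3: "(\<lambda>n. d n ^ 3) \<longlonglongrightarrow> 0" using tendsto_power[OF d, of 3] by simp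
  then show "(\<lambda>n. real n * (b n / real n) ^ 3) \<longlonglongrightarrow> 0"
    by (rule Lim_transform_eventually) (rule eventually_mono[OF ev], rule e2)
  have inv0: "(\<lambda>n. inverse (b n / sqrt (real n))) \<longlonglongrightarrow> 0"
    by (rule tendsto_inverse_0_at_top[OF b1])
  have e5: "inverse (b n / sqrt (real n)) = (real n / b n) / sqrt n" if "n \<ge> 1" for n
  proof -
    have "(real n / b n) / sqrt n = (real n / sqrt n) / b n" by simp
    also have "real n / sqrt n = sqrt n" by (simp add: real_div_sqrt)
    finally show ?thesis by simp
  qed
  from inv0 show "(\<lambda>n. (real n / b n) / sqrt n) \<longlonglongrightarrow> 0"
    by (rule Lim_transform_eventually) (rule eventually_mono[OF ev], rule e5)
  have "(\<lambda>n. (inverse (b n / sqrt (real n)))\<^sup>2) \<longlonglongrightarrow> 0" using tendsto_power[OF inv0, of 2] by simp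
  then show "(\<lambda>n. real n / (b n)\<^sup>2) \<longlonglongrightarrow> 0"
    by (rule Lim_transform_eventually) (rule eventually_mono[OF ev], simp add: power_divide power_inverse)
  have e6: "d n ^ 3 * real n powr - (1 / 2) = sqrt n / (real n / b n) ^ 3" if "n \<ge> 1" for n
  proof -
    have h: "real n powr - (1 / 2) = 1 / sqrt n" by (simp add: powr_minus sq inverse_eq_divide)
    have "d n ^ 3 * real n powr - (1 / 2) = (real n / sqrt n) * (b n / real n) ^ 3"
      unfolding e2[OF that] h by simp
    also have "real n / sqrt n = sqrt n" by (simp add: real_div_sqrt)
    also have "sqrt n * (b n / real n) ^ 3 = sqrt n / (real n / b n) ^ 3" by (simp add: power_divide)
    finally show ?thesis .
  qed
  have "(\<lambda>n. d n ^ 3 * real n powr - (1 / 2)) \<longlonglongrightarrow> 0 * 0" by (intro tendsto_mult d3 pw) simp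
  then have "(\<lambda>n. d n ^ 3 * real n powr - (1 / 2)) \<longlonglongrightarrow> 0" by simp
  then show "(\<lambda>n. sqrt n / (real n / b n) ^ 3) \<longlonglongrightarrow> 0"
    by (rule Lim_transform_eventually) (rule eventually_mono[OF ev], rule e6)
  have "\<forall>\<^sub>F n in sequentially. d n < 1" by (rule order_tendstoD(2)[OF d]) simp
  then show "\<forall>\<^sub>F n in sequentially. b n / real n \<le> sqrt (real n / (b n)\<^sup>2)"
    using ev
  proof eventually_elim
    case (elim n)
    have bn: "0 < b n" and n: "0 < real n" "1 \<le> real n" using b elim(2) by auto
    have d0: "0 \<le> d n" using bn by (simp add: d_def)
    have "real n * (b n / real n) ^ 3 \<le> 1" unfolding e2[OF elim(2), symmetric] using d0 elim(1) by (simp add: power_le_one)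
    then have b3: "b n ^ 3 \<le> real n ^ 2" using n by (simp add: power_divide power2_eq_square power3_eq_cube field_simps)
    \<comment> \<open>The claim amounts to b^4 <= n^3. Only b^3 <= n^2 is at hand, so cubes are
      compared: b^12 <= n^8 <= n^9.\<close>
    have "(b n ^ 4) ^ 3 = (b n ^ 3) ^ 4" by (simp add: power_mult[symmetric])
    also have "\<dots> \<le> (real n ^ 2) ^ 4" using b3 bn by (intro power_mono) auto
    also have "\<dots> \<le> (real n ^ 3) ^ 3" using n by (simp add: power_mult[symmetric] power_increasing)
    finally have "b n ^ 4 \<le> real n ^ 3" using n by (rule_tac power_le_imp_le_base[of _ 2]) (auto simp: numeral_3_eq_3)
    then have "(b n / real n)\<^sup>2 \<le> real n / (b n)\<^sup>2"
      using n bn by (simp add: power_divide field_simps power2_eq_square power3_eq_cube power4_eq_xxxx)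
    then show ?case by (rule real_le_rsqrt)
  qed
qed

theorem theorem2:
  fixes M :: "'w measure"
    and X :: "nat \<Rightarrow> 'w \<Rightarrow> 'a::{banach, second_countable_topology}"
    and \<mu> \<gamma> :: "'a measure"
    and b :: "nat \<Rightarrow> real"
    and D :: "'a set"
    and a0 :: 'a
    and g :: "'a \<Rightarrow>\<^sub>L real"
    and N :: "nat \<Rightarrow> 'z measure"
    and Z :: "nat \<Rightarrow> nat \<Rightarrow> 'z \<Rightarrow> 'a"
    and \<beta> :: real
  assumes "prob_space M"
    and "prob_space.indep_vars M (\<lambda>_. borel) X {1..}"
    and "\<And>j. j \<ge> 1 \<Longrightarrow> distr M borel (X j) = \<mu>"
    and "prob_space \<gamma>" and "sets \<gamma> = sets borel"
    and "\<not> (\<exists>x. \<gamma> = return borel x)"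
    and "weakly_converges (\<lambda>n. distr M borel (\<lambda>\<omega>. (1 / sqrt (real n)) *\<^sub>R (\<Sum>j=1..n. X j \<omega>))) \<gamma>"
    and "\<And>n. n \<ge> 1 \<Longrightarrow> b n > 0"
    and "filterlim (\<lambda>n. b n / sqrt (real n)) at_top sequentially"
    and "(\<lambda>n. b n / real n powr (2 / 3)) \<longlonglongrightarrow> 0"
    and "\<And>f :: 'a \<Rightarrow>\<^sub>L real. \<exists>tf>0. \<forall>t. 0 < \<bar>t\<bar> \<and> \<bar>t\<bar> < tf \<longrightarrow>
           (\<integral>\<^sup>+x. ennreal (norm x ^ 3 * exp (t * \<bar>f x\<bar>)) \<partial>\<mu>) < \<infinity>"
    and "open D" and "convex D"
    and "D \<inter> gen_hilbert_space \<gamma> \<noteq> {}" and "0 \<notin> closure D"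
    and "dominating_point \<gamma> D a0"
    and "associated_functional \<gamma> D a0 g"
    and "\<And>n. n \<ge> 1 \<Longrightarrow> laplace \<mu> ((b n / real n) *\<^sub>R g) < \<infinity> \<Longrightarrow>
           prob_space (N n) \<and>
           prob_space.indep_vars (N n) (\<lambda>_. borel) (Z n) {1..n} \<and>
           (\<forall>j\<in>{1..n}. distr (N n) borel (Z n j) =
              density \<mu> (\<lambda>x. ennreal (exp (g ((b n / real n) *\<^sub>R x))) /
                              laplace \<mu> ((b n / real n) *\<^sub>R g)))"
    and "bounded_in_probability N
           (\<lambda>n \<omega>. (1 / sqrt (real n)) *\<^sub>R
              (\<Sum>j=1..n. Z n j \<omega> - (LINT \<omega>'|N n. Z n j \<omega>')))"
    and "\<beta> > 0"
    and "contains_slices \<gamma> D a0 (\<lambda>s. \<beta> * sqrt (s * \<bar>ln s\<bar>))"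
  shows "Liminf sequentially (\<lambda>n. ereal
           (real n powr (- 1 / 2) * b n *
            measure M {\<omega> \<in> space M. (1 / b n) *\<^sub>R (\<Sum>j=1..n. X j \<omega>) \<in> D} *
            exp ((b n)\<^sup>2 / real n * real_of_ereal (rate_function \<gamma> a0)))) > 0"
proof -
  interpret M: prob_space M by fact
  note iX = assms(2) and dX = assms(3) and s\<gamma> = assms(5) and weak = assms(7) 
    and b1 = assms(9) and b2 = assms(10) and moments = assms(11)
    and D = assms(12) and D0 = assms(15) and dp = assms(16) and assoc = assms(17)
    and ZN = assms(18) and tight = assms(19) and \<beta> = assms(20) and slices = assms(21)
  have bpos: "\<forall>n\<ge>1. 0 < b n" using assms(8) by blast
  note scales = moderate_deviation_scales[OF bpos b1 b2]
  have s\<mu>[measurable_cong]: "sets \<mu> = sets borel" using dX[of 1] by auto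
  have moment_integrable: "\<exists>t>0. integrable \<mu> (\<lambda>x. norm x ^ 3 * exp (t * \<bar>h x\<bar>))" for h :: "'a \<Rightarrow>\<^sub>L real"
  proof -
    obtain tf where tf: "tf > 0" "\<And>t. 0 < \<bar>t\<bar> \<and> \<bar>t\<bar> < tf \<Longrightarrow> (\<integral>\<^sup>+x. ennreal (norm x ^ 3 * exp (t * \<bar>h x\<bar>)) \<partial>\<mu>) < \<infinity>"
      using moments[of h] by auto
    have "integrable \<mu> (\<lambda>x. norm x ^ 3 * exp (tf / 2 * \<bar>h x\<bar>))"
    proof (rule integrableI_bounded)
      show "(\<integral>\<^sup>+x. ennreal (norm (norm x ^ 3 * exp (tf / 2 * \<bar>h x\<bar>))) \<partial>\<mu>) < \<infinity>"
        using tf(2)[of "tf / 2"] tf(1) by simp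
    qed measurable
    then show ?thesis using tf(1) by (intro exI[of _ "tf / 2"]) auto
  qed
  have moment3: "integrable \<mu> (\<lambda>x. norm x ^ 3)"
    using moment_integrable[of 0] by (simp add: blinfun.zero_left)
  obtain t1 where t1: "t1 > 0" "integrable \<mu> (\<lambda>x. norm x ^ 3 * exp (t1 * \<bar>g x\<bar>))"
    using moment_integrable[of g] by auto
  interpret tilted_clt M X \<mu> \<gamma> g t1
    by (intro tilted_clt.intro clt_domain.intro tilted_clt_axioms.intro assms(1-5) weak moment3 t1)
  have dg: "dominating_functional \<gamma> D a0 g" using assoc by (auto simp: associated_functional_def)
  \<comment> \<open>The frontier is part of the closure of \<open>D\<close>, which does not contain
    0.\<close>
  have a0n: "a0 \<noteq> 0" using dp D0 by (auto simp: dominating_point_def frontier_def)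
  have a0: "a0 = cov_vec g" by (rule dominating_functional_cov_vec[OF dg])
  define v where "v = cov g g"
  have v: "0 < v" unfolding v_def by (rule cov_dominating_pos[OF dg a0n])
  have rate: "real_of_ereal (rate_function \<gamma> a0) = v / 2" by (simp add: rate_function_dominating(1)[OF dg] v_def)
  obtain f x0 \<delta> where f: "separating_functional \<gamma> D a0 f" and \<delta>: "0 < \<delta>" and fx0: "0 < f x0"
    and sl: "{y + s *\<^sub>R x0 |y s. f y = 0 \<and> norm y \<le> \<beta> * sqrt (s * \<bar>ln s\<bar>) \<and> 0 < s \<and> s \<le> \<delta>} \<subseteq> (\<lambda>x. x - a0) ` D"
    using slices unfolding contains_slices_def by blast
  obtain cc where cc: "0 < cc" "AE x in \<mu>. f x = cc * g x" "f a0 = cc * g a0"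
    using separating_functional_proportional[OF dp dg a0n f] by blast
  have sl': "a0 + (y + s *\<^sub>R x0) \<in> D"
    if "f y = 0" "norm y \<le> \<beta> * sqrt (s * \<bar>ln s\<bar>)" "0 < s" "s \<le> \<delta>" for y s
  proof -
    have "y + s *\<^sub>R x0 \<in> (\<lambda>x. x - a0) ` D" using sl that by blast
    then show ?thesis by auto
  qed
  obtain e0 C where e0: "0 < e0" "e0 \<le> t1" and C: "0 \<le> C"
    and mgf: "\<And>e. 0 < e \<Longrightarrow> e \<le> e0 \<Longrightarrow> exp (e\<^sup>2 * v / 2 - C * e ^ 3) \<le> mgf e"
    using tilted_estimates unfolding v_def by blast
  \<comment> \<open>For tilts up to \<open>t1\<close> the Laplace transform is finite, so the array
    has its prescribed laws from some index on.\<close>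
  have array: "\<forall>\<^sub>F n in sequentially. prob_space (N n) \<and> prob_space.indep_vars (N n) (\<lambda>_. borel) (Z n) {1..n} \<and>
      (\<forall>j\<in>{1..n}. distr (N n) borel (Z n j) = tilted (b n / real n))"
    using order_tendstoD(2)[OF scales(1) e0(1)] eventually_ge_at_top[of 1]
  proof eventually_elim
    case (elim n)
    have small: "0 \<le> b n / real n" "b n / real n \<le> t1" using elim bpos e0 by auto
    have "laplace \<mu> ((b n / real n) *\<^sub>R g) < \<infinity>" unfolding laplace_eq[OF small] by simp
    from ZN[OF elim(2) this] show ?case unfolding tilted_def[OF small] by simp
  qed
  obtain R K p where R: "0 \<le> R" and K: "0 \<le> K" and p: "0 < p"
    and window: "\<forall>\<^sub>F n in sequentially. p * (sqrt n / b n) \<le>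
      measure (N n) {w \<in> space (N n). blinfun_apply g (\<Sum>j=1..n. Z n j w - tilted_mean (b n / real n)) \<in> {real n / b n .. (2 * R + 1) * (real n / b n)} \<and>
        norm (\<Sum>j=1..n. Z n j w - tilted_mean (b n / real n)) \<le> K * sqrt n}"
    using tilted_window_prob[OF v[unfolded v_def] array bpos scales(1) scales(5) scales(6) tight] by blast
  have event: "\<forall>\<^sub>F n in sequentially. \<forall>T. f T = cc * g T \<longrightarrow>
    g (T - real n *\<^sub>R tilted_mean (b n / real n)) \<in> {real n / b n .. (2 * R + 1) * (real n / b n)} \<longrightarrow>
    norm (T - real n *\<^sub>R tilted_mean (b n / real n)) \<le> K * sqrt n \<longrightarrow>
    (1 / b n) *\<^sub>R T \<in> D \<and> b n / real n * g T \<le> (b n)\<^sup>2 / real n * cov g g + (2 * R + 2)"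
    by (rule window_event_in_slices[OF a0 v[unfolded v_def] bpos scales(1-4) cc(1) cc(3) fx0 \<delta> \<beta> sl' R K])
  have "\<forall>\<^sub>F n in sequentially. C * (real n * (b n / real n) ^ 3) < 1"
    by (rule order_tendstoD(2)[OF tendsto_mult_right_zero[OF scales(2)]]) simp
  \<comment> \<open>In the constant, 2 R + 2 is the excess of \<open>e * g T\<close> over its main
    term on the window event, and the remaining 1 bounds n C e^3, the cubic error in the logarithm
    of \<open>mgf e ^ n\<close>.\<close>
  then have "\<forall>\<^sub>F n in sequentially. p * exp (- (2 * R + 3)) \<le>
      real n powr (- 1 / 2) * b n *
            measure M {w \<in> space M. (1 / b n) *\<^sub>R (\<Sum>j=1..n. X j w) \<in> D} *
            exp ((b n)\<^sup>2 / real n * real_of_ereal (rate_function \<gamma> a0))"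
    using event window array order_tendstoD(2)[OF scales(1) e0(1)] eventually_ge_at_top[of 1]
  proof eventually_elim
    case (elim n)
    define e where "e = b n / real n"
    have bn: "0 < b n" and n: "0 < real n" using bpos elim(6) by auto
    have small: "0 < e" "e \<le> e0" "0 \<le> e" "e \<le> t1" using bn n elim(5) e0 by (auto simp: e_def)
    have PN: "prob_space (N n)" and iN: "prob_space.indep_vars (N n) (\<lambda>_. borel) (Z n) {1..n}"
      and dN: "\<And>j. j \<in> {1..n} \<Longrightarrow> distr (N n) borel (Z n j) = tilted e"
      using elim(4) by (auto simp: e_def)
    interpret P: prob_space "N n" by (rule PN)
    have Zm: "Z n j \<in> borel_measurable (N n)" if "j \<in> {1..n}" for j
      using iN that unfolding P.indep_vars_def by auto
    have Tm[measurable]: "(\<lambda>w. \<Sum>j=1..n. Z n j w) \<in> borel_measurable (N n)"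
      using Zm by (intro borel_measurable_sum) auto
    have W: "(\<Sum>j=1..n. Z n j w - tilted_mean (b n / real n)) = (\<Sum>j=1..n. Z n j w) - real n *\<^sub>R tilted_mean (b n / real n)" for w
      by (simp add: sum_subtractf sum_constant_scaleR)
    define E where "E = {w \<in> space (N n). blinfun_apply g (\<Sum>j=1..n. Z n j w - tilted_mean (b n / real n)) \<in> {real n / b n .. (2 * R + 1) * (real n / b n)} \<and>
        norm (\<Sum>j=1..n. Z n j w - tilted_mean (b n / real n)) \<le> K * sqrt n}"
    have Em: "E \<in> sets (N n)" unfolding E_def W by measurable
    \<comment> \<open>The tilted law has a density with respect to \<open>\<mu>\<close>, so the
      almost sure proportionality passes to each of the finitely many summands and then to their
      sum.\<close>
    have "AE w in N n. \<forall>j\<in>{1..n}. f (Z n j w) = cc * g (Z n j w)"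
    proof (rule AE_ball_countable[THEN iffD2])
      show "\<forall>j\<in>{1..n}. AE w in N n. f (Z n j w) = cc * g (Z n j w)"
      proof
        fix j assume j: "j \<in> {1..n}"
        have "AE x in tilted e. f x = cc * g x"
          unfolding tilted_eq[OF small(3,4)] by (subst AE_density) (use cc(2) in \<open>auto elim: eventually_mono\<close>)
        then have "AE x in distr (N n) borel (Z n j). f x = cc * g x"
          by (simp only: dN[OF j])
        then show "AE w in N n. f (Z n j w) = cc * g (Z n j w)"
          using Zm[OF j] by (subst (asm) AE_distr_iff) auto
      qed
    qed simp
    then have "AE w in N n. w \<in> E \<longrightarrow> (\<Sum>j=1..n. Z n j w) \<in> (\<lambda>x. (1 / b n) *\<^sub>R x) -` D \<and>
        e * blinfun_apply g (\<Sum>j=1..n. Z n j w) \<le> (b n)\<^sup>2 / real n * v + (2 * R + 2)"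
    proof eventually_elim
      case (elim w)
      have "blinfun_apply f (\<Sum>j=1..n. Z n j w) = cc * blinfun_apply g (\<Sum>j=1..n. Z n j w)"
        using elim by (simp add: blinfun.sum_right sum_distrib_left)
      then show ?case
        using \<open>\<forall>T. f T = cc * g T \<longrightarrow> _\<close>[rule_format, of "\<Sum>j=1..n. Z n j w"]
        unfolding E_def W by (auto simp: v_def e_def)
    qed
    note AE = this
    define B where "B = (b n)\<^sup>2 / real n * v + (2 * R + 2)"
    define Q where "Q = measure M {w \<in> space M. (1 / b n) *\<^sub>R (\<Sum>j=1..n. X j w) \<in> D}"
    have "(\<lambda>x. (1 / b n) *\<^sub>R x) -` D \<in> sets borel"
      by (intro borel_open continuous_open_vimage D continuous_intros)
    from tilted_lower_bound[OF small(3,4) PN iN dN this Em AE]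
    have lower: "mgf e ^ n * (exp (- B) * measure (N n) E) \<le> Q"
      by (simp add: B_def Q_def)
    have ne2: "(b n)\<^sup>2 / real n = real n * e\<^sup>2" using n by (simp add: e_def power_divide power2_eq_square)
    have "real n * e\<^sup>2 * v / 2 - 1 \<le> real n * (e\<^sup>2 * v / 2 - C * e ^ 3)"
      using elim(1) by (simp add: e_def[symmetric] algebra_simps)
    then have "exp (real n * e\<^sup>2 * v / 2 - 1) \<le> exp (real n * (e\<^sup>2 * v / 2 - C * e ^ 3))" by simp
    also have "\<dots> = exp (e\<^sup>2 * v / 2 - C * e ^ 3) ^ n" by (rule exp_of_nat_mult)
    also have "\<dots> \<le> mgf e ^ n" by (intro power_mono mgf[OF small(1,2)]) simp
    finally have Lapn: "exp (real n * e\<^sup>2 * v / 2 - 1) \<le> mgf e ^ n" .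
    have "exp (real n * e\<^sup>2 * v / 2 - 1) * (exp (- B) * (p * (sqrt n / b n))) \<le> mgf e ^ n * (exp (- B) * measure (N n) E)"
      using elim(3) Lapn p bn order_trans[OF exp_ge_zero Lapn] unfolding E_def
      by (intro mult_mono) auto
    with lower have le: "exp (real n * e\<^sup>2 * v / 2 - 1) * (exp (- B) * (p * (sqrt n / b n))) \<le> Q" by linarith
    define F where "F = 1 / sqrt n * b n * exp ((b n)\<^sup>2 / real n * (v / 2))"
    have F: "0 \<le> F" using bn by (simp add: F_def)
    have "exp (real n * e\<^sup>2 * v / 2 - 1) * (exp (- B) * (p * (sqrt n / b n))) * F
      = p * (exp (real n * e\<^sup>2 * v / 2 - 1) * exp (- B) * exp ((b n)\<^sup>2 / real n * (v / 2)))"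
      using bn n by (simp add: F_def)
    \<comment> \<open>The terms n e^2 v / 2, - n e^2 v and n e^2 v / 2 cancel, leaving -1 - (2 R +
      2).\<close>
    also have "exp (real n * e\<^sup>2 * v / 2 - 1) * exp (- B) * exp ((b n)\<^sup>2 / real n * (v / 2)) = exp (- (2 * R + 3))"
      unfolding exp_add[symmetric] B_def ne2 by (simp add: algebra_simps)
    finally have "p * exp (- (2 * R + 3)) \<le> Q * F"
      using mult_right_mono[OF le F] by simp
    also have "Q * F = real n powr (- 1 / 2) * b n * Q * exp ((b n)\<^sup>2 / real n * real_of_ereal (rate_function \<gamma> a0))"
    proof -
      have "real n powr (- 1 / 2) = 1 / sqrt n"
        using powr_minus[of "real n" "1 / 2"] by (simp add: powr_half_sqrt inverse_eq_divide)
      then show ?thesis by (simp add: F_def rate)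
    qed
    finally show ?case unfolding Q_def .
  qed
  then have "ereal (p * exp (- (2 * R + 3))) \<le> Liminf sequentially (\<lambda>n. ereal
           (real n powr (- 1 / 2) * b n *
            measure M {w \<in> space M. (1 / b n) *\<^sub>R (\<Sum>j=1..n. X j w) \<in> D} *
            exp ((b n)\<^sup>2 / real n * real_of_ereal (rate_function \<gamma> a0))))"
    by (intro Liminf_bounded) (simp only: ereal_less_eq)
  moreover have "0 < ereal (p * exp (- (2 * R + 3)))" using p by simp
  ultimately show ?thesis by (rule less_le_trans[rotated])
qed

end
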